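(* Let $\alpha\in\mathbb R$. Then: (i) if $\alpha\le-3$, $\Delta|_{C_c^\infty(M)}$ is essentially self-adjoint on $L^2(M,d\omega)$; (ii) if $\alpha\in(-3,-1]$, then $\widehat\Delta_0$ is not essentially self-adjoint on $L^2(\mathbb R\setminus\{0\},|x|^{-\alpha}dx)$, while $\widehat\Delta_k$ is essentially self-adjoint for every $k\in\mathbb Z\setminus\{0\}$ (in particular $\Delta|_{C_c^\infty(M)}$ is not essentially self-adjoint); (iii) if $\alpha\in(-1,1)$, then $\widehat\Delta_k$ is not essentially self-adjoint for every $k\in\mathbb Z$; (iv) if $\alpha\ge1$, $\Delta|_{C_c^\infty(M)}$ is essentially self-adjoint.
   Context: Fix $\alpha\in\mathbb R$. Let $\mathbb T=\mathbb R/2\pi\mathbb Z$ and $M=(\mathbb R\setminus\{0\})\times\mathbb T$ with coordinates $(x,\theta)$, endowed with the Riemannian metric $g=dx^2+|x|^{-2\alpha}d\theta^2$, whose Riemannian volume is $d\omega=|x|^{-\alpha}\,dx\,d\theta$. The Laplace–Beltrami operator is $\Delta=\partial_x^2+|x|^{2\alpha}\partial_\theta^2-\frac{\alpha}{x}\partial_x$; $\Delta|_{C_c^\infty(M)}$ denotes this operator as an unbounded operator on the real Hilbert space $L^2(M,d\omega)$ with domain $C_c^\infty(M)$. For $k\in\mathbb Z$, the $k$-th Fourier component is $\widehat\Delta_k=\partial_x^2-\frac{\alpha}{x}\partial_x-k^2|x|^{2\alpha}$, an unbounded operator on $L^2(\mathbb R\setminus\{0\},|x|^{-\alpha}dx)$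 with domain $C_c^\infty(\mathbb R\setminus\{0\})$; via Fourier series in $\theta$, $L^2(M,d\omega)=\bigoplus_{k\in\mathbb Z}H_k$ with $H_k\cong L^2(\mathbb R\setminus\{0\},|x|^{-\alpha}dx)$, and $\Delta$ acts on $H_k$ as $\widehat\Delta_k$. (Essential self-adjointness on the real space is equivalent to that on the corresponding complex space.) *)

theory Defs
  imports "HOL-Analysis.Analysis"
begin

text \<open>A function is in L^2(mu) (real-valued) if it is Borel measurable and square integrable.
  We work with representatives; all sets below are closed under a.e. modification,
  so they describe the usual objects on equivalence classes.\<close>

definition L2 :: "'a measure \<Rightarrow> ('a \<Rightarrow> real) \<Rightarrow> bool" where
  "L2 M f \<longleftrightarrow> f \<in> borel_measurable M \<and> integrable M (\<lambda>x. (f x)\<^sup>2)"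

definition L2_inner :: "'a measure \<Rightarrow> ('a \<Rightarrow> real) \<Rightarrow> ('a \<Rightarrow> real) \<Rightarrow> real" where
  "L2_inner M f g = (LINT x|M. f x * g x)"

definition L2_dist2 :: "'a measure \<Rightarrow> ('a \<Rightarrow> real) \<Rightarrow> ('a \<Rightarrow> real) \<Rightarrow> real" where
  "L2_dist2 M f g = (LINT x|M. (f x - g x)\<^sup>2)"

definition op_graph :: "('a \<Rightarrow> real) set \<Rightarrow> (('a \<Rightarrow> real) \<Rightarrow> ('a \<Rightarrow> real))
    \<Rightarrow> (('a \<Rightarrow> real) \<times> ('a \<Rightarrow> real)) set" where
  "op_graph D T = {(u, T u) | u. u \<in> D}"

definition L2_closure :: "'a measure \<Rightarrow> (('a \<Rightarrow> real) \<times> ('a \<Rightarrow> real)) set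
    \<Rightarrow> (('a \<Rightarrow> real) \<times> ('a \<Rightarrow> real)) set" where
  "L2_closure M G = {(u, f). L2 M u \<and> L2 M f \<and>
     (\<exists>s :: nat \<Rightarrow> ('a \<Rightarrow> real) \<times> ('a \<Rightarrow> real). (\<forall>n. s n \<in> G) \<and>
        (\<lambda>n. L2_dist2 M (fst (s n)) u) \<longlonglongrightarrow> 0 \<and>
        (\<lambda>n. L2_dist2 M (snd (s n)) f) \<longlonglongrightarrow> 0)}"

definition L2_adjoint :: "'a measure \<Rightarrow> (('a \<Rightarrow> real) \<times> ('a \<Rightarrow> real)) set
    \<Rightarrow> (('a \<Rightarrow> real) \<times> ('a \<Rightarrow> real)) set" where
  "L2_adjoint M G = {(v, w). L2 M v \<and> L2 M w \<and>
     (\<forall>(u, f) \<in> G. L2_inner M f v = L2_inner M u w)}"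

definition ess_self_adjoint :: "'a measure \<Rightarrow> ('a \<Rightarrow> real) set
    \<Rightarrow> (('a \<Rightarrow> real) \<Rightarrow> ('a \<Rightarrow> real)) \<Rightarrow> bool" where
  "ess_self_adjoint M D T \<longleftrightarrow>
     L2_adjoint M (L2_closure M (op_graph D T)) = L2_closure M (op_graph D T)"

definition smooth1_on :: "real set \<Rightarrow> (real \<Rightarrow> real) \<Rightarrow> bool" where
  "smooth1_on S f \<longleftrightarrow> (\<exists>D :: nat \<Rightarrow> real \<Rightarrow> real. D 0 = f \<and>
     (\<forall>n. \<forall>x\<in>S. (D n has_real_derivative D (Suc n) x) (at x)))"

definition smooth2_on :: "(real \<times> real) set \<Rightarrow> (real \<times> real \<Rightarrow> real) \<Rightarrow> bool" where
  "smooth2_on S f \<longleftrightarrow> (\<exists>D :: nat \<Rightarrow> nat \<Rightarrow> real \<times> real \<Rightarrow> real. D 0 0 = f \<and>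
     (\<forall>i j. continuous_on S (D i j) \<and>
        (\<forall>x t. (x, t) \<in> S \<longrightarrow>
           ((\<lambda>s. D i j (s, t)) has_real_derivative D (Suc i) j (x, t)) (at x) \<and>
           ((\<lambda>s. D i j (x, s)) has_real_derivative D i (Suc j) (x, t)) (at t))))"

definition Cc_line :: "(real \<Rightarrow> real) set" where
  "Cc_line = {u. smooth1_on (- {0}) u \<and>
     (\<exists>a b. 0 < a \<and> (\<forall>x. \<bar>x\<bar> < a \<or> b < \<bar>x\<bar> \<longrightarrow> u x = 0))}"

text \<open>C_c^infinity(M), M = (R \ {0}) x T, T = R/2piZ: functions of (x,theta) that are
  2pi-periodic in theta, smooth for x \<noteq> 0 and vanish for |x| near 0 and near infinity.\<close>
definition Cc_M :: "(real \<times> real \<Rightarrow> real) set" where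
  "Cc_M = {u. smooth2_on {p. fst p \<noteq> 0} u \<and>
     (\<forall>x t. u (x, t + 2 * pi) = u (x, t)) \<and>
     (\<exists>a b. 0 < a \<and> (\<forall>x t. \<bar>x\<bar> < a \<or> b < \<bar>x\<bar> \<longrightarrow> u (x, t) = 0))}"

text \<open>|x|^(-alpha) dx on R \ {0} (the point 0 is a null set; 0 powr _ = 0).\<close>
definition omega_line :: "real \<Rightarrow> real measure" where
  "omega_line \<alpha> = density lborel (\<lambda>x. ennreal (\<bar>x\<bar> powr (- \<alpha>)))"

text \<open>d omega = |x|^(-alpha) dx dtheta on M, the torus parametrised by theta in [0, 2pi).\<close>
definition omega_M :: "real \<Rightarrow> (real \<times> real) measure" where
  "omega_M \<alpha> = density lborel
     (\<lambda>p. ennreal (indicator {0..<2 * pi} (snd p) * \<bar>fst p\<bar> powr (- \<alpha>)))"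

definition lap_M :: "real \<Rightarrow> (real \<times> real \<Rightarrow> real) \<Rightarrow> (real \<times> real \<Rightarrow> real)" where
  "lap_M \<alpha> u = (\<lambda>(x, t).
      deriv (\<lambda>s. deriv (\<lambda>r. u (r, t)) s) x
    + \<bar>x\<bar> powr (2 * \<alpha>) * deriv (\<lambda>s. deriv (\<lambda>r. u (x, r)) s) t
    - (\<alpha> / x) * deriv (\<lambda>r. u (r, t)) x)"

text \<open>k-th Fourier component: u'' - (alpha/x) u' - k^2 |x|^(2 alpha) u.\<close>
definition lap_k :: "real \<Rightarrow> int \<Rightarrow> (real \<Rightarrow> real) \<Rightarrow> (real \<Rightarrow> real)" where
  "lap_k \<alpha> k u = (\<lambda>x. deriv (deriv u) x - (\<alpha> / x) * deriv u x
      - (of_int k)\<^sup>2 * \<bar>x\<bar> powr (2 * \<alpha>) * u x)"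

end

theory Submission
  imports Defs
begin

text \<open>The operators are symmetric and nonpositive, so essential self-adjointness amounts to the
  triviality of the square integrable weak solutions of \<open>T u = u\<close>.  On each half line such a
  solution is classical, and unless it vanishes it grows towards the origin or towards infinity
  at least like a multiple of \<open>\<bar>x\<bar> powr ((\<alpha> - 1) / 2)\<close> as soon as this function is a subsolution.
  Its square has the density \<open>1 / \<bar>x\<bar>\<close> with respect to \<open>dx\<close> once multiplied by the weight, hence is
  integrable at neither end.  It is a subsolution for every \<open>k\<close> if \<open>\<alpha> \<le> -3\<close> or \<open>1 \<le> \<alpha>\<close>, and
  for \<open>k \<noteq> 0\<close> if \<open>\<alpha> \<le> -1\<close>; Fourier series in the angle reduce the cylinder to the line.

  In the remaining cases the equation \<open>T u = 0\<close> becomes \<open>d\<^sup>2u/dy\<^sup>2 = k\<^sup>2 u\<close> in the variable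
  \<open>y = x powr (\<alpha> + 1) / (\<alpha> + 1)\<close> (and \<open>y = ln x\<close> if \<open>\<alpha> = -1\<close>), and both of its solutions are square
  integrable near the origin.  Cut off away from the origin, they belong to the domain of the
  adjoint and have a nonzero boundary form, so the adjoint is not symmetric.\<close>

section \<open>Square integrable functions and the self-adjointness criterion\<close>

text \<open>The thresholds come from writing \<open>u = |x| powr (\<alpha> / 2) * \<phi>\<close>,
  which turns the operator into \<open>\<phi>'' - (\<alpha> * (\<alpha> + 2) / 4) / x\<^sup>2 *
  \<phi> - k\<^sup>2 * |x| powr (2 * \<alpha>) * \<phi>\<close> without a weight. Weyl's limit point
  condition at the origin for a potential \<open>c / x\<^sup>2\<close> is
  \<open>3 / 4 \<le> c\<close>, that is \<open>0 \<le> (\<alpha> + 3) * (\<alpha> - 1)\<close>; the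
  borderline function \<open>x powr (-1/2)\<close> becomes the comparison function
  \<open>x powr ((\<alpha> - 1) / 2)\<close>. For \<open>k \<noteq> 0\<close> and
  \<open>\<alpha> = -1\<close> the total coefficient is \<open>k\<^sup>2 - 1 / 4\<close>, which for
  \<open>|k| = 1\<close> is exactly the threshold. No explicit solution is needed for the positive
  cases: at a point where a solution is positive, the sign of its conormal derivative decides
  whether it is pushed up towards infinity or towards the origin, and one comparison function is
  non-integrable at both ends. This is an order argument, hence the real equation
  \<open>T u = u\<close> with a definite sign instead of complex deficiency spaces. The origin
  separates two half lines that do not interact, so kernels are treated on the right and reflected,
  and pairs supported on the right suffice for the negative cases.\<close>

lemma L2_measurable [measurable_dest]: "L2 M f \<Longrightarrow> f \<in> borel_measurable M"
  by (simp add: L2_def)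

lemma L2_integrable_mult:
  assumes "L2 M f" "L2 M g" shows "integrable M (\<lambda>x. f x * g x)"
proof (rule Bochner_Integration.integrable_bound)
  show "integrable M (\<lambda>x. (f x)\<^sup>2 + (g x)\<^sup>2)" using assms by (auto simp: L2_def)
  show "(\<lambda>x. f x * g x) \<in> borel_measurable M" using assms by (auto simp: L2_def)
  have "\<bar>a * b\<bar> \<le> a\<^sup>2 + b\<^sup>2" for a b :: real
    using sum_squares_bound[of "\<bar>a\<bar>" "\<bar>b\<bar>"] mult_nonneg_nonneg[OF abs_ge_zero[of a] abs_ge_zero[of b]]
    unfolding abs_mult power2_abs by linarith
  then show "AE x in M. norm (f x * g x) \<le> norm ((f x)\<^sup>2 + (g x)\<^sup>2)" by simp
qed

lemma L2_cmult: "L2 M f \<Longrightarrow> L2 M (\<lambda>x. c * f x)"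
  by (auto simp: L2_def power_mult_distrib)

lemma L2_add:
  assumes "L2 M f" "L2 M g" shows "L2 M (\<lambda>x. f x + g x)"
  using assms L2_integrable_mult[OF assms]
  by (auto simp: L2_def power2_sum mult.assoc)

lemma L2_diff: "L2 M f \<Longrightarrow> L2 M g \<Longrightarrow> L2 M (\<lambda>x. f x - g x)"
  using L2_add[of M f "\<lambda>x. -1 * g x"] L2_cmult[of M g "-1"] by simp

lemma L2_inner_commute: "L2_inner M f g = L2_inner M g f"
  by (simp add: L2_inner_def mult.commute)

lemma L2_inner_add_left:
  "L2 M f \<Longrightarrow> L2 M g \<Longrightarrow> L2 M h \<Longrightarrow> L2_inner M (\<lambda>x. f x + g x) h = L2_inner M f h + L2_inner M g h"
  by (simp add: L2_inner_def distrib_right L2_integrable_mult)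

lemma L2_inner_diff_left:
  "L2 M f \<Longrightarrow> L2 M g \<Longrightarrow> L2 M h \<Longrightarrow> L2_inner M (\<lambda>x. f x - g x) h = L2_inner M f h - L2_inner M g h"
  by (simp add: L2_inner_def left_diff_distrib L2_integrable_mult)

lemma L2_inner_cmult_left: "L2_inner M (\<lambda>x. c * f x) h = c * L2_inner M f h"
  by (simp add: L2_inner_def mult.assoc)

lemma L2_inner_add_right:
  "L2 M f \<Longrightarrow> L2 M g \<Longrightarrow> L2 M h \<Longrightarrow> L2_inner M h (\<lambda>x. f x + g x) = L2_inner M h f + L2_inner M h g"
  by (simp add: L2_inner_commute[of M h] L2_inner_add_left)

lemma L2_inner_diff_right:
  "L2 M f \<Longrightarrow> L2 M g \<Longrightarrow> L2 M h \<Longrightarrow> L2_inner M h (\<lambda>x. f x - g x) = L2_inner M h f - L2_inner M h g"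
  by (simp add: L2_inner_commute[of M h] L2_inner_diff_left)

lemma L2_inner_cmult_right: "L2_inner M h (\<lambda>x. c * f x) = c * L2_inner M h f"
  by (simp add: L2_inner_commute[of M h] L2_inner_cmult_left)

lemma L2_inner_self_nonneg: "0 \<le> L2_inner M f f"
  by (simp add: L2_inner_def)

lemma L2_dist2_eq_inner: "L2_dist2 M f g = L2_inner M (\<lambda>x. f x - g x) (\<lambda>x. f x - g x)"
  by (simp add: L2_inner_def L2_dist2_def power2_eq_square)

text \<open>Serves twice: it gives the Cauchy--Schwarz inequality, and with \<open>a = 0\<close> it
  turns minimality of a quadratic functional into the vanishing of its linear term.\<close>

lemma quadratic_nonneg_imp_discriminant_le:
  fixes a b c :: real
  assumes "\<And>t. 0 \<le> a + 2 * t * b + t\<^sup>2 * c"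
  shows "b\<^sup>2 \<le> a * c"
proof (cases "c = 0")
  case True
  have "b = 0"
  proof (rule ccontr)
    assume "b \<noteq> 0"
    \<comment> \<open>At this point the affine function \<open>a + 2 * t * b\<close> has the value
      -1.\<close>
    then show False using assms[of "- (a + 1) / (2 * b)"] True by (simp add: field_simps)
  qed
  then show ?thesis using True by simp
next
  case False
  have "0 \<le> c"
  proof (rule ccontr)
    assume "\<not> 0 \<le> c"
    have "0 \<le> a + 2 * t * b + t\<^sup>2 * c + (a + 2 * (-t) * b + (-t)\<^sup>2 * c)" for t
      using assms[of t] assms[of "-t"] by linarith
    then have **: "0 \<le> (a + t\<^sup>2 * c) + (a + t\<^sup>2 * c)" for t by (simp add: algebra_simps)
    have *: "0 \<le> a + t\<^sup>2 * c" for t using **[of t] by (simp only: zero_le_double_add_iff_zero_le_single_add)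
    \<comment> \<open>Averaging over \<open>t\<close> and \<open>-t\<close> has removed the linear
      term; for this \<open>t\<close> what remains is \<open>a - (|a| + 1) < 0\<close>.\<close>
    have "sqrt ((\<bar>a\<bar> + 1) / - c) ^ 2 = (\<bar>a\<bar> + 1) / - c"
      using \<open>\<not> 0 \<le> c\<close> by (intro real_sqrt_pow2) (auto simp: divide_le_0_iff)
    with *[of "sqrt ((\<bar>a\<bar> + 1) / - c)"] False have "0 \<le> a - (\<bar>a\<bar> + 1)" by simp
    then show False by linarith
  qed
  with False have "0 < c" by simp
  have "0 \<le> a + 2 * (- b / c) * b + (- b / c)\<^sup>2 * c" by (rule assms)
  also have "\<dots> = (a * c - b\<^sup>2) / c"
    using \<open>0 < c\<close> by (simp add: field_simps power2_eq_square)
  finally show ?thesis using \<open>0 < c\<close> by (simp add: zero_le_divide_iff)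
qed

lemma L2_inner_add_cmult_self:
  assumes "L2 M f" "L2 M g"
  shows "L2_inner M (\<lambda>x. f x + t * g x) (\<lambda>x. f x + t * g x)
    = L2_inner M f f + 2 * t * L2_inner M f g + t\<^sup>2 * L2_inner M g g"
  using assms
  by (simp add: L2_inner_add_left L2_inner_add_right L2_add L2_cmult L2_inner_cmult_left
      L2_inner_cmult_right L2_inner_commute[of M g f] power2_eq_square algebra_simps)

lemma L2_Cauchy_Schwarz:
  assumes "L2 M f" "L2 M g"
  shows "(L2_inner M f g)\<^sup>2 \<le> L2_inner M f f * L2_inner M g g"
proof (rule quadratic_nonneg_imp_discriminant_le)
  fix t :: real
  have "0 \<le> L2_inner M (\<lambda>x. f x + t * g x) (\<lambda>x. f x + t * g x)" by (rule L2_inner_self_nonneg)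
  also note L2_inner_add_cmult_self[OF assms]
  finally show "0 \<le> L2_inner M f f + 2 * t * L2_inner M f g + t\<^sup>2 * L2_inner M g g" .
qed

lemma L2_inner_tendsto:
  assumes "\<And>n. L2 M (s n)" "L2 M f" "L2 M g" and lim: "(\<lambda>n. L2_dist2 M (s n) f) \<longlonglongrightarrow> 0"
  shows "(\<lambda>n. L2_inner M (s n) g) \<longlonglongrightarrow> L2_inner M f g"
proof -
  have "(\<lambda>n. (L2_inner M (s n) g - L2_inner M f g)\<^sup>2) \<longlonglongrightarrow> 0"
  proof (rule tendsto_sandwich[OF _ _ tendsto_const])
    show "\<forall>\<^sub>F n in sequentially. 0 \<le> (L2_inner M (s n) g - L2_inner M f g)\<^sup>2" by simp
    have "(L2_inner M (s n) g - L2_inner M f g)\<^sup>2 \<le> L2_dist2 M (s n) f * L2_inner M g g" for n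
      using L2_Cauchy_Schwarz[OF L2_diff[OF assms(1)[of n] assms(2)] assms(3)]
        L2_inner_diff_left[OF assms(1)[of n] assms(2,3)]
      by (simp add: L2_dist2_eq_inner)
    then show "\<forall>\<^sub>F n in sequentially. (L2_inner M (s n) g - L2_inner M f g)\<^sup>2
        \<le> L2_dist2 M (s n) f * L2_inner M g g" by simp
    show "(\<lambda>n. L2_dist2 M (s n) f * L2_inner M g g) \<longlonglongrightarrow> 0"
      using tendsto_mult_right[OF lim, of "L2_inner M g g"] by simp
  qed
  then have "(\<lambda>n. L2_inner M (s n) g - L2_inner M f g) \<longlonglongrightarrow> 0" by simp
  then show ?thesis by (rule LIM_zero_cancel)
qed

section \<open>Adjoints of closures and criteria for essential self-adjointness\<close>

text \<open>The adjoint relation survives limits in the graph because inner products are continuous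
  in the mean. Hence adjoint membership only has to be tested on the core.\<close>

lemma L2_adjoint_closure:
  assumes "\<And>u f. (u, f) \<in> G \<Longrightarrow> L2 M u \<and> L2 M f"
  shows "L2_adjoint M (L2_closure M G) = L2_adjoint M G"
proof (intro set_eqI iffI)
  fix p
  have sub: "G \<subseteq> L2_closure M G"
  proof
    fix q assume q: "q \<in> G"
    have "(\<lambda>n::nat. L2_dist2 M (fst q) (fst q)) \<longlonglongrightarrow> 0" "(\<lambda>n::nat. L2_dist2 M (snd q) (snd q)) \<longlonglongrightarrow> 0"
      by (simp_all add: L2_dist2_def)
    then have "\<exists>s::nat \<Rightarrow> _. (\<forall>n. s n \<in> G) \<and> (\<lambda>n. L2_dist2 M (fst (s n)) (fst q)) \<longlonglongrightarrow> 0
        \<and> (\<lambda>n. L2_dist2 M (snd (s n)) (snd q)) \<longlonglongrightarrow> 0"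
      using q by (intro exI[of _ "\<lambda>_. q"]) simp
    then show "q \<in> L2_closure M G"
      using assms[of "fst q" "snd q"] q unfolding L2_closure_def
      by (simp add: split_beta)
  qed
  then show "p \<in> L2_adjoint M G" if "p \<in> L2_adjoint M (L2_closure M G)"
    using that subsetD[OF sub] unfolding L2_adjoint_def by fast
  assume p: "p \<in> L2_adjoint M G"
  obtain v w where vw: "p = (v, w)" by (cases p)
  from p vw have L: "L2 M v" "L2 M w" and adj: "\<And>u f. (u, f) \<in> G \<Longrightarrow> L2_inner M f v = L2_inner M u w"
    by (auto simp: L2_adjoint_def)
  have "L2_inner M f v = L2_inner M u w" if "(u, f) \<in> L2_closure M G" for u f
  proof -
    from that obtain s where s: "L2 M u" "L2 M f" "\<And>n. s n \<in> G"
      "(\<lambda>n. L2_dist2 M (fst (s n)) u) \<longlonglongrightarrow> 0" "(\<lambda>n. L2_dist2 M (snd (s n)) f) \<longlonglongrightarrow> 0"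
      unfolding L2_closure_def by auto
    have Ls: "L2 M (fst (s n))" "L2 M (snd (s n))" for n
      using assms[of "fst (s n)" "snd (s n)"] s(3) by auto
    have "(\<lambda>n. L2_inner M (snd (s n)) v) \<longlonglongrightarrow> L2_inner M f v"
      "(\<lambda>n. L2_inner M (fst (s n)) w) \<longlonglongrightarrow> L2_inner M u w"
      by (rule L2_inner_tendsto[OF Ls(2) s(2) L(1) s(5)], rule L2_inner_tendsto[OF Ls(1) s(1) L(2) s(4)])
    moreover have "L2_inner M (snd (s n)) v = L2_inner M (fst (s n)) w" for n
      using adj[of "fst (s n)" "snd (s n)"] s(3) by simp
    ultimately show ?thesis by (simp add: LIMSEQ_unique)
  qed
  then show "p \<in> L2_adjoint M (L2_closure M G)" using L vw by (auto simp: L2_adjoint_def)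
qed

text \<open>If the closure were its own adjoint, both pairs would lie in it, and the adjoint
  relation applied to one against the other would give equality in the last assumption.\<close>

lemma not_ess_self_adjointI:
  assumes "\<And>u. u \<in> D \<Longrightarrow> L2 M u \<and> L2 M (T u)"
    and "(v\<^sub>1, w\<^sub>1) \<in> L2_adjoint M (op_graph D T)" "(v\<^sub>2, w\<^sub>2) \<in> L2_adjoint M (op_graph D T)"
    and "L2_inner M w\<^sub>1 v\<^sub>2 \<noteq> L2_inner M v\<^sub>1 w\<^sub>2"
  shows "\<not> ess_self_adjoint M D T"
proof
  assume "ess_self_adjoint M D T"
  then have sa: "L2_adjoint M (L2_closure M (op_graph D T)) = L2_closure M (op_graph D T)"
    by (simp add: ess_self_adjoint_def)
  have "L2_adjoint M (L2_closure M (op_graph D T)) = L2_adjoint M (op_graph D T)"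
    by (rule L2_adjoint_closure) (use assms(1) in \<open>auto simp: op_graph_def\<close>)
  then have "(v\<^sub>2, w\<^sub>2) \<in> L2_adjoint M (L2_closure M (op_graph D T))"
    and "(v\<^sub>1, w\<^sub>1) \<in> L2_closure M (op_graph D T)"
    using assms(2,3) sa by (simp_all only:)
  then have "L2_inner M w\<^sub>1 v\<^sub>2 = L2_inner M v\<^sub>1 w\<^sub>2"
    unfolding L2_adjoint_def by blast
  then show False using assms(4) by contradiction
qed

text \<open>A weighted sum makes the increments absolutely summable almost everywhere;
  Fatou's lemma then upgrades pointwise convergence to convergence in the mean.\<close>
lemma L2_complete_fast:
  assumes L: "\<And>n. L2 M (s n)" and fast: "\<And>n. L2_dist2 M (s (Suc n)) (s n) \<le> C * (1/4) ^ n"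
    and cauchy: "\<And>e. e > 0 \<Longrightarrow> \<exists>N. \<forall>n\<ge>N. \<forall>m\<ge>N. L2_dist2 M (s m) (s n) \<le> e"
  obtains f where "L2 M f" "(\<lambda>n. L2_dist2 M (s n) f) \<longlonglongrightarrow> 0"
proof -
  have [measurable]: "s n \<in> borel_measurable M" for n using L by (simp add: L2_def)
  have intd: "integrable M (\<lambda>x. (s m x - s n x)\<^sup>2)" for m n
    using L2_diff[OF L L, of m n] by (simp add: L2_def)
  have C0: "0 \<le> C" using fast[of 0] L2_inner_self_nonneg[of M "\<lambda>x. s 1 x - s 0 x"]
    by (simp add: L2_dist2_eq_inner)
  have "(\<integral>\<^sup>+ x. (\<Sum>n. ennreal (2 ^ n * (s (Suc n) x - s n x)\<^sup>2)) \<partial>M)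
      = (\<Sum>n. \<integral>\<^sup>+ x. ennreal (2 ^ n * (s (Suc n) x - s n x)\<^sup>2) \<partial>M)"
    by (rule nn_integral_suminf) simp
  also have "\<dots> = (\<Sum>n. ennreal (2 ^ n * L2_dist2 M (s (Suc n)) (s n)))"
    by (subst nn_integral_eq_integral) (auto intro!: integrable_mult_right intd simp: L2_dist2_def)
  \<comment> \<open>The weight \<open>2 ^ n\<close> consumes only half of the decay
    \<open>(1/4) ^ n\<close>, so a geometric series is left.\<close>
  also have "\<dots> \<le> (\<Sum>n. ennreal (C * (1/2) ^ n))"
  proof (intro suminf_le ennreal_leI)
    fix n
    have "2 ^ n * L2_dist2 M (s (Suc n)) (s n) \<le> 2 ^ n * (C * (1/4) ^ n)"
      by (intro mult_left_mono fast) simp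
    also have "\<dots> = C * (1/2) ^ n"
    proof -
      have "(1/2::real) ^ n = (2 * (1/4)) ^ n" by simp
      also have "\<dots> = 2 ^ n * (1/4) ^ n" by (rule power_mult_distrib)
      finally show ?thesis by simp
    qed
    finally show "2 ^ n * L2_dist2 M (s (Suc n)) (s n) \<le> C * (1/2) ^ n" .
  qed auto
  also have "\<dots> < \<infinity>"
    using C0 by (subst suminf_ennreal2) (auto intro!: summable_mult)
  finally have "AE x in M. (\<Sum>n. ennreal (2 ^ n * (s (Suc n) x - s n x)\<^sup>2)) \<noteq> \<infinity>"
    by (intro nn_integral_PInf_AE) auto
  then have conv: "AE x in M. convergent (\<lambda>n. s n x)"
  proof eventually_elim
    case (elim x)
    let ?a = "\<lambda>n. 2 ^ n * (s (Suc n) x - s n x)\<^sup>2"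
    have sum: "summable ?a" using elim by (intro summable_suminf_not_top) auto
    have "summable (\<lambda>n. norm (s (Suc n) x - s n x))"
    proof (rule summable_comparison_test')
      show "summable (\<lambda>n. (1/2) ^ n + ?a n)" by (intro summable_add sum) simp
      fix n :: nat
      \<comment> \<open>With \<open>y = 2 ^ n * |d|\<close> this is
        \<open>y \<le> 1 + y\<^sup>2\<close> divided by \<open>2 ^ n\<close>. It trades the weighted
        squares for absolute summability.\<close>
      have "\<bar>d\<bar> \<le> (1/2) ^ n + 2 ^ n * d\<^sup>2" for d :: real
      proof -
        have "(1/2) ^ n + 2 ^ n * d\<^sup>2 - \<bar>d\<bar> = (1/2) ^ n * (1 - (2 ^ n * \<bar>d\<bar>) + (2 ^ n * \<bar>d\<bar>)\<^sup>2)"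
          by (simp add: field_simps power2_eq_square)
        moreover have "1 - y + y\<^sup>2 \<ge> 0" for y :: real
        proof -
          have "1 - y + y\<^sup>2 = (y - 1/2)\<^sup>2 + 3/4" by (simp add: power2_eq_square algebra_simps)
          then show ?thesis by simp
        qed
        ultimately have "(1/2) ^ n + 2 ^ n * d\<^sup>2 - \<bar>d\<bar> \<ge> 0" by simp
        then show ?thesis by simp
      qed
      then show "norm (norm (s (Suc n) x - s n x)) \<le> (1/2) ^ n + ?a n" by simp
    qed
    then have "summable (\<lambda>n. s (Suc n) x - s n x)" by (rule summable_norm_cancel)
    then have "convergent (\<lambda>n. \<Sum>i<n. s (Suc i) x - s i x)" by (simp add: summable_iff_convergent)
    then have "convergent (\<lambda>n. s n x - s 0 x)" using sum_lessThan_telescope[of "\<lambda>i. s i x"] by simp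
    then have "convergent (\<lambda>n. (s n x - s 0 x) + s 0 x)" by (intro convergent_add convergent_const)
    then show ?case by simp
  qed
  define f where "f x = lim (\<lambda>n. s n x)" for x
  have [measurable]: "f \<in> borel_measurable M" unfolding f_def by measurable
  have lim: "AE x in M. (\<lambda>n. s n x) \<longlonglongrightarrow> f x"
    using conv by eventually_elim (simp add: f_def convergent_LIMSEQ_iff)
  have bound: "(\<integral>\<^sup>+x. ennreal ((s m x - f x)\<^sup>2) \<partial>M) \<le> ennreal e"
    if e: "e > 0" "\<forall>n\<ge>N. L2_dist2 M (s m) (s n) \<le> e" for m N e
  proof -
    have "(\<integral>\<^sup>+x. ennreal ((s m x - f x)\<^sup>2) \<partial>M)
        = (\<integral>\<^sup>+x. liminf (\<lambda>n. ennreal ((s m x - s n x)\<^sup>2)) \<partial>M)"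
    proof (rule nn_integral_cong_AE, use lim in eventually_elim)
      fix x assume "(\<lambda>n. s n x) \<longlonglongrightarrow> f x"
      then have "(\<lambda>n. ennreal ((s m x - s n x)\<^sup>2)) \<longlonglongrightarrow> ennreal ((s m x - f x)\<^sup>2)"
        by (intro tendsto_ennrealI tendsto_intros)
      from lim_imp_Liminf[OF _ this] show "ennreal ((s m x - f x)\<^sup>2) = liminf (\<lambda>n. ennreal ((s m x - s n x)\<^sup>2))"
        by simp
    qed
    also have "\<dots> \<le> liminf (\<lambda>n. \<integral>\<^sup>+x. ennreal ((s m x - s n x)\<^sup>2) \<partial>M)"
      by (rule nn_integral_liminf) simp
    also have "\<dots> = liminf (\<lambda>n. ennreal (L2_dist2 M (s m) (s n)))"
      by (subst nn_integral_eq_integral[OF intd]) (auto simp: L2_dist2_def)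
    also have "\<dots> \<le> liminf (\<lambda>n::nat. ennreal e)"
      by (intro Liminf_mono eventually_sequentiallyI[of N] ennreal_leI) (use e in auto)
    finally show ?thesis by (simp add: Liminf_const)
  qed
  have Lsf: "L2 M (\<lambda>x. s m x - f x)" if "(\<integral>\<^sup>+x. ennreal ((s m x - f x)\<^sup>2) \<partial>M) \<le> ennreal e" for m e
    using that unfolding L2_def
    by (auto intro!: integrableI_bounded simp: le_less_trans)
  obtain N where N: "\<forall>n\<ge>N. \<forall>m\<ge>N. L2_dist2 M (s m) (s n) \<le> 1" using cauchy[of 1] by auto
  have "L2 M (\<lambda>x. s N x - f x)" using N by (intro Lsf[OF bound[of 1 N N]]) auto
  from L2_diff[OF L[of N] this] have Lf: "L2 M f" by simp
  moreover have "(\<lambda>n. L2_dist2 M (s n) f) \<longlonglongrightarrow> 0"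
  proof (rule LIMSEQ_I)
    fix r :: real assume "r > 0"
    then obtain N where N: "\<forall>n\<ge>N. \<forall>m\<ge>N. L2_dist2 M (s m) (s n) \<le> r/2" using cauchy[of "r/2"] by auto
    have "L2_dist2 M (s m) f \<le> r/2" if "m \<ge> N" for m
    proof -
      have "ennreal (L2_dist2 M (s m) f) = (\<integral>\<^sup>+x. ennreal ((s m x - f x)\<^sup>2) \<partial>M)"
        using L2_diff[OF L Lf, of m] unfolding L2_dist2_def
        by (intro nn_integral_eq_integral[symmetric]) (auto simp: L2_def)
      also have "\<dots> \<le> ennreal (r/2)"
        using bound[of "r/2" N m] N that \<open>r > 0\<close> by auto
      finally have "ennreal (L2_dist2 M (s m) f) \<le> ennreal (r/2)" .
      then show ?thesis using \<open>r > 0\<close> by (subst (asm) ennreal_le_iff) auto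
    qed
    note le = this
    have "norm (L2_dist2 M (s m) f - 0) < r" if "m \<ge> N" for m
      using le[OF that] \<open>r > 0\<close> L2_inner_self_nonneg[of M "\<lambda>x. s m x - f x"]
      by (simp add: L2_dist2_eq_inner)
    then show "\<exists>no. \<forall>n\<ge>no. norm (L2_dist2 M (s n) f - 0) < r" by blast
  qed
  ultimately show ?thesis using that by blast
qed

lemma L2_AE_cong_dist2:
  assumes "L2 M (s::'a \<Rightarrow> real)" "L2 M f" "L2 M g" "AE x in M. f x = g x"
  shows "L2_dist2 M s f = L2_dist2 M s g"
  unfolding L2_dist2_def
  using assms by (intro integral_cong_AE) (auto simp: L2_def)

text \<open>For nonpositive \<open>T\<close>, \<open>T - 1\<close> is coercive, so a minimising sequence for the distance of
  \<open>w - v\<close> to its range converges in the graph norm.  The minimality condition puts the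
  remainder into the kernel of the adjoint of \<open>T - 1\<close>.\<close>
lemma ess_self_adjoint_criterion:
  fixes T :: "('a \<Rightarrow> real) \<Rightarrow> ('a \<Rightarrow> real)"
  assumes D0: "D \<noteq> {}"
    and D_lin: "\<And>u v c. u \<in> D \<Longrightarrow> v \<in> D \<Longrightarrow> (\<lambda>x. u x + c * v x) \<in> D"
    and T_lin: "\<And>u v c. u \<in> D \<Longrightarrow> v \<in> D \<Longrightarrow> T (\<lambda>x. u x + c * v x) = (\<lambda>x. T u x + c * T v x)"
    and L: "\<And>u. u \<in> D \<Longrightarrow> L2 M u" and LT: "\<And>u. u \<in> D \<Longrightarrow> L2 M (T u)"
    and sym: "\<And>u v. u \<in> D \<Longrightarrow> v \<in> D \<Longrightarrow> L2_inner M (T u) v = L2_inner M u (T v)"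
    and neg: "\<And>u. u \<in> D \<Longrightarrow> L2_inner M (T u) u \<le> 0"
    and ker: "\<And>h. L2 M h \<Longrightarrow> (\<And>u. u \<in> D \<Longrightarrow> L2_inner M (T u) h = L2_inner M u h) \<Longrightarrow> AE x in M. h x = 0"
  shows "ess_self_adjoint M D T"
proof -
  let ?G = "op_graph D T"
  let ?y = "\<lambda>u x. T u x - u x"
  have adj: "L2_adjoint M (L2_closure M ?G) = L2_adjoint M ?G"
    by (rule L2_adjoint_closure) (use L LT in \<open>auto simp: op_graph_def\<close>)
  have Ly: "L2 M (?y u)" if "u \<in> D" for u by (intro L2_diff L LT that)
  have sub1: "L2_closure M ?G \<subseteq> L2_adjoint M ?G"
  proof
    fix p assume "p \<in> L2_closure M ?G"
    then obtain u f s where p: "p = (u, f)" "L2 M u" "L2 M f" "\<And>n. s n \<in> ?G"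
      "(\<lambda>n. L2_dist2 M (fst (s n)) u) \<longlonglongrightarrow> 0" "(\<lambda>n. L2_dist2 M (snd (s n)) f) \<longlonglongrightarrow> 0"
      unfolding L2_closure_def by auto
    have s: "fst (s n) \<in> D" "snd (s n) = T (fst (s n))" for n
      using p(4)[of n] by (auto simp: op_graph_def)
    have "L2_inner M (T \<phi>) u = L2_inner M \<phi> f" if \<phi>: "\<phi> \<in> D" for \<phi>
    proof -
      have "(\<lambda>n. L2_inner M (fst (s n)) (T \<phi>)) \<longlonglongrightarrow> L2_inner M u (T \<phi>)"
        by (rule L2_inner_tendsto[OF L[OF s(1)] p(2) LT[OF \<phi>] p(5)])
      moreover have "(\<lambda>n. L2_inner M (snd (s n)) \<phi>) \<longlonglongrightarrow> L2_inner M f \<phi>"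
        by (rule L2_inner_tendsto[OF _ p(3) L[OF \<phi>] p(6)]) (simp add: s LT)
      moreover have "L2_inner M (fst (s n)) (T \<phi>) = L2_inner M (snd (s n)) \<phi>" for n
        using sym[OF s(1) \<phi>, of n] by (simp add: s)
      ultimately have "L2_inner M u (T \<phi>) = L2_inner M f \<phi>" by (simp add: LIMSEQ_unique)
      then show ?thesis by (simp add: L2_inner_commute)
    qed
    then show "p \<in> L2_adjoint M ?G" using p by (auto simp: L2_adjoint_def op_graph_def)
  qed
  \<comment> \<open>In the expansion of the squared norm of \<open>T u - u\<close> the cross term is
    nonnegative by \<open>neg\<close>, so that norm controls \<open>u\<close> and \<open>T u\<close>
    separately.\<close>
  have coer: "L2_inner M u u \<le> L2_inner M (?y u) (?y u)"
    "L2_inner M (T u) (T u) \<le> L2_inner M (?y u) (?y u)" if "u \<in> D" for u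
  proof -
    have "L2_inner M (?y u) (?y u) = L2_inner M (T u) (T u) - 2 * L2_inner M (T u) u + L2_inner M u u"
      unfolding L2_inner_diff_left[OF LT[OF that] L[OF that] Ly[OF that]]
        L2_inner_diff_right[OF LT[OF that] L[OF that] L[OF that]]
        L2_inner_diff_right[OF LT[OF that] L[OF that] LT[OF that]]
      by (simp add: L2_inner_commute[of M u "T u"])
    then show "L2_inner M u u \<le> L2_inner M (?y u) (?y u)"
      "L2_inner M (T u) (T u) \<le> L2_inner M (?y u) (?y u)"
      using neg[OF that] L2_inner_self_nonneg[of M u] L2_inner_self_nonneg[of M "T u"] by linarith+
  qed
  have sub2: "L2_adjoint M ?G \<subseteq> L2_closure M ?G"
  proof
    fix p assume "p \<in> L2_adjoint M ?G"
    then obtain v w where p: "p = (v, w)" and Lv: "L2 M v" and Lw: "L2 M w"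
      and vw: "\<And>u. u \<in> D \<Longrightarrow> L2_inner M (T u) v = L2_inner M u w"
      unfolding L2_adjoint_def op_graph_def by auto
    \<comment> \<open>\<open>J u\<close> below is the squared distance from \<open>T u - u\<close>
      to this target, and \<open>d\<close> is its infimum over the domain.\<close>
    define g where "g x = w x - v x" for x
    have Lg: "L2 M g" unfolding g_def by (intro L2_diff Lv Lw)
    define J where "J u = L2_inner M (\<lambda>x. ?y u x - g x) (\<lambda>x. ?y u x - g x)" for u
    define d where "d = Inf (J ` D)"
    have bdd: "bdd_below (J ` D)" by (rule bdd_belowI2[of _ 0]) (simp add: J_def L2_inner_self_nonneg)
    have dle: "d \<le> J u" if "u \<in> D" for u unfolding d_def using that by (intro cInf_lower bdd) auto
    have "\<exists>u\<in>D. J u < d + (1/4) ^ n" for n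
      using cInf_lessD[of "J ` D" "d + (1/4)^n"] D0 by (auto simp: d_def)
    then obtain u where u: "\<And>n. u n \<in> D" "\<And>n::nat. J (u n) < d + (1/4) ^ n" by metis
    have Jexp: "J (\<lambda>x. a x + c * b x) = J a + 2 * c * L2_inner M (\<lambda>x. ?y a x - g x) (?y b) + c\<^sup>2 * L2_inner M (?y b) (?y b)"
      if a: "a \<in> D" and b: "b \<in> D" for a b c
    proof -
      let ?A = "\<lambda>x. ?y a x - g x" and ?B = "?y b"
      have L': "L2 M ?A" "L2 M ?B" "L2 M (\<lambda>x. c * ?B x)" 
        by (rule L2_diff[OF Ly[OF a] Lg] Ly[OF b] L2_cmult[OF Ly[OF b]])+
      have "(\<lambda>x. ?y (\<lambda>x. a x + c * b x) x - g x) = (\<lambda>x. ?A x + c * ?B x)"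
        by (simp add: T_lin[OF a b] algebra_simps)
      then have "J (\<lambda>x. a x + c * b x) = L2_inner M (\<lambda>x. ?A x + c * ?B x) (\<lambda>x. ?A x + c * ?B x)"
        unfolding J_def by simp
      also note L2_inner_add_cmult_self[OF L'(1,2)]
      finally show ?thesis unfolding J_def .
    qed
    have yd: "?y (\<lambda>x. a x + (-1) * b x) = (\<lambda>x. ?y a x - ?y b x)" if "a \<in> D" "b \<in> D" for a b
      unfolding T_lin[OF that] by (simp add: algebra_simps)
    have ybound: "L2_dist2 M (?y (u n)) (?y (u m)) \<le> 2 * (1/4) ^ n + 2 * (1/4) ^ m" for n m
    proof -
      let ?b = "\<lambda>x. u n x + (-1) * u m x"
      have b: "?b \<in> D" by (intro D_lin u)
      have "J (\<lambda>x. u m x + 1 * ?b x) = J (u n)" by simp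
      then have "J (u n) = J (u m) + 2 * L2_inner M (\<lambda>x. ?y (u m) x - g x) (?y ?b) + L2_inner M (?y ?b) (?y ?b)"
        using Jexp[OF u(1)[of m] b, of 1] by simp
      \<comment> \<open>Parallelogram argument: the midpoint of \<open>u n\<close> and
        \<open>u m\<close> belongs to \<open>D\<close>, so its value is at least the
        infimum.\<close>
      moreover have "d \<le> J (u m) + L2_inner M (\<lambda>x. ?y (u m) x - g x) (?y ?b) + (1/2)\<^sup>2 * L2_inner M (?y ?b) (?y ?b)"
        using dle[OF D_lin[OF u(1)[of m] b, of "1/2"]] Jexp[OF u(1)[of m] b, of "1/2"] by simp
      ultimately have "L2_inner M (?y ?b) (?y ?b) \<le> 2 * J (u n) + 2 * J (u m) - 4 * d"
        by (simp add: power2_eq_square)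
      then show ?thesis using u(2)[of n] u(2)[of m]
        unfolding yd[OF u(1)[of n] u(1)[of m]] L2_dist2_eq_inner by linarith
    qed
    have ubound: "L2_dist2 M (u n) (u m) \<le> 2 * (1/4) ^ n + 2 * (1/4) ^ m" 
      "L2_dist2 M (T (u n)) (T (u m)) \<le> 2 * (1/4) ^ n + 2 * (1/4) ^ m" for n m
    proof -
      let ?b = "\<lambda>x. u n x + (-1) * u m x"
      have b: "?b \<in> D" by (intro D_lin u)
      have "L2_inner M (?y ?b) (?y ?b) \<le> 2 * (1/4) ^ n + 2 * (1/4) ^ m"
        using ybound[of n m] unfolding yd[OF u(1)[of n] u(1)[of m]] L2_dist2_eq_inner .
      with coer[OF b]
      show "L2_dist2 M (u n) (u m) \<le> 2 * (1/4) ^ n + 2 * (1/4) ^ m" 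
      "L2_dist2 M (T (u n)) (T (u m)) \<le> 2 * (1/4) ^ n + 2 * (1/4) ^ m"
        unfolding L2_dist2_eq_inner T_lin[OF u(1)[of n] u(1)[of m]] by simp_all
    qed
    have small: "\<exists>N. \<forall>n\<ge>N. \<forall>m\<ge>N. 2 * (1/4::real) ^ m + 2 * (1/4) ^ n \<le> e" if "e > 0" for e
    proof -
      from that have "0 < e / 4" by simp
      then obtain N where N: "(1/4::real) ^ N < e / 4"
        using real_arch_pow_inv[of "e/4" "1/4"] by (simp only:) fastforce
      have le: "(1/4::real) ^ n < e / 4" if "n \<ge> N" for n
      proof -
        have "(1/4::real) ^ n \<le> (1/4) ^ N" using that by (intro power_decreasing) auto
        with N show ?thesis by linarith
      qed
      have "2 * (1/4::real) ^ m + 2 * (1/4) ^ n \<le> e" if "n \<ge> N" "m \<ge> N" for n m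
        using le[OF that(1)] le[OF that(2)] by argo
      then show ?thesis by blast
    qed
    have fast: "2 * (1/4::real) ^ Suc n + 2 * (1/4) ^ n \<le> 4 * (1/4) ^ n" for n by simp
    obtain u' where u': "L2 M u'" "(\<lambda>n. L2_dist2 M (u n) u') \<longlonglongrightarrow> 0"
    proof (rule L2_complete_fast[of M u 4])
      show "L2 M (u n)" for n by (rule L[OF u(1)])
      show "L2_dist2 M (u (Suc n)) (u n) \<le> 4 * (1/4) ^ n" for n
        using order_trans[OF ubound(1) fast] .
      show "\<exists>N. \<forall>n\<ge>N. \<forall>m\<ge>N. L2_dist2 M (u m) (u n) \<le> e" if "e > 0" for e
        using small[OF that] order_trans[OF ubound(1)] by meson
    qed blast
    obtain f where f: "L2 M f" "(\<lambda>n. L2_dist2 M (T (u n)) f) \<longlonglongrightarrow> 0"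
    proof (rule L2_complete_fast[of M "\<lambda>n. T (u n)" 4])
      show "L2 M (T (u n))" for n by (rule LT[OF u(1)])
      show "L2_dist2 M (T (u (Suc n))) (T (u n)) \<le> 4 * (1/4) ^ n" for n
        using order_trans[OF ubound(2) fast] .
      show "\<exists>N. \<forall>n\<ge>N. \<forall>m\<ge>N. L2_dist2 M (T (u m)) (T (u n)) \<le> e" if "e > 0" for e
        using small[OF that] order_trans[OF ubound(2)] by meson
    qed blast
    \<comment> \<open>\<open>f - u'\<close> is the limit of \<open>T (u n) - u n\<close> and thus
      the best approximation of \<open>g\<close>; \<open>h\<close> is the remainder, orthogonal to
      the range of \<open>T - 1\<close>.\<close>
    define h where "h x = g x - (f x - u' x)" for x
    have Lh: "L2 M h" unfolding h_def by (intro L2_diff Lg f u')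
    have Jlim: "(\<lambda>n. J (u n)) \<longlonglongrightarrow> d"
    proof (rule tendsto_sandwich[of "\<lambda>_. d" _ _ "\<lambda>n. d + (1/4) ^ n"])
      show "(\<lambda>n. d + (1/4) ^ n) \<longlonglongrightarrow> d"
        using tendsto_add[OF tendsto_const LIMSEQ_power_zero[of "1/4::real"], of d] by simp
    qed (use dle[OF u(1)] u(2) in \<open>auto intro!: always_eventually less_imp_le\<close>)
    have "AE x in M. h x = 0"
    proof (rule ker[OF Lh])
      fix \<phi> assume \<phi>: "\<phi> \<in> D"
      let ?\<psi> = "?y \<phi>"
      have L\<psi>: "L2 M ?\<psi>" by (rule Ly[OF \<phi>])
      have expand: "L2_inner M (\<lambda>x. T (u n) x - u n x - g x) ?\<psi>
           = L2_inner M (T (u n)) ?\<psi> - L2_inner M (u n) ?\<psi> - L2_inner M g ?\<psi>" for n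
        by (simp add: L2_inner_diff_left L2_diff L LT u Lg L\<psi>)
      have "(\<lambda>n. L2_inner M (T (u n)) ?\<psi> - L2_inner M (u n) ?\<psi> - L2_inner M g ?\<psi>) \<longlonglongrightarrow>
          L2_inner M f ?\<psi> - L2_inner M u' ?\<psi> - L2_inner M g ?\<psi>"
        by (intro tendsto_diff tendsto_const L2_inner_tendsto L\<psi> f u' L[OF u(1)] LT[OF u(1)])
      also have "L2_inner M f ?\<psi> - L2_inner M u' ?\<psi> - L2_inner M g ?\<psi> = - L2_inner M h ?\<psi>"
        unfolding h_def by (simp add: L2_inner_diff_left L2_diff f u' Lg L\<psi>)
      finally have lim: "(\<lambda>n. L2_inner M (\<lambda>x. T (u n) x - u n x - g x) ?\<psi>) \<longlonglongrightarrow> - L2_inner M h ?\<psi>"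
        unfolding expand .
      have "0 \<le> 0 + 2 * t * (- L2_inner M h ?\<psi>) + t\<^sup>2 * L2_inner M ?\<psi> ?\<psi>" for t
      proof -
        have "(\<lambda>n. J (u n) + 2 * t * L2_inner M (\<lambda>x. T (u n) x - u n x - g x) ?\<psi> + t\<^sup>2 * L2_inner M ?\<psi> ?\<psi>)
          \<longlonglongrightarrow> d + 2 * t * (- L2_inner M h ?\<psi>) + t\<^sup>2 * L2_inner M ?\<psi> ?\<psi>"
          by (intro tendsto_intros Jlim lim)
        moreover have "d \<le> J (u n) + 2 * t * L2_inner M (\<lambda>x. T (u n) x - u n x - g x) ?\<psi> + t\<^sup>2 * L2_inner M ?\<psi> ?\<psi>" for n
          using dle[OF D_lin[OF u(1)[of n] \<phi>, of t]] unfolding Jexp[OF u(1)[of n] \<phi>, of t] .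
        ultimately have "d \<le> d + 2 * t * (- L2_inner M h ?\<psi>) + t\<^sup>2 * L2_inner M ?\<psi> ?\<psi>"
          by (intro LIMSEQ_le_const) auto
        then show ?thesis by simp
      qed
      \<comment> \<open>The constant term is 0, so the discriminant bound kills the linear
        coefficient.\<close>
      from quadratic_nonneg_imp_discriminant_le[OF this] have "L2_inner M h ?\<psi> = 0" by simp
      then have "L2_inner M ?\<psi> h = 0" by (simp add: L2_inner_commute)
      then show "L2_inner M (T \<phi>) h = L2_inner M \<phi> h"
        by (simp add: L2_inner_diff_left L LT \<phi> Lh)
    qed
    have uf: "(u', f) \<in> L2_closure M ?G"
      unfolding L2_closure_def op_graph_def using u u' f
      by (auto intro!: exI[of _ "\<lambda>n. (u n, T (u n))"])
    \<comment> \<open>Both \<open>(v, w)\<close> and \<open>(u', f)\<close> satisfy the adjoint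
      relation, and \<open>h = 0\<close> says \<open>w - f = v - u'\<close> almost everywhere. So
      \<open>k\<close> lies in the same kernel and vanishes too.\<close>
    define k where "k x = v x - u' x" for x
    have Lk: "L2 M k" unfolding k_def by (intro L2_diff Lv u')
    have "AE x in M. k x = 0"
    proof (rule ker[OF Lk])
      fix \<phi> assume \<phi>: "\<phi> \<in> D"
      have "L2_inner M (T \<phi>) u' = L2_inner M \<phi> f"
        using subsetD[OF sub1 uf] \<phi> by (auto simp: L2_adjoint_def op_graph_def)
      then have "L2_inner M (T \<phi>) k = L2_inner M \<phi> (\<lambda>x. w x - f x)"
        unfolding k_def by (simp add: L2_inner_diff_right L LT \<phi> Lv Lw u' f vw)
      also have "\<dots> = L2_inner M \<phi> k"
        unfolding L2_inner_def
      proof (rule integral_cong_AE)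
        show "AE x in M. \<phi> x * (w x - f x) = \<phi> x * k x"
          using \<open>AE x in M. h x = 0\<close> by eventually_elim (simp add: h_def g_def k_def)
      qed (use L[OF \<phi>] Lw f Lk in \<open>auto simp: L2_def\<close>)
      finally show "L2_inner M (T \<phi>) k = L2_inner M \<phi> k" .
    qed
    then have AE: "AE x in M. u' x = v x" "AE x in M. f x = w x"
      using \<open>AE x in M. h x = 0\<close> by (eventually_elim, simp add: h_def g_def k_def)+
    have "(\<lambda>n. L2_dist2 M (u n) v) \<longlonglongrightarrow> 0" "(\<lambda>n. L2_dist2 M (T (u n)) w) \<longlonglongrightarrow> 0"
      using u' f L2_AE_cong_dist2[OF L[OF u(1)] u'(1) Lv AE(1)] L2_AE_cong_dist2[OF LT[OF u(1)] f(1) Lw AE(2)]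
      by simp_all
    then show "p \<in> L2_closure M ?G"
      unfolding p L2_closure_def op_graph_def using u Lv Lw
      by (auto intro!: exI[of _ "\<lambda>n. (u n, T (u n))"])
  qed
  show ?thesis unfolding ess_self_adjoint_def adj using sub1 sub2 by (rule equalityI[rotated])
qed

section \<open>Smooth functions and integration on the line\<close>

text \<open>Smoothness asks for a whole sequence of derivatives. Choosing a derivative inside a
  class that is closed under differentiation and iterating the choice produces it.\<close>

lemma smooth1_on_coinduct:
  assumes "f \<in> F"
    and step: "\<And>g. g \<in> F \<Longrightarrow> \<exists>g'\<in>F. \<forall>x\<in>S. (g has_real_derivative g' x) (at x)"
  shows "smooth1_on S f"
proof -
  obtain d where d: "\<And>g. g \<in> F \<Longrightarrow> d g \<in> F \<and> (\<forall>x\<in>S. (g has_real_derivative d g x) (at x))"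
    using step by metis
  have "(d ^^ n) f \<in> F" for n by (induction n) (use assms(1) d in auto)
  then show ?thesis unfolding smooth1_on_def using d
    by (intro exI[of _ "\<lambda>n. (d ^^ n) f"]) auto
qed

lemma smooth1_onD:
  assumes "smooth1_on S f"
  shows "\<exists>f'. smooth1_on S f' \<and> (\<forall>x\<in>S. (f has_real_derivative f' x) (at x))"
proof -
  obtain D where D: "D 0 = f" "\<And>n x. x \<in> S \<Longrightarrow> (D n has_real_derivative D (Suc n) x) (at x)"
    using assms unfolding smooth1_on_def by blast
  have "smooth1_on S (D 1)" unfolding smooth1_on_def
    by (rule exI[of _ "\<lambda>n. D (Suc n)"]) (use D(2) in auto)
  moreover have "(f has_real_derivative D 1 x) (at x)" if "x \<in> S" for x using D(2)[OF that, of 0] D(1) by simp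
  ultimately show ?thesis by (intro exI[of _ "D 1"]) auto
qed

lemma smooth1_on_antideriv:
  assumes "smooth1_on S f'" "\<And>x. x \<in> S \<Longrightarrow> (f has_real_derivative f' x) (at x)"
  shows "smooth1_on S f"
proof -
  obtain D where D: "D 0 = f'" "\<And>n x. x \<in> S \<Longrightarrow> (D n has_real_derivative D (Suc n) x) (at x)"
    using assms(1) unfolding smooth1_on_def by blast
  show ?thesis unfolding smooth1_on_def
    by (rule exI[of _ "\<lambda>n. case n of 0 \<Rightarrow> f | Suc m \<Rightarrow> D m"]) (use D assms(2) in \<open>auto split: nat.split\<close>)
qed

lemma smooth1_on_subset: "smooth1_on S f \<Longrightarrow> T \<subseteq> S \<Longrightarrow> smooth1_on T f"
  unfolding smooth1_on_def by blast

lemma smooth1_on_isCont: "smooth1_on S f \<Longrightarrow> x \<in> S \<Longrightarrow> isCont f x"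
  using smooth1_onD[of S f] DERIV_isCont by fast

lemma smooth1_on_add:
  assumes "smooth1_on S f" "smooth1_on S g"
  shows "smooth1_on S (\<lambda>x. f x + g x)"
proof (rule smooth1_on_coinduct)
  show "(\<lambda>x. f x + g x) \<in> {\<lambda>x. f x + g x |f g. smooth1_on S f \<and> smooth1_on S g}" using assms by blast
  fix h assume "h \<in> {\<lambda>x. f x + g x |f g. smooth1_on S f \<and> smooth1_on S g}"
  then obtain f g where h: "h = (\<lambda>x. f x + g x)" "smooth1_on S f" "smooth1_on S g" by blast
  obtain f' where f': "smooth1_on S f'" "\<And>x. x \<in> S \<Longrightarrow> (f has_real_derivative f' x) (at x)"
    using smooth1_onD[OF h(2)] by fast
  obtain g' where g': "smooth1_on S g'" "\<And>x. x \<in> S \<Longrightarrow> (g has_real_derivative g' x) (at x)"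
    using smooth1_onD[OF h(3)] by fast
  show "\<exists>h'\<in>{\<lambda>x. f x + g x |f g. smooth1_on S f \<and> smooth1_on S g}. \<forall>x\<in>S. (h has_real_derivative h' x) (at x)"
    unfolding h(1) by (rule bexI[of _ "\<lambda>x. f' x + g' x"]) (use f' g' in \<open>auto intro!: DERIV_add\<close>)
qed

text \<open>Products alone are not closed under differentiation, since the Leibniz rule produces
  sums of them; this class is, and so feeds \<open>smooth1_on_coinduct\<close>.\<close>

inductive_set product_sums :: "real set \<Rightarrow> (real \<Rightarrow> real) set" for S where
  prod: "smooth1_on S f \<Longrightarrow> smooth1_on S g \<Longrightarrow> (\<lambda>x. f x * g x) \<in> product_sums S"
| add: "f \<in> product_sums S \<Longrightarrow> g \<in> product_sums S \<Longrightarrow> (\<lambda>x. f x + g x) \<in> product_sums S"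

lemma smooth1_on_mult:
  assumes "smooth1_on S f" "smooth1_on S g"
  shows "smooth1_on S (\<lambda>x. f x * g x)"
proof (rule smooth1_on_coinduct[of _ "product_sums S"])
  show "(\<lambda>x. f x * g x) \<in> product_sums S" by (rule product_sums.prod[OF assms])
  fix h assume "h \<in> product_sums S"
  then show "\<exists>h'\<in>product_sums S. \<forall>x\<in>S. (h has_real_derivative h' x) (at x)"
  proof induction
    case (prod f g)
    obtain f' where f': "smooth1_on S f'" "\<And>x. x \<in> S \<Longrightarrow> (f has_real_derivative f' x) (at x)"
    using smooth1_onD[OF prod(1)] by fast
    obtain g' where g': "smooth1_on S g'" "\<And>x. x \<in> S \<Longrightarrow> (g has_real_derivative g' x) (at x)"
    using smooth1_onD[OF prod(2)] by fast
    have "(\<lambda>x. f' x * g x + f x * g' x) \<in> product_sums S"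
      by (intro product_sums.intros prod f' g')
    moreover have "((\<lambda>x. f x * g x) has_real_derivative f' x * g x + f x * g' x) (at x)" if "x \<in> S" for x
      using DERIV_mult[OF f'(2)[OF that] g'(2)[OF that]] by (simp add: algebra_simps)
    ultimately show ?case by (intro bexI[of _ "\<lambda>x. f' x * g x + f x * g' x"]) auto
  next
    case (add f g)
    from add.IH obtain f' g' where "f' \<in> product_sums S" "g' \<in> product_sums S"
      "\<forall>x\<in>S. (f has_real_derivative f' x) (at x)" "\<forall>x\<in>S. (g has_real_derivative g' x) (at x)" by fast
    then show ?case
      by (intro bexI[of _ "\<lambda>x. f' x + g' x"] product_sums.add) (auto intro!: DERIV_add)
  qed
qed

lemma smooth1_on_const: "smooth1_on S (\<lambda>x. c)"
  by (rule smooth1_on_coinduct[of _ "range (\<lambda>c x. c)"]) (auto intro!: derivative_eq_intros)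

lemma smooth1_on_diff:
  assumes "smooth1_on S f" "smooth1_on S g"
  shows "smooth1_on S (\<lambda>x. f x - g x)"
  using smooth1_on_add[OF assms(1) smooth1_on_mult[OF smooth1_on_const[of S "-1"] assms(2)]] by simp

lemma smooth1_on_affine:
  assumes "smooth1_on S f" "\<And>x. x \<in> T \<Longrightarrow> a * x + b \<in> S"
  shows "smooth1_on T (\<lambda>x. f (a * x + b))"
proof -
  obtain D where D: "D 0 = f" "\<And>n x. x \<in> S \<Longrightarrow> (D n has_real_derivative D (Suc n) x) (at x)"
    using assms(1) unfolding smooth1_on_def by blast
  have "((\<lambda>x. a ^ n * D n (a * x + b)) has_real_derivative a ^ Suc n * D (Suc n) (a * x + b)) (at x)"
    if "x \<in> T" for n x
  proof -
    have "((\<lambda>x. D n (a * x + b)) has_real_derivative D (Suc n) (a * x + b) * a) (at x)"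
      by (rule DERIV_chain2[where g = "\<lambda>x. a * x + b", OF D(2)[OF assms(2)[OF that]]]) (auto intro!: derivative_eq_intros)
    from DERIV_cmult[OF this, of "a ^ n"] show ?thesis by (simp add: algebra_simps)
  qed
  then show ?thesis unfolding smooth1_on_def using D(1)
    by (intro exI[of _ "\<lambda>n x. a ^ n * D n (a * x + b)"]) auto
qed

lemma DERIV_abs_powr: "x \<noteq> 0 \<Longrightarrow> ((\<lambda>x::real. \<bar>x\<bar> powr a) has_real_derivative a / x * \<bar>x\<bar> powr a) (at x)"
proof -
  assume x: "x \<noteq> 0"
  show ?thesis
  proof (cases "x > 0")
    case True
    have "((\<lambda>x. x powr a) has_real_derivative a / x * \<bar>x\<bar> powr a) (at x)"
      using True by (auto intro!: derivative_eq_intros simp: powr_diff)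
    then show ?thesis
      by (rule has_field_derivative_transform_within_open[where S = "{0<..}"]) (use True in auto)
  next
    case False
    have "((\<lambda>x. (- x) powr a) has_real_derivative a / x * \<bar>x\<bar> powr a) (at x)"
      using False x by (auto intro!: derivative_eq_intros simp: powr_diff)
    then show ?thesis
      by (rule has_field_derivative_transform_within_open[where S = "{..<0}"]) (use x False in auto)
  qed
qed

text \<open>The functions \<open>c * |x| powr a / x ^ n\<close> form a class closed under
  differentiation. Keeping the exponent \<open>a\<close> and dividing by powers of \<open>x\<close>
  lets one formula carry the sign on both half lines.\<close>

lemma smooth1_on_abs_powr: "smooth1_on (- {0}) (\<lambda>x. \<bar>x\<bar> powr a)"
proof (rule smooth1_on_coinduct[of _ "{(\<lambda>x. c * (\<bar>x\<bar> powr a / x ^ n)) |c n. True}"])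
  have "(\<lambda>x. \<bar>x\<bar> powr a) = (\<lambda>x. 1 * (\<bar>x\<bar> powr a / x ^ 0))" by simp
  then show "(\<lambda>x. \<bar>x\<bar> powr a) \<in> {(\<lambda>x. c * (\<bar>x\<bar> powr a / x ^ n)) |c n. True}" by blast
  fix g assume "g \<in> {(\<lambda>x. c * (\<bar>x\<bar> powr a / x ^ n)) |c n. True}"
  then obtain c n where g: "g = (\<lambda>x. c * (\<bar>x\<bar> powr a / x ^ n))" by blast
  have "(g has_real_derivative (c * (a - n)) * (\<bar>x\<bar> powr a / x ^ Suc n)) (at x)" if "x \<noteq> 0" for x
  proof -
    have "((\<lambda>x. inverse (x ^ n)) has_real_derivative - (real n / x ^ Suc n)) (at x)"
    proof -
      have "((\<lambda>x. inverse (x ^ n)) has_real_derivative - (inverse (x ^ n) * (real n * x ^ (n - Suc 0)) * inverse (x ^ n))) (at x)"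
        by (rule DERIV_inverse') (use that DERIV_pow in auto)
      also have "- (inverse (x ^ n) * (real n * x ^ (n - Suc 0)) * inverse (x ^ n)) = - (real n / x ^ Suc n)"
        using that by (cases n) (auto simp: field_simps)
      finally show ?thesis .
    qed
    from DERIV_cmult[OF DERIV_mult[OF DERIV_abs_powr[OF that] this], of c] show ?thesis
      unfolding g using that by (simp add: field_simps)
  qed
  moreover have "(\<lambda>x. (c * (a - n)) * (\<bar>x\<bar> powr a / x ^ Suc n)) \<in> {(\<lambda>x. c * (\<bar>x\<bar> powr a / x ^ n)) |c n. True}"
    by blast
  ultimately show "\<exists>g'\<in>{(\<lambda>x. c * (\<bar>x\<bar> powr a / x ^ n)) |c n. True}. \<forall>x\<in>- {0}. (g has_real_derivative g' x) (at x)"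
    by (intro bexI[of _ "\<lambda>x. (c * (a - n)) * (\<bar>x\<bar> powr a / x ^ Suc n)"]) auto
qed

section \<open>Smooth cutoffs\<close>

text \<open>The classical flat function \<open>exp (- 1 / x)\<close>, extended by 0. The polynomial
  factor in \<open>1 / x\<close> makes the family closed under differentiation.\<close>

definition flat_exp :: "real poly \<Rightarrow> real \<Rightarrow> real" where
  "flat_exp p x = (if x > 0 then poly p (1 / x) * exp (- (1 / x)) else 0)"

lemma poly_times_exp_neg_tendsto: "((\<lambda>t. poly p t * exp (- t)) \<longlongrightarrow> 0) (at_top :: real filter)"
proof (induction p)
  case 0
  then show ?case by simp
next
  case (pCons c p)
  have gen: "((\<lambda>t. t ^ n * exp (- t)) \<longlongrightarrow> 0) (at_top :: real filter)" for n
    using tendsto_power_div_exp_0[of n] by (simp add: exp_minus divide_inverse)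
  have "((\<lambda>t. \<Sum>i\<le>degree (pCons c p). coeff (pCons c p) i * (t ^ i * exp (- t))) \<longlongrightarrow>
     (\<Sum>i\<le>degree (pCons c p). coeff (pCons c p) i * 0)) (at_top :: real filter)"
    by (intro tendsto_sum tendsto_mult_left gen)
  then show ?case by (simp add: poly_altdef sum_distrib_right mult.assoc)
qed

text \<open>Differentiating in \<open>1 / x\<close> yields \<open>p - pderiv p\<close> times the
  inner factor \<open>1 / x\<^sup>2\<close>, which is the monomial \<open>[:0, 0, 1:]\<close>. At
  the origin the right difference quotient is again a polynomial in \<open>1 / h\<close> times
  \<open>exp (- 1 / h)\<close> and tends to 0.\<close>

lemma flat_exp_deriv: 
  "(flat_exp p has_real_derivative flat_exp ([:0, 0, 1:] * (p - pderiv p)) x) (at x)"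
proof -
  consider "x > 0" | "x < 0" | "x = 0" by linarith
  then show ?thesis
  proof cases
    case 1
    have "((\<lambda>x. poly p (1 / x) * exp (- (1 / x))) has_real_derivative
        (poly (pderiv p) (1 / x) * (- (1 / x\<^sup>2))) * exp (- (1 / x)) + (exp (- (1 / x)) * (1 / x\<^sup>2)) * poly p (1 / x)) (at x)"
      using 1 by (intro DERIV_mult DERIV_chain2[OF poly_DERIV] DERIV_chain2[OF DERIV_exp])
        (auto intro!: derivative_eq_intros simp: power2_eq_square)
    then have "((\<lambda>x. poly p (1 / x) * exp (- (1 / x))) has_real_derivative flat_exp ([:0, 0, 1:] * (p - pderiv p)) x) (at x)"
      by (rule DERIV_cong) (use 1 in \<open>simp add: flat_exp_def power2_eq_square field_simps\<close>)
    then show ?thesis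
      by (rule has_field_derivative_transform_within_open[where S = "{0<..}"]) (use 1 in \<open>auto simp: flat_exp_def\<close>)
  next
    case 2
    have "((\<lambda>x. 0) has_real_derivative flat_exp ([:0, 0, 1:] * (p - pderiv p)) x) (at x)"
      using 2 by (simp add: flat_exp_def)
    then show ?thesis
      by (rule has_field_derivative_transform_within_open[where S = "{..<0}"]) (use 2 in \<open>auto simp: flat_exp_def\<close>)
  next
    case 3
    have "((\<lambda>h. (flat_exp p (0 + h) - flat_exp p 0) / h) \<longlongrightarrow> 0) (at 0)"
    proof (rule filterlim_split_at)
      show "((\<lambda>h. (flat_exp p (0 + h) - flat_exp p 0) / h) \<longlongrightarrow> 0) (at_left 0)"
        by (rule tendsto_eventually) (auto simp: eventually_at_filter flat_exp_def)
      have "((\<lambda>h. poly ([:0, 1:] * p) (inverse h) * exp (- inverse h)) \<longlongrightarrow> 0) (at_right (0::real))"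
        by (rule filterlim_compose[OF poly_times_exp_neg_tendsto filterlim_inverse_at_top_right])
      then show "((\<lambda>h. (flat_exp p (0 + h) - flat_exp p 0) / h) \<longlongrightarrow> 0) (at_right 0)"
        by (rule Lim_transform_eventually)
          (auto simp: eventually_at_filter flat_exp_def field_simps)
    qed
    then show ?thesis using 3 by (simp add: DERIV_def flat_exp_def)
  qed
qed

lemma smooth_flat_exp: "smooth1_on UNIV (flat_exp p)"
  by (rule smooth1_on_coinduct[of _ "range flat_exp"]) (auto intro: flat_exp_deriv)

lemma DERIV_antiderivative:
  assumes "\<And>x. isCont f x"
  obtains F where "\<And>x::real. (F has_real_derivative f x) (at x)"
  using einterval_antiderivative[of "-\<infinity>" "\<infinity>" f] assms
  by (auto simp: has_real_derivative_iff_has_vector_derivative)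

lemma DERIV_antiderivative_pos:
  assumes "\<And>x. x > 0 \<Longrightarrow> isCont f x"
  obtains F where "\<And>x::real. x > 0 \<Longrightarrow> (F has_real_derivative f x) (at x)"
  using einterval_antiderivative[of 0 "\<infinity>" f] assms
  by (auto simp: has_real_derivative_iff_has_vector_derivative)

lemma DERIV_zero_const:
  fixes f :: "real \<Rightarrow> real"
  assumes "\<And>t. t \<in> {min x y..max x y} \<Longrightarrow> (f has_real_derivative 0) (at t)"
  shows "f x = f y"
proof -
  have "continuous_on {min x y..max x y} f"
    using assms DERIV_isCont by (intro continuous_at_imp_continuous_on) fast
  then show ?thesis
    using DERIV_isconst_end[of x y f] DERIV_isconst_end[of y x f] assms
    by (cases x y rule: linorder_cases) auto
qed

text \<open>The step is the normalised antiderivative of the bump \<open>b\<close>, a product of two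
  flat exponentials that is positive exactly on the open unit interval.\<close>

lemma smooth_step:
  obtains \<sigma> :: "real \<Rightarrow> real" where "smooth1_on UNIV \<sigma>" "\<And>x. x \<le> 0 \<Longrightarrow> \<sigma> x = 0" "\<And>x. x \<ge> 1 \<Longrightarrow> \<sigma> x = 1"
    "\<And>x. 0 \<le> \<sigma> x" "\<And>x. \<sigma> x \<le> 1"
proof -
  define b where "b x = flat_exp [:1:] x * flat_exp [:1:] ((-1) * x + 1)" for x
  have sb: "smooth1_on UNIV b" unfolding b_def
    by (intro smooth1_on_mult smooth_flat_exp smooth1_on_affine[OF smooth_flat_exp]) simp
  have b: "b x = 0" if "x \<le> 0 \<or> 1 \<le> x" for x using that by (auto simp: b_def flat_exp_def)
  have bpos: "b x > 0" if "0 < x" "x < 1" for x using that by (auto simp: b_def flat_exp_def)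
  have bge: "b x \<ge> 0" for x by (auto simp: b_def flat_exp_def)
  obtain B where B: "\<And>x. (B has_real_derivative b x) (at x)"
    using DERIV_antiderivative[of b] smooth1_on_isCont[OF sb] by blast
  have mono: "B x \<le> B y" if "x \<le> y" for x y
    by (rule DERIV_nonneg_imp_nondecreasing[OF that]) (use B bge in blast)
  have B0: "B x = B 0" if "x \<le> 0" for x
  proof (rule DERIV_zero_const[where f = B])
    fix t assume "t \<in> {min x 0..max x 0}"
    then show "(B has_real_derivative 0) (at t)" using B[of t] b[of t] that by auto
  qed
  have B1: "B x = B 1" if "x \<ge> 1" for x
  proof (rule DERIV_zero_const[where f = B])
    fix t assume "t \<in> {min x 1..max x 1}"
    then show "(B has_real_derivative 0) (at t)" using B[of t] b[of t] that by auto
  qed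
  have lt: "B 0 < B 1"
  proof (rule DERIV_pos_imp_increasing_open[where f = B])
    show "(0::real) < 1" by simp
    show "\<exists>y. (B has_real_derivative y) (at x) \<and> 0 < y" if "0 < x" "x < 1" for x
      using B bpos[OF that] by blast
    show "continuous_on {0..1} B" using B by (meson DERIV_isCont continuous_at_imp_continuous_on)
  qed
  define \<sigma> where "\<sigma> x = 1 / (B 1 - B 0) * (B x - B 0)" for x
  show ?thesis
  proof (rule that[of \<sigma>])
    show "smooth1_on UNIV \<sigma>" unfolding \<sigma>_def
      by (intro smooth1_on_mult smooth1_on_const smooth1_on_diff smooth1_on_antideriv[OF sb] B)
    show "\<sigma> x = 0" if "x \<le> 0" for x using B0[OF that] by (simp add: \<sigma>_def)
    show "\<sigma> x = 1" if "x \<ge> 1" for x using B1[OF that] lt by (simp add: \<sigma>_def)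
    show "0 \<le> \<sigma> x" for x using lt mono[of 0 x] B0[of x] by (cases "x \<le> 0") (auto simp: \<sigma>_def)
    show "\<sigma> x \<le> 1" for x using lt mono[of x 1] B1[of x] by (cases "x \<le> 1") (auto simp: \<sigma>_def divide_simps)
  qed
qed

text \<open>Smoothness on \<open>- {0}\<close> leaves the derivatives at the origin unspecified; since \<open>u\<close> vanishes
  near the origin, they can be taken to be \<open>0\<close> there.\<close>
lemma Cc_lineE:
  assumes "u \<in> Cc_line"
  obtains D a b where "D 0 = u" "\<And>n x. (D n has_real_derivative D (Suc n) x) (at x)" "0 < a" "a < b"
    "\<And>n x. \<bar>x\<bar> < a \<or> b < \<bar>x\<bar> \<Longrightarrow> D n x = 0"
proof -
  obtain D a b where D: "D 0 = u" "\<And>n x. x \<noteq> 0 \<Longrightarrow> (D n has_real_derivative D (Suc n) x) (at x)"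
    and a: "0 < a" "\<And>x. \<bar>x\<bar> < a \<or> b < \<bar>x\<bar> \<Longrightarrow> u x = 0"
    using assms unfolding Cc_line_def smooth1_on_def by blast
  let ?V = "\<lambda>x. x \<noteq> 0 \<and> (\<bar>x\<bar> < a \<or> b < \<bar>x\<bar>)"
  have opV: "open {x. ?V x}"
    by (intro open_Collect_conj open_Collect_disj open_Collect_less open_Collect_neq continuous_intros)
  have zero: "D n x = 0" if "?V x" for n x
    using that
  proof (induction n arbitrary: x)
    case 0
    then show ?case using a(2) D(1) by auto
  next
    case (Suc n)
    have "(D n has_real_derivative D (Suc n) x) (at x)" using D(2) Suc.prems by auto
    moreover have "(D n has_real_derivative 0) (at x)"
      by (rule has_field_derivative_transform_within_open[OF DERIV_const[of 0] opV])
        (use Suc in auto)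
    ultimately show ?case by (rule DERIV_unique)
  qed
  define E where "E n x = (if x = 0 then 0 else D n x)" for n x
  have E0: "E n x = 0" if "\<bar>x\<bar> < a \<or> b < \<bar>x\<bar>" for n x using zero that by (auto simp: E_def)
  show ?thesis
  \<comment> \<open>The given outer radius may be smaller than \<open>a\<close>, for instance when
    \<open>u\<close> is 0; enlarging it guarantees \<open>a < b\<close>.\<close>
  proof (rule that[of E a "max b (a + 1)"])
    show "E 0 = u" using D(1) a by (auto simp: E_def fun_eq_iff)
    show "(E n has_real_derivative E (Suc n) x) (at x)" for n x
    proof (cases "x = 0")
      case True
      have "(E n has_real_derivative 0) (at x)"
        by (rule has_field_derivative_transform_within_open[OF DERIV_const[of 0], of "{-a<..<a}"])
          (use True a in \<open>auto intro!: E0 simp: abs_less_iff\<close>)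
      then show ?thesis using True by (simp add: E_def)
    next
      case False
      have "(D n has_real_derivative E (Suc n) x) (at x)" using D(2)[OF False] False by (simp add: E_def)
      then show ?thesis
        by (rule has_field_derivative_transform_within_open[where S = "-{0}"]) (use False in \<open>auto simp: E_def\<close>)
    qed
  qed (use a E0 in auto)
qed

section \<open>Integrals over the line\<close>

lemma integral_DERIV_compact_support:
  fixes F f :: "real \<Rightarrow> real"
  assumes F: "\<And>x. (F has_real_derivative f x) (at x)" and cont: "\<And>x. isCont f x"
    and supp: "\<And>x. x < a \<or> b < x \<Longrightarrow> F x = 0"
  shows "integrable lborel f" "(LINT x|lborel. f x) = 0"
proof -
  \<comment> \<open>No order between \<open>a\<close> and \<open>b\<close> is assumed, and the
    margin 1 places both endpoints strictly outside the support.\<close>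
  define c d where "c = min a b - 1" and "d = max a b + 1"
  have f0: "f x = 0" if "x < a \<or> b < x" for x
  proof -
    have "open {x. x < a \<or> b < x}" by (intro open_Collect_disj open_Collect_less continuous_intros)
    then have "(F has_real_derivative 0) (at x)"
      by (rule has_field_derivative_transform_within_open[OF DERIV_const[of 0]]) (use that supp in auto)
    then show ?thesis using F DERIV_unique by blast
  qed
  have eq: "f = (\<lambda>x. f x * indicator {c..d} x)"
  proof
    fix x show "f x = f x * indicator {c..d} x"
      using f0[of x] by (cases "x \<in> {c..d}") (auto simp: c_def d_def min_def max_def split: if_splits)
  qed
  have "has_bochner_integral lborel (\<lambda>x. f x * indicator {c..d} x) (F d - F c)"
    by (rule has_bochner_integral_FTC_Icc_real) (use F cont in \<open>auto simp: c_def d_def\<close>)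
  moreover have "F d = 0" "F c = 0" by (auto intro!: supp simp: c_def d_def)
  ultimately have "has_bochner_integral lborel f 0" using eq by simp
  then show "integrable lborel f" "(LINT x|lborel. f x) = 0"
    by (auto simp: has_bochner_integral_iff)
qed

lemma integrable_continuous_compact_support:
  fixes f :: "real \<Rightarrow> real"
  assumes "\<And>x. isCont f x" "\<And>x. x < a \<or> b < x \<Longrightarrow> f x = 0"
  shows "integrable lborel f"
proof -
  have "integrable lborel (\<lambda>x. f x * indicator {a..b} x)"
    by (rule borel_integrable_atLeastAtMost) (use assms in auto)
  also have "(\<lambda>x. f x * indicator {a..b} x) = f"
  proof
    fix x show "f x * indicator {a..b} x = f x"
      using assms(2)[of x] by (cases "x \<in> {a..b}") auto
  qed
  finally show ?thesis .
qed

text \<open>The positive and negative parts of \<open>g\<close> are densities of two finite measures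
  that agree on all rays. Rays determine such measures, and equal measures have almost everywhere
  equal densities.\<close>

lemma AE_zero_if_interval_integrals_zero:
  fixes g :: "real \<Rightarrow> real"
  assumes g: "integrable lborel g" and z: "\<And>a b. a < b \<Longrightarrow> (LINT x|lborel. indicator {a<..<b} x * g x) = 0"
  shows "AE x in lborel. g x = 0"
proof -
  have [measurable]: "g \<in> borel_measurable borel" using g by auto
  have ray: "(LINT x|lborel. indicator {a<..} x * g x) = 0" for a
  proof -
    have "(\<lambda>n::nat. LINT x|lborel. indicator {a<..<a + 1 + n} x * g x) \<longlonglongrightarrow> (LINT x|lborel. indicator {a<..} x * g x)"
    proof (rule integral_dominated_convergence[where w = "\<lambda>x. \<bar>g x\<bar>"])
      show "AE x in lborel. (\<lambda>n::nat. indicator {a<..<a + 1 + n} x * g x) \<longlonglongrightarrow> indicator {a<..} x * g x"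
      proof (rule AE_I2)
        fix x
        obtain N::nat where "x - a - 1 < N" using reals_Archimedean2 by blast
        then have "\<forall>n\<ge>N. indicator {a<..<a + 1 + n} x * g x = indicator {a<..} x * g x"
          by (auto simp: indicator_def)
        then show "(\<lambda>n::nat. indicator {a<..<a + 1 + n} x * g x) \<longlonglongrightarrow> indicator {a<..} x * g x"
          by (intro tendsto_eventually) (auto simp: eventually_sequentially)
      qed
    qed (use g in \<open>auto simp: indicator_def\<close>)
    moreover have "(\<lambda>n::nat. LINT x|lborel. indicator {a<..<a + 1 + n} x * g x) = (\<lambda>n. 0)"
      by (intro ext z) simp
    ultimately show ?thesis by (simp add: LIMSEQ_const_iff)
  qed
  define p m where "p x = max 0 (g x)" and "m x = max 0 (- g x)" for x
  have [measurable]: "p \<in> borel_measurable borel" "m \<in> borel_measurable borel" unfolding p_def m_def by auto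
  have ip: "integrable lborel p" "integrable lborel m" unfolding p_def m_def using g by auto
  have em: "emeasure (density lborel (\<lambda>x. ennreal (f x))) {a<..} = ennreal (LINT x|lborel. indicator {a<..} x * f x)"
    if [measurable]: "f \<in> borel_measurable borel" and "integrable lborel f" "\<And>x. 0 \<le> f x" for f and a :: real
  proof -
    have "emeasure (density lborel (\<lambda>x. ennreal (f x))) {a<..} = (\<integral>\<^sup>+x. ennreal (f x) * indicator {a<..} x \<partial>lborel)"
      by (rule emeasure_density) auto
    also have "\<dots> = (\<integral>\<^sup>+x. ennreal (indicator {a<..} x * f x) \<partial>lborel)"
      by (intro nn_integral_cong) (auto simp: indicator_def)
    also have "\<dots> = ennreal (LINT x|lborel. indicator {a<..} x * f x)"
      by (rule nn_integral_eq_integral) (use that in \<open>auto intro: integrable_real_mult_indicator simp: mult.commute\<close>)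
    finally show ?thesis .
  qed
  have imult: "integrable lborel (\<lambda>x. indicator {a<..} x * f x)" if "integrable lborel f" for f :: "real \<Rightarrow> real" and a
    using integrable_mult_indicator[OF _ that, of "{a<..}"] by simp
  have "density lborel (\<lambda>x. ennreal (p x)) = density lborel (\<lambda>x. ennreal (m x))"
  proof (rule measure_eqI_lessThan)
    fix a
    have "(LINT x|lborel. indicator {a<..} x * p x) - (LINT x|lborel. indicator {a<..} x * m x)
      = (LINT x|lborel. indicator {a<..} x * g x)"
      by (subst Bochner_Integration.integral_diff[symmetric])
        (auto intro!: imult[OF ip(1)] imult[OF ip(2)] Bochner_Integration.integral_cong, auto simp: p_def m_def max_def)
    then have "(LINT x|lborel. indicator {a<..} x * p x) = (LINT x|lborel. indicator {a<..} x * m x)"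
      using ray by simp
    then show "emeasure (density lborel (\<lambda>x. ennreal (p x))) {a<..} = emeasure (density lborel (\<lambda>x. ennreal (m x))) {a<..}"
      by (subst (1 2) em) (auto simp: ip, auto simp: p_def m_def)
    show "emeasure (density lborel (\<lambda>x. ennreal (p x))) {a<..} < \<infinity>"
      by (subst em) (auto simp: ip, auto simp: p_def)
  qed auto
  then have "AE x in lborel. ennreal (p x) = ennreal (m x)"
    by (subst (asm) sigma_finite_measure.density_unique_iff[OF sigma_finite_lborel]) auto
  then show ?thesis
    by eventually_elim (auto simp: p_def m_def max_def split: if_splits)
qed

section \<open>Growth of solutions on a half line\<close>

text \<open>First-zero argument: before the first zero of \<open>z\<close> the function
  \<open>P\<close> is nondecreasing, hence positive, so \<open>z\<close> is nondecreasing there and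
  cannot have come down to zero.\<close>

lemma comparison_stays_positive:
  fixes z P :: "real \<Rightarrow> real"
  assumes "x\<^sub>1 \<le> x"
    and z: "\<And>t. t \<in> {x\<^sub>1..x} \<Longrightarrow> (z has_real_derivative r t * P t) (at t)"
    and P: "\<And>t. t \<in> {x\<^sub>1..x} \<Longrightarrow> (P has_real_derivative g t) (at t)"
    and r: "\<And>t. t \<in> {x\<^sub>1..x} \<Longrightarrow> 0 \<le> r t"
    and g: "\<And>t. t \<in> {x\<^sub>1..x} \<Longrightarrow> 0 < z t \<Longrightarrow> 0 \<le> g t"
    and init: "0 < z x\<^sub>1" "0 < P x\<^sub>1"
  shows "0 < z x"
proof (rule ccontr)
  assume "\<not> 0 < z x"
  have cz: "continuous_on {x\<^sub>1..x} z"
    using z DERIV_isCont by (intro continuous_at_imp_continuous_on) fast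
  define S where "S = {x\<^sub>1..x} \<inter> z -` {..0}"
  have "closed S" unfolding S_def by (intro continuous_closed_preimage[OF cz]) auto
  then have "compact ({x\<^sub>1..x} \<inter> S)" by (intro compact_Int_closed) auto
  then have "compact S" by (simp add: S_def)
  moreover have "x \<in> S" using assms(1) \<open>\<not> 0 < z x\<close> by (auto simp: S_def)
  ultimately obtain t\<^sub>0 where t0: "t\<^sub>0 \<in> S" "\<And>t. t \<in> S \<Longrightarrow> t\<^sub>0 \<le> t"
    using compact_attains_inf[of S] by blast
  then have t0': "x\<^sub>1 \<le> t\<^sub>0" "t\<^sub>0 \<le> x" "z t\<^sub>0 \<le> 0" by (auto simp: S_def)
  have pos: "0 < z t" if "x\<^sub>1 \<le> t" "t < t\<^sub>0" for t
    using t0(2)[of t] that t0' by (force simp: S_def)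
  have Ppos: "0 < P t" if "x\<^sub>1 \<le> t" "t \<le> t\<^sub>0" for t
  proof -
    have "P x\<^sub>1 \<le> P t"
    proof (cases "x\<^sub>1 = t")
      case False
      then have "x\<^sub>1 < t" using that by simp
      have "\<exists>s. x\<^sub>1 < s \<and> s < t \<and> P t - P x\<^sub>1 = (t - x\<^sub>1) * g s"
        by (rule MVT2[OF \<open>x\<^sub>1 < t\<close>]) (use P that t0' in auto)
      then obtain s where s: "x\<^sub>1 < s" "s < t" "P t - P x\<^sub>1 = (t - x\<^sub>1) * g s" by blast
      have "0 \<le> g s" using s that t0' pos[of s] by (intro g) auto
      then have "0 \<le> (t - x\<^sub>1) * g s" using \<open>x\<^sub>1 < t\<close> by simp
      then show ?thesis using s by linarith
    qed simp
    then show ?thesis using init by linarith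
  qed
  have "z x\<^sub>1 \<le> z t\<^sub>0"
  proof (rule DERIV_nonneg_imp_nondecreasing[OF t0'(1)])
    fix t assume "x\<^sub>1 \<le> t" "t \<le> t\<^sub>0"
    then show "\<exists>y. (z has_real_derivative y) (at t) \<and> 0 \<le> y"
      using z[of t] r[of t] Ppos[of t] t0' by (intro exI[of _ "r t * P t"]) auto
  qed
  then show False using init t0' by linarith
qed

text \<open>Turns a pointwise bound \<open>C / x\<close> into a contradiction with integrability,
  since the ratio of the endpoints can be taken arbitrarily large.\<close>

lemma integral_ge_log:
  fixes h :: "real \<Rightarrow> real"
  assumes h: "integrable lborel h" "\<And>x. 0 \<le> h x"
    and ab: "0 < a" "a \<le> b" "\<And>x. a \<le> x \<Longrightarrow> x \<le> b \<Longrightarrow> C / x \<le> h x"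
  shows "C * (ln b - ln a) \<le> (LINT x|lborel. h x)"
proof -
  have FTC: "has_bochner_integral lborel (\<lambda>x. C / x * indicator {a..b} x) (C * ln b - C * ln a)"
  proof (rule has_bochner_integral_FTC_Icc_real[OF ab(2)])
    fix x assume "a \<le> x" "x \<le> b"
    then show "((\<lambda>x. C * ln x) has_real_derivative C / x) (at x)" "isCont (\<lambda>x. C / x) x"
      using ab(1) by (auto intro!: derivative_eq_intros continuous_intros)
  qed
  have "C * ln b - C * ln a = (LINT x|lborel. C / x * indicator {a..b} x)"
    using FTC by (simp add: has_bochner_integral_iff)
  also have "\<dots> \<le> (LINT x|lborel. h x)"
    by (rule integral_mono) (use FTC h ab(3) in \<open>auto simp: has_bochner_integral_iff indicator_def\<close>)
  finally show ?thesis by (simp add: right_diff_distrib)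
qed

text \<open>Below, \<open>y' = x powr \<alpha> * P\<close> and \<open>P' = q * y\<close> is the equation \<open>lap_k \<alpha> k y = y\<close> on the right
  half line, with \<open>K\<close> standing for the square of \<open>k\<close>.\<close>
locale radial_ode =
  fixes \<alpha> K :: real
  assumes K: "0 \<le> K"
    and limit_point: "\<And>x. 0 < x \<Longrightarrow> (1 - (1 + \<alpha>)\<^sup>2 / 4) / x\<^sup>2 \<le> 1 + K * x powr (2 * \<alpha>)"
begin

definition q :: "real \<Rightarrow> real" where "q x = (1 + K * \<bar>x\<bar> powr (2 * \<alpha>)) * \<bar>x\<bar> powr (- \<alpha>)"

lemma q_nonneg: "0 \<le> q x"
  using K by (simp add: q_def)

lemma q_pos: "0 < x \<Longrightarrow> 0 < q x"
  using K by (simp add: q_def add_pos_nonneg)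

text \<open>\<open>f x = x powr ((\<alpha> - 1) / 2)\<close> is a subsolution that just fails to be square integrable with
  respect to the weight \<open>x powr - \<alpha>\<close>, both at the origin and at infinity.\<close>
definition f :: "real \<Rightarrow> real" where "f x = x powr ((\<alpha> - 1) / 2)"
text \<open>The conormal derivative \<open>x powr (- \<alpha>) * f'\<close> of the comparison
  function.\<close>

definition Pf :: "real \<Rightarrow> real" where "Pf x = (\<alpha> - 1) / 2 * x powr (- (\<alpha> + 3) / 2)"
text \<open>The coefficient is \<open>(\<alpha> - 1) / 2\<close> times
  \<open>- (\<alpha> + 3) / 2\<close>; it is positive exactly for \<alpha> strictly between -3 and
  1.\<close>

definition Pf' :: "real \<Rightarrow> real" where "Pf' x = (1 - (1 + \<alpha>)\<^sup>2 / 4) * x powr (- (\<alpha> + 5) / 2)"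

lemma f_deriv: "0 < x \<Longrightarrow> (f has_real_derivative x powr \<alpha> * Pf x) (at x)"
proof -
  assume x: "0 < x"
  have "(f has_real_derivative (\<alpha> - 1) / 2 * x powr ((\<alpha> - 1) / 2 - 1)) (at x)"
    unfolding f_def using x by (auto intro!: derivative_eq_intros)
  also have "(\<alpha> - 1) / 2 * x powr ((\<alpha> - 1) / 2 - 1) = x powr \<alpha> * Pf x"
    using x by (simp add: Pf_def powr_add[symmetric] field_simps)
  finally show ?thesis .
qed

lemma Pf_deriv: "0 < x \<Longrightarrow> (Pf has_real_derivative Pf' x) (at x)"
proof -
  assume x: "0 < x"
  have "(Pf has_real_derivative (\<alpha> - 1) / 2 * (- (\<alpha> + 3) / 2 * x powr (- (\<alpha> + 3) / 2 - 1))) (at x)"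
    unfolding Pf_def using x by (intro DERIV_cmult has_real_derivative_powr) auto
  also have "- (\<alpha> + 3) / 2 - 1 = - (\<alpha> + 5) / 2" by (simp add: field_simps)
  also have "(\<alpha> - 1) / 2 * (- (\<alpha> + 3) / 2 * x powr (- (\<alpha> + 5) / 2)) = Pf' x"
    by (simp add: Pf'_def field_simps power2_eq_square)
  finally show ?thesis .
qed

text \<open>This is the assumption \<open>limit_point\<close> multiplied by the positive factor
  \<open>x powr (- \<alpha>) * f x\<close>.\<close>

lemma Pf'_le: "0 < x \<Longrightarrow> Pf' x \<le> q x * f x"
proof -
  assume x: "0 < x"
  have e: "x powr (- (\<alpha> + 5) / 2) = (x powr (- \<alpha>) * f x) / x\<^sup>2"
  proof -
    have "x powr (- \<alpha>) * f x = x powr (- (\<alpha> + 5) / 2 + 2)"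
      by (simp add: f_def powr_add[symmetric] field_simps)
    also have "\<dots> = x powr (- (\<alpha> + 5) / 2) * x\<^sup>2"
      using x by (simp add: powr_add)
    finally show ?thesis using x by simp
  qed
  have "Pf' x = (1 - (1 + \<alpha>)\<^sup>2 / 4) / x\<^sup>2 * (x powr (- \<alpha>) * f x)"
    unfolding Pf'_def e by simp
  also have "\<dots> \<le> (1 + K * x powr (2 * \<alpha>)) * (x powr (- \<alpha>) * f x)"
    by (intro mult_right_mono limit_point x) (simp add: f_def)
  also have "\<dots> = q x * f x" using x by (simp add: q_def)
  finally show ?thesis .
qed

lemma weight_f: "0 < x \<Longrightarrow> x powr (- \<alpha>) * (f x)\<^sup>2 = 1 / x"
proof -
  assume x: "0 < x"
  have "(f x)\<^sup>2 = x powr (\<alpha> - 1)"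
    by (simp add: f_def power2_eq_square powr_add[symmetric])
  then have "x powr (- \<alpha>) * (f x)\<^sup>2 = x powr (-1)" by (simp add: powr_add[symmetric])
  then show ?thesis using x by (simp add: powr_minus_divide)
qed

text \<open>A small multiple of \<open>f\<close> is kept below \<open>y\<close>: to the right of the
  base point if \<open>P\<close> is positive there, to the left if it is negative. Since
  \<open>f\<close> is a subsolution, the difference obeys \<open>comparison_stays_positive\<close>,
  and the weighted square of \<open>y\<close> dominates \<open>c\<^sup>2 / x\<close> all the way to
  infinity or to the origin.\<close>

lemma solution_not_L2:
  assumes y: "\<And>x. 0 < x \<Longrightarrow> (y has_real_derivative x powr \<alpha> * P x) (at x)"
    and P: "\<And>x. 0 < x \<Longrightarrow> (P has_real_derivative q x * y x) (at x)"
    and int: "integrable lborel (\<lambda>x. indicator {0<..} x * (x powr (- \<alpha>) * (y x)\<^sup>2))"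
    and x1: "0 < x\<^sub>1" "0 < y x\<^sub>1" "P x\<^sub>1 \<noteq> 0"
  shows False
proof -
  define m where "m = min (y x\<^sub>1) \<bar>P x\<^sub>1\<bar>"
  \<comment> \<open>Small enough that \<open>c * f\<close> starts below \<open>y\<close> and
    \<open>c * Pf\<close> is smaller in absolute value than \<open>P\<close>. The summand 1 keeps
    the denominator positive, the factor 2 makes both inequalities strict.\<close>
  define c where "c = m / (2 * (\<bar>f x\<^sub>1\<bar> + \<bar>Pf x\<^sub>1\<bar> + 1))"
  have m: "0 < m" using x1 by (simp add: m_def)
  then have c: "0 < c" by (simp add: c_def add_nonneg_pos)
  have "c * (\<bar>f x\<^sub>1\<bar> + \<bar>Pf x\<^sub>1\<bar> + 1) = m / 2"
    by (simp add: c_def add_nonneg_pos[THEN less_imp_neq[symmetric]] divide_simps)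
  then have eq: "c * \<bar>f x\<^sub>1\<bar> + c * \<bar>Pf x\<^sub>1\<bar> + c = m / 2" by (simp add: algebra_simps)
  have small: "c * \<bar>f x\<^sub>1\<bar> < m" "c * \<bar>Pf x\<^sub>1\<bar> < m"
    using eq m c mult_nonneg_nonneg[of c "\<bar>f x\<^sub>1\<bar>"] mult_nonneg_nonneg[of c "\<bar>Pf x\<^sub>1\<bar>"] by linarith+
  have init1: "c * f x\<^sub>1 < y x\<^sub>1" and init2: "\<bar>c * Pf x\<^sub>1\<bar> < \<bar>P x\<^sub>1\<bar>"
    using small c by (auto simp: m_def f_def abs_mult)
  let ?z = "\<lambda>x. y x - c * f x" and ?Pz = "\<lambda>x. P x - c * Pf x"
  have z: "(?z has_real_derivative x powr \<alpha> * ?Pz x) (at x)" if "0 < x" for x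
    using DERIV_diff[OF y[OF that] DERIV_cmult[OF f_deriv[OF that], of c]] by (simp add: algebra_simps)
  have Pz: "(?Pz has_real_derivative q x * y x - c * Pf' x) (at x)" if "0 < x" for x
    by (intro DERIV_diff P DERIV_cmult Pf_deriv that)
  have g: "0 \<le> q x * y x - c * Pf' x" if "0 < x" "0 < ?z x" for x
  proof -
    have "0 \<le> q x * ?z x" using q_nonneg that by simp
    moreover have "c * Pf' x \<le> c * (q x * f x)" using c Pf'_le[OF that(1)] by simp
    ultimately show ?thesis by (simp add: algebra_simps)
  qed
  let ?h = "\<lambda>x. indicator {0<..} x * (x powr (- \<alpha>) * (y x)\<^sup>2)"
  have hge: "c\<^sup>2 / x \<le> ?h x" if "0 < x" "0 < ?z x" for x
  proof -
    have "c\<^sup>2 / x = x powr (- \<alpha>) * (c * f x)\<^sup>2"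
    proof -
      have "x powr (- \<alpha>) * (c * f x)\<^sup>2 = c\<^sup>2 * (x powr (- \<alpha>) * (f x)\<^sup>2)" by (simp add: power_mult_distrib)
      then show ?thesis unfolding weight_f[OF that(1)] by simp
    qed
    also have "\<dots> \<le> x powr (- \<alpha>) * (y x)\<^sup>2"
      using that c by (intro mult_left_mono power_mono) (auto simp: f_def)
    finally show ?thesis using that by simp
  qed
  define I where "I = (LINT x|lborel. ?h x)"
  \<comment> \<open>The logarithmic length of an interval on which \<open>c\<^sup>2 / x\<close>
    alone already integrates to more than \<open>I\<close>.\<close>
  define L where "L = \<bar>I\<bar> / c\<^sup>2 + 1"
  have L: "I < c\<^sup>2 * L" using c by (simp add: L_def distrib_left) (smt (verit) zero_less_power)
  have L0: "0 < L" by (simp add: L_def add_nonneg_pos)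
  show False
  proof (cases "0 < P x\<^sub>1")
    case True
    have pos: "0 < ?z x" if "x\<^sub>1 \<le> x" for x
    proof (rule comparison_stays_positive[OF that z Pz])
      show "0 < P x\<^sub>1 - c * Pf x\<^sub>1" "0 < y x\<^sub>1 - c * f x\<^sub>1" using init1 init2 True by auto
    qed (use x1 g in auto)
    have le: "x\<^sub>1 \<le> x\<^sub>1 * exp L" using x1 L0 by simp
    have "c\<^sup>2 * (ln (x\<^sub>1 * exp L) - ln x\<^sub>1) \<le> I"
      unfolding I_def by (rule integral_ge_log[OF int _ x1(1) le]) (use hge pos x1 in \<open>auto simp: indicator_def\<close>)
    moreover have "ln (x\<^sub>1 * exp L) - ln x\<^sub>1 = L" using x1 by (simp add: ln_mult)
    ultimately show False using L by simp
  next
    case False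
    have pos: "0 < ?z x" if "0 < x" "x \<le> x\<^sub>1" for x
    proof -
      \<comment> \<open>Leftward comparison is the rightward one after reflecting the axis, which
        flips the sign of the conormal derivative.\<close>
      have "0 < ?z (- (- x))"
      proof (rule comparison_stays_positive[of "- x\<^sub>1" "- x" "\<lambda>t. ?z (- t)" "\<lambda>t. (- t) powr \<alpha>"
            "\<lambda>t. - ?Pz (- t)" "\<lambda>t. q (- t) * y (- t) - c * Pf' (- t)"])
        show "- x\<^sub>1 \<le> - x" using that by simp
        fix t assume "t \<in> {- x\<^sub>1..- x}"
        then have t: "0 < - t" using that by simp
        show "((\<lambda>t. ?z (- t)) has_real_derivative (- t) powr \<alpha> * - ?Pz (- t)) (at t)"
          by (rule DERIV_cong[OF DERIV_chain2[where g = uminus, OF z[OF t] DERIV_minus[OF DERIV_ident]]]) (simp add: algebra_simps)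
        show "((\<lambda>t. - ?Pz (- t)) has_real_derivative q (- t) * y (- t) - c * Pf' (- t)) (at t)"
          using DERIV_minus[OF DERIV_chain2[where g = uminus, OF Pz[OF t] DERIV_minus[OF DERIV_ident]]] by simp
        show "0 \<le> q (- t) * y (- t) - c * Pf' (- t)" if "0 < y (- t) - c * f (- t)" using g[OF t that] .
      next
        show "0 < y (- (- x\<^sub>1)) - c * f (- (- x\<^sub>1))" "0 < - (P (- (- x\<^sub>1)) - c * Pf (- (- x\<^sub>1)))"
          using init1 init2 False by auto
      qed simp
      then show ?thesis by simp
    qed
    have le: "0 < x\<^sub>1 * exp (- L)" "x\<^sub>1 * exp (- L) \<le> x\<^sub>1" using x1 L0 by (simp_all add: mult_le_cancel_left2)
    have "c\<^sup>2 * (ln x\<^sub>1 - ln (x\<^sub>1 * exp (- L))) \<le> I"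
      unfolding I_def by (rule integral_ge_log[OF int _ le]) (use hge pos x1 le in \<open>auto simp: indicator_def\<close>)
    moreover have "ln x\<^sub>1 - ln (x\<^sub>1 * exp (- L)) = L" using x1 by (simp add: ln_mult)
    ultimately show False using L by simp
  qed
qed

text \<open>To start the comparison, some point needs both \<open>y\<close> and \<open>P\<close>
  nonzero. If \<open>y * P\<close> vanished identically, so would its derivative
  \<open>x powr \<alpha> * P\<^sup>2 + q * y\<^sup>2\<close>, which is positive wherever
  \<open>y\<close> is nonzero.\<close>

lemma L2_solution_zero:
  assumes y: "\<And>x. 0 < x \<Longrightarrow> (y has_real_derivative x powr \<alpha> * P x) (at x)"
    and P: "\<And>x. 0 < x \<Longrightarrow> (P has_real_derivative q x * y x) (at x)"
    and int: "integrable lborel (\<lambda>x. indicator {0<..} x * (x powr (- \<alpha>) * (y x)\<^sup>2))"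
    and "0 < x"
  shows "y x = 0"
proof (rule ccontr)
  assume nz: "y x \<noteq> 0"
  have "\<exists>t>0. y t * P t \<noteq> 0"
  proof (rule ccontr)
    assume "\<not> (\<exists>t>0. y t * P t \<noteq> 0)"
    then have z: "y t * P t = 0" if "t > 0" for t using that by auto
    have "((\<lambda>t. y t * P t) has_real_derivative x powr \<alpha> * P x * P x + q x * y x * y x) (at x)"
      by (rule DERIV_mult[OF y P]) fact+
    moreover have "((\<lambda>t. y t * P t) has_real_derivative 0) (at x)"
      by (rule has_field_derivative_transform_within_open[OF DERIV_const[of 0], of "{0<..}"])
        (use z assms(4) in auto)
    ultimately have "x powr \<alpha> * P x * P x + q x * y x * y x = 0" by (rule DERIV_unique)
    moreover have "0 \<le> x powr \<alpha> * P x * P x" by (simp add: mult.assoc)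
    moreover have "0 < q x * y x * y x" using q_pos[OF assms(4)] nz
      by (auto simp add: mult.assoc zero_less_mult_iff linorder_neq_iff)
    ultimately show False by linarith
  qed
  then obtain t where t: "0 < t" "y t \<noteq> 0" "P t \<noteq> 0" by auto
  show False
  proof (cases "0 < y t")
    case True
    then show False using solution_not_L2[OF y P int t(1)] t by blast
  next
    case False
    show False
    proof (rule solution_not_L2[of "\<lambda>x. - y x" "\<lambda>x. - P x", OF _ _ _ t(1)])
      show "((\<lambda>x. - y x) has_real_derivative x powr \<alpha> * - P x) (at x)" if "0 < x" for x
        using DERIV_minus[OF y[OF that]] by simp
      show "((\<lambda>x. - P x) has_real_derivative q x * - y x) (at x)" if "0 < x" for x
        using DERIV_minus[OF P[OF that]] by simp
    qed (use t False int in auto)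
  qed
qed

end

section \<open>Regularity of weak solutions\<close>

definition test_fun :: "(real \<Rightarrow> real) \<Rightarrow> bool" where
  "test_fun u \<longleftrightarrow> u \<in> Cc_line \<and> (\<forall>x\<le>0. u x = 0)"

lemma test_funE:
  assumes "test_fun u"
  obtains D a b where "D 0 = u" "\<And>n x. (D n has_real_derivative D (Suc n) x) (at x)" "0 < a" "a < b"
    "\<And>n x. x < a \<or> b < x \<Longrightarrow> D n x = 0"
proof -
  obtain D a b where D: "D 0 = u" "\<And>n x. (D n has_real_derivative D (Suc n) x) (at x)" "0 < a" "a < b"
    "\<And>n x. \<bar>x\<bar> < a \<or> b < \<bar>x\<bar> \<Longrightarrow> D n x = 0"
    using assms unfolding test_fun_def by (elim conjE) (erule Cc_lineE, blast)
  have neg: "D n x = 0" if "x < 0" for n x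
    using that
  proof (induction n arbitrary: x)
    case 0
    then show ?case using assms D(1) by (auto simp: test_fun_def)
  next
    case (Suc n)
    have "(D n has_real_derivative 0) (at x)"
      by (rule has_field_derivative_transform_within_open[OF DERIV_const[of 0], of "{..<0}"]) (use Suc in auto)
    then show ?case using D(2) DERIV_unique by blast
  qed
  have "D n x = 0" if "x < a \<or> b < x" for n x
    using neg[of x n] D(5)[of x n] that by (cases "x < 0") auto
  then show ?thesis using that[of D a b] D by blast
qed

lemma test_funI:
  assumes "smooth1_on (- {0}) u" "0 < a" "\<And>x. x < a \<or> b < x \<Longrightarrow> u x = 0"
  shows "test_fun u"
proof -
  have "u x = 0" if "\<bar>x\<bar> < a \<or> max b 0 < \<bar>x\<bar>" for x
    using assms(3)[of x] assms(2) that by (cases "x \<ge> 0") auto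
  then have "\<exists>a b. 0 < a \<and> (\<forall>x. \<bar>x\<bar> < a \<or> b < \<bar>x\<bar> \<longrightarrow> u x = 0)" using assms(2) by blast
  moreover have "u x = 0" if "x \<le> 0" for x using assms(2) assms(3)[of x] that by auto
  ultimately show ?thesis using assms(1) unfolding test_fun_def Cc_line_def by blast
qed

lemma test_fun_supp:
  assumes "test_fun u"
  obtains a b where "0 < a" "a < b" "\<And>x. x < a \<or> b < x \<Longrightarrow> u x = 0"
  using test_funE[OF assms] by metis

lemma test_fun_smooth: "test_fun u \<Longrightarrow> smooth1_on S u"
  by (erule test_funE) (auto simp: smooth1_on_def)

lemma test_fun_isCont: "test_fun u \<Longrightarrow> isCont u x"
  using smooth1_on_isCont[OF test_fun_smooth[of u UNIV]] by simp

lemma test_fun_integrable: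
  assumes "test_fun u" shows "integrable lborel u"
proof -
  obtain a b where "\<And>x. x < a \<or> b < x \<Longrightarrow> u x = 0" using assms by (rule test_fun_supp) blast
  then show ?thesis by (rule integrable_continuous_compact_support[OF test_fun_isCont[OF assms]])
qed

lemma test_fun_deriv:
  assumes "test_fun u" obtains u' where "test_fun u'" "\<And>x. (u has_real_derivative u' x) (at x)"
proof -
  obtain D a b where D: "D 0 = u" "\<And>n x. (D n has_real_derivative D (Suc n) x) (at x)" "0 < a" "a < b"
    "\<And>n x. x < a \<or> b < x \<Longrightarrow> D n x = 0" using assms by (rule test_funE) blast
  have "smooth1_on (- {0}) (D 1)" unfolding smooth1_on_def
    by (rule exI[of _ "\<lambda>n. D (Suc n)"]) (use D(2) in auto)
  then have "test_fun (D 1)" by (rule test_funI[OF _ D(3)]) (use D(5) in auto)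
  then show ?thesis using that[of "D 1"] D(2)[of 0] D(1) by simp
qed

lemma test_fun_mult:
  assumes "test_fun u" "smooth1_on (- {0}) w" shows "test_fun (\<lambda>x. w x * u x)"
proof -
  obtain a b where "0 < a" "\<And>x. x < a \<or> b < x \<Longrightarrow> u x = 0" using assms(1) by (rule test_fun_supp) blast
  then show ?thesis
    by (intro test_funI[of _ a b] smooth1_on_mult assms(2) test_fun_smooth[OF assms(1)]) auto
qed

lemma test_fun_diff_cmult:
  assumes "test_fun u" "test_fun v" shows "test_fun (\<lambda>x. u x - c * v x)"
proof -
  obtain a b where ab: "0 < a" "\<And>x. x < a \<or> b < x \<Longrightarrow> u x = 0" using assms(1) by (rule test_fun_supp) blast
  obtain a' b' where ab': "0 < a'" "\<And>x. x < a' \<or> b' < x \<Longrightarrow> v x = 0" using assms(2) by (rule test_fun_supp) blast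
  show ?thesis
  proof (rule test_funI)
    show "smooth1_on (- {0}) (\<lambda>x. u x - c * v x)"
      by (intro smooth1_on_diff smooth1_on_mult smooth1_on_const) (rule test_fun_smooth, fact)+
    show "0 < min a a'" using ab ab' by simp
    show "u x - c * v x = 0" if "x < min a a' \<or> max b b' < x" for x
      using ab(2)[of x] ab'(2)[of x] that by auto
  qed
qed

text \<open>Vanishing mean is what brings the antiderivative back to its initial constant to the
  right of the support, so that subtracting this constant gives compact support.\<close>

lemma test_fun_primitive:
  assumes "test_fun \<psi>" "(LINT x|lborel. \<psi> x) = 0"
  obtains u where "test_fun u" "\<And>x. (u has_real_derivative \<psi> x) (at x)"
proof -
  obtain a b where ab: "0 < a" "a < b" "\<And>x. x < a \<or> b < x \<Longrightarrow> \<psi> x = 0" using assms(1) by (rule test_fun_supp) blast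
  obtain F where F: "\<And>x. (F has_real_derivative \<psi> x) (at x)"
    using DERIV_antiderivative[of \<psi>] test_fun_isCont[OF assms(1)] by blast
  define c d where "c = a / 2" and "d = b + 1"
  have cd: "0 < c" "c < d" "c < a" "b < d" using ab by (auto simp: c_def d_def)
  have Fl: "F x = F c" if "x \<le> c" for x
  proof (rule DERIV_zero_const[where f = F])
    fix t assume "t \<in> {min x c..max x c}"
    then show "(F has_real_derivative 0) (at t)" using F[of t] ab(3)[of t] cd that by auto
  qed
  have Fr: "F x = F d" if "d \<le> x" for x
  proof (rule DERIV_zero_const[where f = F])
    fix t assume "t \<in> {min x d..max x d}"
    then show "(F has_real_derivative 0) (at t)" using F[of t] ab(3)[of t] cd that by auto
  qed
  have "has_bochner_integral lborel (\<lambda>x. \<psi> x * indicator {c..d} x) (F d - F c)"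
    by (rule has_bochner_integral_FTC_Icc_real) (use F cd test_fun_isCont[OF assms(1)] in auto)
  moreover have "(\<lambda>x. \<psi> x * indicator {c..d} x) = \<psi>"
  proof
    fix x show "\<psi> x * indicator {c..d} x = \<psi> x" using ab(3)[of x] cd by (cases "x \<in> {c..d}") auto
  qed
  ultimately have "F d = F c" using assms(2) by (auto simp: has_bochner_integral_iff)
  define u where "u x = F x - F c" for x
  have u: "(u has_real_derivative \<psi> x) (at x)" for x
    unfolding u_def using DERIV_diff[OF F DERIV_const[of "F c"]] by simp
  have "test_fun u"
  proof (rule test_funI[of _ c d])
    show "smooth1_on (- {0}) u" by (rule smooth1_on_antideriv[OF test_fun_smooth[OF assms(1)] u])
    show "u x = 0" if "x < c \<or> d < x" for x
      using that Fl[of x] Fr[of x] \<open>F d = F c\<close> by (auto simp: u_def)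
  qed (rule cd)
  then show ?thesis using that u by blast
qed

text \<open>Subtracting a suitable multiple of such a function gives any test function vanishing
  weighted mean, the condition under which \<open>test_fun_primitive\<close> applies.\<close>

lemma test_fun_normalized:
  assumes "\<And>x. x > 0 \<Longrightarrow> isCont w x" "\<And>x. x > 0 \<Longrightarrow> 0 < w x"
  obtains \<psi> where "test_fun \<psi>" "(LINT x|lborel. w x * \<psi> x) = 1"
proof -
  define b where "b x = flat_exp [:1:] (1 * x + (-1)) * flat_exp [:1:] ((-1) * x + 2)" for x
  have sb: "smooth1_on UNIV b" unfolding b_def
    by (intro smooth1_on_mult smooth1_on_affine[OF smooth_flat_exp]) simp_all
  have b0: "b x = 0" if "x \<le> 1 \<or> 2 \<le> x" for x using that by (auto simp: b_def flat_exp_def)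
  have bpos: "b x > 0" if "1 < x" "x < 2" for x using that by (auto simp: b_def flat_exp_def)
  have tb: "test_fun b" by (rule test_funI[of _ 1 2]) (use b0 smooth1_on_subset[OF sb] in auto)
  have cont: "isCont (\<lambda>x. w x * b x) x" if "x > 0" for x
    by (intro continuous_mult assms that test_fun_isCont[OF tb])
  obtain F where F: "\<And>x. x > 0 \<Longrightarrow> (F has_real_derivative w x * b x) (at x)"
    using DERIV_antiderivative_pos[of "\<lambda>x. w x * b x"] cont by blast
  have "has_bochner_integral lborel (\<lambda>x. (w x * b x) * indicator {1..2} x) (F 2 - F 1)"
    by (rule has_bochner_integral_FTC_Icc_real) (use F cont in auto)
  moreover have "(\<lambda>x. (w x * b x) * indicator {1..2} x) = (\<lambda>x. w x * b x)"
  proof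
    fix x show "(w x * b x) * indicator {1..2} x = w x * b x" using b0[of x] by (cases "x \<in> {1..2}") auto
  qed
  ultimately have int: "(LINT x|lborel. w x * b x) = F 2 - F 1" by (simp add: has_bochner_integral_iff)
  have lt: "F 1 < F 2"
  proof (rule DERIV_pos_imp_increasing_open[where f = F])
    show "(1::real) < 2" by simp
    show "\<exists>y. (F has_real_derivative y) (at x) \<and> 0 < y" if "1 < x" "x < 2" for x
      using F[of x] bpos[OF that] assms(2)[of x] that by (intro exI[of _ "w x * b x"]) auto
    show "continuous_on {1..2} F"
    proof (intro continuous_at_imp_continuous_on ballI)
      fix x :: real assume "x \<in> {1..2}"
      then show "isCont F x" by (intro DERIV_isCont[OF F]) auto
    qed
  qed
  show ?thesis
  proof (rule that[of "\<lambda>x. 1 / (F 2 - F 1) * b x"])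
    show "test_fun (\<lambda>x. 1 / (F 2 - F 1) * b x)" by (intro test_fun_mult tb smooth1_on_const)
    have "(\<lambda>x. w x * (1 / (F 2 - F 1) * b x)) = (\<lambda>x. 1 / (F 2 - F 1) * (w x * b x))" by (simp add: fun_eq_iff)
    then have "(LINT x|lborel. w x * (1 / (F 2 - F 1) * b x)) = 1 / (F 2 - F 1) * (F 2 - F 1)"
      using int by (simp only: integral_mult_right_zero)
    then show "(LINT x|lborel. w x * (1 / (F 2 - F 1) * b x)) = 1" using lt by simp
  qed
qed

section \<open>Locally integrable functions and their primitives\<close>

definition loc_int :: "(real \<Rightarrow> real) \<Rightarrow> bool" where
  "loc_int g \<longleftrightarrow> (\<forall>a b. 0 < a \<longrightarrow> integrable lborel (\<lambda>x. indicator {a..b} x * g x))"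

lemma loc_int_mult:
  assumes "loc_int g" "\<And>x. 0 < x \<Longrightarrow> isCont w x" shows "loc_int (\<lambda>x. w x * g x)"
  unfolding loc_int_def
proof (intro allI impI)
  fix a b :: real assume a: "0 < a"
  have "compact (w ` {a..b})"
    using assms(2) a by (intro compact_continuous_image continuous_at_imp_continuous_on) auto
  then obtain C where C: "\<And>x. x \<in> {a..b} \<Longrightarrow> \<bar>w x\<bar> \<le> C"
    using compact_imp_bounded bounded_iff by (metis image_eqI real_norm_def)
  have ig: "integrable lborel (\<lambda>x. indicator {a..b} x * g x)" using assms(1) a by (auto simp: loc_int_def)
  have iw: "integrable lborel (\<lambda>x. w x * indicator {a..b} x)"
    by (rule borel_integrable_atLeastAtMost) (use assms(2) a in auto)
  have eq: "(\<lambda>x. indicator {a..b} x * (w x * g x)) = (\<lambda>x. (w x * indicator {a..b} x) * (indicator {a..b} x * g x))"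
    by (auto simp: fun_eq_iff indicator_def)
  show "integrable lborel (\<lambda>x. indicator {a..b} x * (w x * g x))"
  proof (rule Bochner_Integration.integrable_bound)
    show "integrable lborel (\<lambda>x. C * (indicator {a..b} x * g x))" using ig by simp
    show "(\<lambda>x. indicator {a..b} x * (w x * g x)) \<in> borel_measurable lborel"
      unfolding eq
      by (rule borel_measurable_times[OF borel_measurable_integrable[OF iw] borel_measurable_integrable[OF ig]])
    show "AE x in lborel. norm (indicator {a..b} x * (w x * g x)) \<le> norm (C * (indicator {a..b} x * g x))"
    proof (rule AE_I2)
      fix x show "norm (indicator {a..b} x * (w x * g x)) \<le> norm (C * (indicator {a..b} x * g x))"
      proof (cases "x \<in> {a..b}")
        case True
        then have "\<bar>w x\<bar> \<le> \<bar>C\<bar>" using C[OF True] by linarith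
        then show ?thesis using True by (simp add: abs_mult mult_right_mono)
      qed simp
    qed
  qed
qed

lemma loc_int_cont: assumes "\<And>x. 0 < x \<Longrightarrow> isCont g x" shows "loc_int g"
  unfolding loc_int_def
proof (intro allI impI)
  fix a b :: real assume a: "0 < a"
  have "integrable lborel (\<lambda>x. g x * indicator {a..b} x)"
    by (rule borel_integrable_atLeastAtMost) (use assms a in auto)
  then show "integrable lborel (\<lambda>x. indicator {a..b} x * g x)" by (simp add: mult.commute)
qed

lemma loc_int_diff: "loc_int f \<Longrightarrow> loc_int g \<Longrightarrow> loc_int (\<lambda>x. f x - g x)"
  unfolding loc_int_def right_diff_distrib by (auto intro: Bochner_Integration.integrable_diff)

lemma loc_int_test_mult:
  assumes "loc_int g" "\<And>x. isCont \<phi> x" "0 < a" "\<And>x. x < a \<or> b < x \<Longrightarrow> \<phi> x = 0"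
  shows "integrable lborel (\<lambda>x. \<phi> x * g x)"
proof -
  have "loc_int (\<lambda>x. \<phi> x * g x)" by (rule loc_int_mult) (use assms in auto)
  then have "integrable lborel (\<lambda>x. indicator {a..b} x * (\<phi> x * g x))" using assms by (auto simp: loc_int_def)
  also have "(\<lambda>x. indicator {a..b} x * (\<phi> x * g x)) = (\<lambda>x. \<phi> x * g x)"
  proof
    fix x show "indicator {a..b} x * (\<phi> x * g x) = \<phi> x * g x"
      using assms(4)[of x] by (cases "x \<in> {a..b}") auto
  qed
  finally show ?thesis .
qed

lemma loc_int_test_fun_mult:
  assumes "loc_int g" "test_fun \<phi>" shows "integrable lborel (\<lambda>x. \<phi> x * g x)"
proof -
  obtain a b where "0 < a" "\<And>x. x < a \<or> b < x \<Longrightarrow> \<phi> x = 0" using assms(2) by (rule test_fun_supp) blast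
  then show ?thesis by (rule loc_int_test_mult[OF assms(1) test_fun_isCont[OF assms(2)]])
qed

lemma loc_int_measurable:
  "loc_int g \<Longrightarrow> 0 < a \<Longrightarrow> (\<lambda>x. indicator {a..b} x * g x) \<in> borel_measurable lborel"
  by (rule borel_measurable_integrable) (simp add: loc_int_def)

lemma loc_int_measurable_open:
  assumes "loc_int g" "0 < a" shows "(\<lambda>x. indicator {a<..<b} x * g x) \<in> borel_measurable lborel"
proof -
  have "(\<lambda>x. indicator {a<..<b} x * (indicator {a..b} x * g x)) \<in> borel_measurable lborel"
    by (rule borel_measurable_times[OF _ loc_int_measurable[OF assms]]) simp
  also have "(\<lambda>x. indicator {a<..<b} x * (indicator {a..b} x * g x)) = (\<lambda>x. indicator {a<..<b} x * g x)"
    by (auto simp: fun_eq_iff indicator_def)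
  finally show ?thesis .
qed

text \<open>The oriented integral from 1 to \<open>x\<close>. The difference of indicators covers
  both orientations in one formula, and the base point 1 avoids integrating up to the
  origin.\<close>

definition primitive :: "(real \<Rightarrow> real) \<Rightarrow> real \<Rightarrow> real" where
  "primitive g x = (LINT t|lborel. (indicator {1<..x} t - indicator {x<..1} t) * g t)"

lemma primitive_eq:
  assumes g: "loc_int g" and a: "0 < a" "a \<le> 1" "a \<le> x"
  shows "primitive g x = (LINT t|lborel. indicator {a..x} t * g t) - (LINT t|lborel. indicator {a..1} t * g t)"
proof -
  have "(LINT t|lborel. indicator {a..x} t * g t) - (LINT t|lborel. indicator {a..1} t * g t)
    = (LINT t|lborel. indicator {a..x} t * g t - indicator {a..1} t * g t)"
    by (rule Bochner_Integration.integral_diff[symmetric]) (use g a in \<open>auto simp: loc_int_def\<close>)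
  also have "\<dots> = primitive g x" unfolding primitive_def
    by (intro Bochner_Integration.integral_cong) (use a in \<open>auto simp: indicator_def\<close>)
  finally show ?thesis by simp
qed

lemma isCont_primitive:
  assumes g: "loc_int g" and x: "0 < x" shows "isCont (primitive g) x"
proof -
  define a b where "a = min x 1 / 2" and "b = max x 1 + 1"
  have ab: "0 < a" "a < x" "a < 1" "x < b" using x by (auto simp: a_def b_def)
  have ig: "set_integrable lborel {a..t} g" for t
    using g ab(1) by (simp add: loc_int_def set_integrable_def)
  have "continuous_on {a..b} (\<lambda>t. integral {a..t} g)"
    using set_borel_integral_eq_integral(1)[OF ig] by (rule indefinite_integral_continuous_1)
  then have "continuous_on {a..b} (\<lambda>t. integral {a..t} g - integral {a..1} g)" by (intro continuous_intros)
  then have "continuous_on {a<..<b} (\<lambda>t. integral {a..t} g - integral {a..1} g)"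
    by (rule continuous_on_subset) auto
  moreover have "integral {a..t} g - integral {a..1} g = primitive g t" if "t \<in> {a<..<b}" for t
    using primitive_eq[OF g ab(1), of t] that ab set_borel_integral_eq_integral(2)[OF ig]
    by (simp add: set_lebesgue_integral_def)
  ultimately have "continuous_on {a<..<b} (primitive g)"
    using continuous_on_cong[of "{a<..<b}"] by (metis (mono_tags, lifting))
  then show ?thesis using ab by (simp add: continuous_on_eq_continuous_at)
qed

lemma DERIV_primitive:
  assumes g: "\<And>x. 0 < x \<Longrightarrow> isCont g x" and x: "0 < x"
  shows "(primitive g has_real_derivative g x) (at x)"
proof -
  obtain F where F: "\<And>x. x > 0 \<Longrightarrow> (F has_real_derivative g x) (at x)"
    using DERIV_antiderivative_pos[of g] g by blast
  have FTC: "(LINT t|lborel. indicator {a..b} t * g t) = F b - F a" if "0 < a" "a \<le> b" for a b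
  proof -
    have "has_bochner_integral lborel (\<lambda>t. g t * indicator {a..b} t) (F b - F a)"
      by (rule has_bochner_integral_FTC_Icc_real) (use F g that in auto)
    then show ?thesis by (simp add: has_bochner_integral_iff mult.commute)
  qed
  have "F t - F 1 = primitive g t" if "t \<in> {0<..}" for t
    using primitive_eq[OF loc_int_cont[OF g], of "min t 1" t] FTC[of "min t 1" t] FTC[of "min t 1" 1] that by auto
  moreover have "((\<lambda>t. F t - F 1) has_real_derivative g x) (at x)"
    using DERIV_diff[OF F[OF x] DERIV_const[of "F 1"]] by simp
  ultimately show ?thesis using has_field_derivative_transform_within_open[of "\<lambda>t. F t - F 1" "g x" x "{0<..}" "primitive g"] x
    by auto
qed

text \<open>A locally integrable \<open>g\<close> need not have a primitive differentiable
  everywhere, so the product rule is replaced by Fubini on the region \<open>x \<le> t\<close>, with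
  \<open>\<phi>\<close> recovered as the tail integral of \<open>- \<phi>'\<close>.\<close>

lemma integral_by_parts_loc_int:
  assumes g: "loc_int g" and \<phi>: "test_fun \<phi>" "test_fun \<phi>'" "\<And>x. (\<phi> has_real_derivative \<phi>' x) (at x)"
  shows "(LINT x|lborel. \<phi> x * g x) = - (LINT x|lborel. \<phi>' x * primitive g x)"
proof -
  obtain a0 b0 where 0: "0 < a0" "a0 < b0" "\<And>x. x < a0 \<or> b0 < x \<Longrightarrow> \<phi> x = 0" using \<phi>(1) by (rule test_fun_supp) blast
  obtain a1 b1 where 1: "0 < a1" "a1 < b1" "\<And>x. x < a1 \<or> b1 < x \<Longrightarrow> \<phi>' x = 0" using \<phi>(2) by (rule test_fun_supp) blast
  define a b where "a = min (min a0 a1) 1" and "b = max (max b0 b1) 1"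
  have a: "0 < a" "a \<le> 1" "1 \<le> b" using 0 1 by (auto simp: a_def b_def)
  have supp: "\<phi> x = 0" "\<phi>' x = 0" if "x < a \<or> b < x" for x
    using that by (auto simp: a_def b_def intro!: 0(3) 1(3))
  define G where "G x = indicator {a..b} x * g x" for x
  have iG: "integrable lborel G" using g a unfolding G_def loc_int_def by simp
  have i\<phi>': "integrable lborel \<phi>'" by (rule test_fun_integrable[OF \<phi>(2)])
  have [measurable]: "G \<in> borel_measurable borel" "\<phi>' \<in> borel_measurable borel" using iG i\<phi>' by auto
  let ?H = "\<lambda>x t. G x * (\<phi>' t * indicator {x..} t)"
  have mI: "(\<lambda>(x::real, t::real). indicator {x..} t :: real) \<in> borel_measurable (lborel \<Otimes>\<^sub>M lborel)"
  proof -
    have "(\<lambda>p. indicator {p. fst p \<le> snd p} p :: real) \<in> borel_measurable (borel \<Otimes>\<^sub>M (borel :: real measure))"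
      by measurable
    also have "(\<lambda>p. indicator {p. fst p \<le> snd p} p :: real) = (\<lambda>(x, t). indicator {x..} t)"
      by (auto simp: fun_eq_iff indicator_def)
    finally show ?thesis
      unfolding measurable_cong_sets[OF sets_pair_measure_cong[OF sets_lborel sets_lborel] refl] .
  qed
  then have [measurable]: "(\<lambda>p::real \<times> real. indicator {fst p..} (snd p) :: real) \<in> borel_measurable (lborel \<Otimes>\<^sub>M lborel)"
    unfolding split_beta' .
  have i1: "integrable (lborel \<Otimes>\<^sub>M lborel) (\<lambda>(x, t). G x * \<phi>' t)"
    by (rule lborel_pair.Fubini_integrable) (use iG i\<phi>' in \<open>auto simp: abs_mult split_beta'\<close>)
  have "integrable (lborel \<Otimes>\<^sub>M lborel) (\<lambda>(x, t). ?H x t)"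
    by (rule Bochner_Integration.integrable_bound[OF i1]) (auto simp: split_beta' indicator_def)
  then have fub: "(LINT t|lborel. LINT x|lborel. ?H x t) = (LINT x|lborel. LINT t|lborel. ?H x t)"
    by (rule lborel_pair.Fubini_integral)
  have tail: "G x * (LINT t|lborel. \<phi>' t * indicator {x..} t) = - (\<phi> x * g x)" for x
  proof (cases "x \<in> {a..b}")
    case True
    have "has_bochner_integral lborel (\<lambda>t. \<phi>' t * indicator {x..b + 1} t) (\<phi> (b + 1) - \<phi> x)"
      by (rule has_bochner_integral_FTC_Icc_real) (use \<phi>(3) True test_fun_isCont[OF \<phi>(2)] in auto)
    moreover have "(\<lambda>t. \<phi>' t * indicator {x..b + 1} t) = (\<lambda>t. \<phi>' t * indicator {x..} t)"
    proof
      fix t show "\<phi>' t * indicator {x..b + 1} t = \<phi>' t * indicator {x..} t"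
        using supp(2)[of t] by (cases "t \<le> b + 1") (auto simp: indicator_def)
    qed
    ultimately have "(LINT t|lborel. \<phi>' t * indicator {x..} t) = - \<phi> x"
      using supp(1)[of "b + 1"] by (simp add: has_bochner_integral_iff)
    then show ?thesis using True by (simp add: G_def)
  next
    case False
    then show ?thesis using supp(1)[of x] by (auto simp: G_def)
  qed
  \<comment> \<open>The offset between integrating from \<open>a\<close> and from the base point 1.
    It drops out at the end because \<open>\<phi>'\<close> has integral 0.\<close>
  define A where "A = (LINT x|lborel. indicator {a..1} x * g x)"
  have head: "\<phi>' t * (LINT x|lborel. G x * indicator {x..} t) = \<phi>' t * primitive g t + A * \<phi>' t" for t
  proof (cases "t \<in> {a..b}")
    case True
    have "(LINT x|lborel. G x * indicator {x..} t) = (LINT x|lborel. indicator {a..t} x * g x)"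
      by (intro Bochner_Integration.integral_cong) (use True in \<open>auto simp: G_def indicator_def\<close>)
    also have "\<dots> = primitive g t + A"
      using primitive_eq[OF g a(1,2), of t] True by (simp add: A_def)
    finally show ?thesis by (simp add: algebra_simps)
  next
    case False
    then show ?thesis using supp(2)[of t] by auto
  qed
  have l: "(LINT x|lborel. LINT t|lborel. ?H x t) = - (LINT x|lborel. \<phi> x * g x)"
    by (simp add: tail)
  have "(LINT x|lborel. ?H x t) = \<phi>' t * (LINT x|lborel. G x * indicator {x..} t)" for t
    by (subst integral_mult_right_zero[symmetric]) (simp add: mult.left_commute)
  then have "(LINT t|lborel. LINT x|lborel. ?H x t) = (LINT t|lborel. \<phi>' t * (LINT x|lborel. G x * indicator {x..} t))"
    by simp
  also have "\<dots> = (LINT t|lborel. \<phi>' t * primitive g t + A * \<phi>' t)" by (simp only: head)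
  also have "\<dots> = (LINT t|lborel. \<phi>' t * primitive g t) + A * (LINT t|lborel. \<phi>' t)"
    using loc_int_test_fun_mult[OF loc_int_cont \<phi>(2), of "primitive g"] isCont_primitive[OF g] i\<phi>'
    by (subst Bochner_Integration.integral_add) auto
  also have "(LINT t|lborel. \<phi>' t) = 0"
    by (rule integral_DERIV_compact_support(2)[OF \<phi>(3) test_fun_isCont[OF \<phi>(2)], of a b]) (use supp in auto)
  finally show ?thesis using l fub by simp
qed

text \<open>Smooth plateaus converge boundedly to the indicators of open intervals, so
  \<open>f\<close> integrates to 0 over every interval compactly contained in the half line.\<close>

lemma fundamental_lemma:
  assumes f: "loc_int f" and z: "\<And>\<psi>. test_fun \<psi> \<Longrightarrow> (LINT x|lborel. \<psi> x * f x) = 0"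
  shows "AE x in lborel. 0 < x \<longrightarrow> f x = 0"
proof -
  obtain \<sigma> :: "real \<Rightarrow> real" where \<sigma>: "smooth1_on UNIV \<sigma>" "\<And>x. x \<le> 0 \<Longrightarrow> \<sigma> x = 0" "\<And>x. x \<ge> 1 \<Longrightarrow> \<sigma> x = 1"
    "\<And>x. 0 \<le> \<sigma> x" "\<And>x. \<sigma> x \<le> 1" by (rule smooth_step) blast
  have interval: "(LINT x|lborel. indicator {a<..<b} x * f x) = 0" if ab: "0 < a" for a b
  proof -
    \<comment> \<open>A plateau inside the interval, with ramps of width \<open>1 / n\<close> at
      both ends.\<close>
    define \<psi> where "\<psi> n x = \<sigma> (real n * x + - real n * a) * \<sigma> (- real n * x + real n * b)" for n :: nat and x
    have supp: "\<psi> n x = 0" if "x \<le> a \<or> b \<le> x" for n x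
    proof -
      have "real n * x + - real n * a \<le> 0 \<or> - real n * x + real n * b \<le> 0"
        using that by (auto intro: mult_left_mono)
      then show ?thesis using \<sigma>(2) by (auto simp: \<psi>_def)
    qed
    have t: "test_fun (\<psi> n)" for n
    proof (rule test_funI[OF _ ab, of _ b])
      show "smooth1_on (- {0}) (\<psi> n)" unfolding \<psi>_def
        by (intro smooth1_on_mult smooth1_on_affine[OF \<sigma>(1)]) auto
    qed (use supp in auto)
    have b\<psi>: "\<bar>\<psi> n x\<bar> \<le> 1" for n x
      unfolding \<psi>_def using \<sigma>(4,5) by (simp add: abs_mult mult_le_one)
    have "(\<lambda>n. LINT x|lborel. \<psi> n x * f x) \<longlonglongrightarrow> (LINT x|lborel. indicator {a<..<b} x * f x)"
    proof (rule integral_dominated_convergence[where w = "\<lambda>x. \<bar>indicator {a..b} x * f x\<bar>"])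
      show "integrable lborel (\<lambda>x. \<bar>indicator {a..b} x * f x\<bar>)" using f ab by (auto simp: loc_int_def)
      show "(\<lambda>x. \<psi> n x * f x) \<in> borel_measurable lborel" for n
        using loc_int_test_fun_mult[OF f t] by auto
      show "(\<lambda>x. indicator {a<..<b} x * f x) \<in> borel_measurable lborel"
        by (rule loc_int_measurable_open[OF f ab])
      show "AE x in lborel. norm (\<psi> n x * f x) \<le> \<bar>indicator {a..b} x * f x\<bar>" for n
      proof (rule AE_I2)
        fix x show "norm (\<psi> n x * f x) \<le> \<bar>indicator {a..b} x * f x\<bar>"
          using supp[of x n] mult_right_mono[OF b\<psi>[of n x], of "\<bar>f x\<bar>"]
          by (cases "x \<in> {a..b}") (auto simp: abs_mult)
      qed
      show "AE x in lborel. (\<lambda>n. \<psi> n x * f x) \<longlonglongrightarrow> indicator {a<..<b} x * f x"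
      proof (rule AE_I2)
        fix x
        have "(\<lambda>n. \<psi> n x) \<longlonglongrightarrow> indicator {a<..<b} x"
        proof (cases "x \<in> {a<..<b}")
          case True
          define m where "m = min (x - a) (b - x)"
          have m: "0 < m" using True by (simp add: m_def)
          obtain N :: nat where N: "1 / m < N" using reals_Archimedean2 by blast
          have "\<psi> n x = 1" if "n \<ge> N" for n
          proof -
            have "1 / m \<le> real n" using N that by linarith
            then have nm: "1 \<le> real n * m" using m by (simp add: field_simps)
            have "real n * m \<le> real n * (x - a)" "real n * m \<le> real n * (b - x)"
              by (intro mult_left_mono; simp add: m_def)+
            then have "1 \<le> real n * (x - a)" "1 \<le> real n * (b - x)" using nm by linarith+
            then show ?thesis by (simp add: \<psi>_def \<sigma>(3) algebra_simps)
          qed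
          then show ?thesis using True by (intro tendsto_eventually) (auto simp: eventually_sequentially)
        next
          case False
          then have "\<psi> n x = 0" for n by (intro supp) auto
          then show ?thesis using False by simp
        qed
        then show "(\<lambda>n. \<psi> n x * f x) \<longlonglongrightarrow> indicator {a<..<b} x * f x" by (rule tendsto_mult_right)
      qed
    qed
    then show ?thesis using z[OF t] by (simp add: LIMSEQ_const_iff)
  qed
  \<comment> \<open>Countably many compact intervals exhaust the half line; clipping an open
    interval to one of them changes only endpoints, a null set.\<close>
  have piece: "AE x in lborel. indicator {1 / real (Suc n)..real n} x * f x = 0" for n
  proof (rule AE_zero_if_interval_integrals_zero)
    show "integrable lborel (\<lambda>x. indicator {1 / real (Suc n)..real n} x * f x)" using f by (auto simp: loc_int_def)
    fix a b :: real
    define a' b' where "a' = max a (1 / real (Suc n))" and "b' = min b (real n)"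
    have "0 < a'" by (simp add: a'_def less_max_iff_disj)
    have "AE x in lborel. x \<noteq> a' \<and> x \<noteq> b'"
      using AE_lborel_singleton[of a'] AE_lborel_singleton[of b'] by eventually_elim simp
    then have ae: "AE x in lborel. indicator {a<..<b} x * (indicator {1 / real (Suc n)..real n} x * f x)
        = indicator {a'<..<b'} x * f x"
      by eventually_elim (auto simp: indicator_def a'_def b'_def)
    have "(LINT x|lborel. indicator {a<..<b} x * (indicator {1 / real (Suc n)..real n} x * f x))
        = (LINT x|lborel. indicator {a'<..<b'} x * f x)"
    proof (rule integral_cong_AE[OF _ _ ae])
      show "(\<lambda>x. indicator {a<..<b} x * (indicator {1 / real (Suc n)..real n} x * f x)) \<in> borel_measurable lborel"
        by (rule borel_measurable_times[OF _ loc_int_measurable[OF f]]) simp_all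
      show "(\<lambda>x. indicator {a'<..<b'} x * f x) \<in> borel_measurable lborel"
        by (rule loc_int_measurable_open[OF f \<open>0 < a'\<close>])
    qed
    then show "(LINT x|lborel. indicator {a<..<b} x * (indicator {1 / real (Suc n)..real n} x * f x)) = 0"
      using interval[OF \<open>0 < a'\<close>] by simp
  qed
  then have "AE x in lborel. \<forall>n. indicator {1 / real (Suc n)..real n} x * f x = 0" by (intro AE_all_countable[THEN iffD2] allI piece)
  then show ?thesis
  proof eventually_elim
    case (elim x)
    show ?case
    proof
      assume x: "0 < x"
      obtain n :: nat where n: "max x (1 / x) < n" using reals_Archimedean2 by blast
      then have "1 / x \<le> real (Suc n)" by simp
      then have "1 / real (Suc n) \<le> x" using x by (simp add: field_simps)
      then have "x \<in> {1 / real (Suc n)..real n}" using n by simp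
      then show "f x = 0" using elim[rule_format, of n] by simp
    qed
  qed
qed

lemma isCont_abs_powr: "0 < x \<Longrightarrow> isCont (\<lambda>x::real. \<bar>x\<bar> powr a) x"
  by (intro continuous_intros) auto

lemma primitive_cong_AE:
  assumes "loc_int f" "loc_int g" "AE t in lborel. 0 < t \<longrightarrow> f t = g t" "0 < x"
  shows "primitive f x = primitive g x"
proof -
  define a where "a = min x 1"
  have a: "0 < a" "a \<le> 1" "a \<le> x" using assms(4) by (auto simp: a_def)
  have "(LINT t|lborel. indicator {a..b} t * f t) = (LINT t|lborel. indicator {a..b} t * g t)" for b
  proof (rule integral_cong_AE[OF loc_int_measurable[OF assms(1) a(1)] loc_int_measurable[OF assms(2) a(1)]])
    show "AE t in lborel. indicator {a..b} t * f t = indicator {a..b} t * g t"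
      using assms(3) by eventually_elim (use a(1) in \<open>auto simp: indicator_def\<close>)
  qed
  then show ?thesis unfolding primitive_eq[OF assms(1) a] primitive_eq[OF assms(2) a] by simp
qed

text \<open>On a compact interval away from 0 the inverse weight is bounded by some
  \<open>C\<close>, and \<open>|v| \<le> 1 + v\<^sup>2\<close> reduces local integrability to the
  weighted square.\<close>

lemma loc_int_weighted_L2:
  assumes "integrable lborel (\<lambda>x. indicator {0<..} x * (\<bar>x\<bar> powr (- \<alpha>) * (v x)\<^sup>2))"
    and v: "v \<in> borel_measurable borel"
  shows "loc_int v"
  unfolding loc_int_def
proof (intro allI impI)
  fix a b :: real assume a: "0 < a"
  let ?h = "\<lambda>x. indicator {0<..} x * (\<bar>x\<bar> powr (- \<alpha>) * (v x)\<^sup>2)"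
  have "compact ((\<lambda>x. \<bar>x\<bar> powr \<alpha>) ` {a..b})"
    using a by (intro compact_continuous_image continuous_at_imp_continuous_on ballI isCont_abs_powr) auto
  then obtain C where C: "\<And>x. x \<in> {a..b} \<Longrightarrow> \<bar>\<bar>x\<bar> powr \<alpha>\<bar> \<le> C"
    using compact_imp_bounded bounded_iff by (metis image_eqI real_norm_def)
  show "integrable lborel (\<lambda>x. indicator {a..b} x * v x)"
  proof (rule Bochner_Integration.integrable_bound)
    show "integrable lborel (\<lambda>x. indicator {a..b} x + C * ?h x)"
      using assms(1)
      by (intro Bochner_Integration.integrable_add integrable_mult_right integrable_real_indicator)
        (auto simp: emeasure_lborel_Icc_eq)
    show "(\<lambda>x. indicator {a..b} x * v x) \<in> borel_measurable lborel" using v by simp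
    show "AE x in lborel. norm (indicator {a..b} x * v x) \<le> norm (indicator {a..b} x + C * ?h x)"
    proof (rule AE_I2)
      fix x show "norm (indicator {a..b} x * v x) \<le> norm (indicator {a..b} x + C * ?h x)"
      proof (cases "x \<in> {a..b}")
        case True
        have "\<bar>v x\<bar> \<le> 1 + (v x)\<^sup>2"
          using zero_le_power2[of "\<bar>v x\<bar> - 1"] zero_le_power2[of "v x"]
          by (simp add: power2_diff del: zero_le_power2)
        also have "(v x)\<^sup>2 = \<bar>x\<bar> powr \<alpha> * ?h x"
          using True a by (simp add: mult.assoc[symmetric] powr_add[symmetric])
        also have "\<dots> \<le> C * ?h x"
          using C[OF True] by (intro mult_right_mono) auto
        finally show ?thesis using True by simp
      qed simp
    qed
  qed
qed

section \<open>From weak to classical solutions\<close>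

context radial_ode
begin

lemma isCont_q: "0 < x \<Longrightarrow> isCont q x"
  unfolding q_def by (intro continuous_intros isCont_abs_powr) auto

text \<open>Two applications of the du Bois-Reymond argument. The equation in divergence form says
  that the conormal derivative of \<open>v\<close> has derivative \<open>q * v\<close>, so
  \<open>v\<close> is almost everywhere a function \<open>y\<close> with
  \<open>y' = r * (Q + B)\<close>, where \<open>Q\<close> is a primitive of \<open>q * v\<close>.
  Continuity of \<open>y\<close> then makes \<open>Q\<close> differentiable, and the classical
  result \<open>L2_solution_zero\<close> applies.\<close>

lemma half_line_kernel:
  assumes v: "v \<in> borel_measurable borel"
    and int: "integrable lborel (\<lambda>x. indicator {0<..} x * (\<bar>x\<bar> powr (- \<alpha>) * (v x)\<^sup>2))"
    and weak: "\<And>u u' u''. test_fun u \<Longrightarrow> (\<And>x. (u has_real_derivative u' x) (at x)) \<Longrightarrow>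
      (\<And>x. (u' has_real_derivative u'' x) (at x)) \<Longrightarrow>
      (LINT x|lborel. \<bar>x\<bar> powr (- \<alpha>) *
        ((u'' x - \<alpha> / x * u' x - K * \<bar>x\<bar> powr (2 * \<alpha>) * u x - u x) * v x)) = 0"
  shows "AE x in lborel. 0 < x \<longrightarrow> v x = 0"
proof -
  have lv: "loc_int v" by (rule loc_int_weighted_L2[OF int v])
  have lqv: "loc_int (\<lambda>x. q x * v x)" by (rule loc_int_mult[OF lv isCont_q])
  define Q where "Q = primitive (\<lambda>x. q x * v x)"
  have cQ: "isCont Q x" if "0 < x" for x unfolding Q_def by (rule isCont_primitive[OF lqv that])
  define r where "r x = \<bar>x\<bar> powr \<alpha>" for x :: real
  have cr: "isCont r x" if "0 < x" for x unfolding r_def by (rule isCont_abs_powr[OF that])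
  have sr: "smooth1_on (- {0}) r" unfolding r_def by (rule smooth1_on_abs_powr)
  have lrQ: "loc_int (\<lambda>x. r x * Q x)"
    by (rule loc_int_cont) (intro continuous_mult cr cQ)
  \<comment> \<open>The test function is an antiderivative \<open>u\<close> of
    \<open>r * \<Psi>\<close>, so that its conormal derivative is \<open>\<Psi>\<close>. The
    constraint on the integral of \<open>r * \<Psi>\<close> makes \<open>u\<close> compactly
    supported.\<close>
  have step1: "(LINT x|lborel. \<Psi>' x * v x) = - (LINT x|lborel. \<Psi> x * (r x * Q x))"
    if \<Psi>: "test_fun \<Psi>" "test_fun \<Psi>'" "\<And>x. (\<Psi> has_real_derivative \<Psi>' x) (at x)"
      and z: "(LINT x|lborel. r x * \<Psi> x) = 0" for \<Psi> \<Psi>'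
  proof -
    have t\<psi>: "test_fun (\<lambda>x. r x * \<Psi> x)" by (rule test_fun_mult[OF \<Psi>(1) sr])
    obtain u where u: "test_fun u" "\<And>x. (u has_real_derivative r x * \<Psi> x) (at x)"
      using t\<psi> z by (rule test_fun_primitive) blast
    obtain \<psi>' where \<psi>': "test_fun \<psi>'" "\<And>x. ((\<lambda>x. r x * \<Psi> x) has_real_derivative \<psi>' x) (at x)"
      using t\<psi> by (rule test_fun_deriv) blast
    have "\<bar>x\<bar> powr (- \<alpha>) * ((\<psi>' x - \<alpha> / x * (r x * \<Psi> x) - K * \<bar>x\<bar> powr (2 * \<alpha>) * u x - u x) * v x)
        = \<Psi>' x * v x - u x * (q x * v x)" for x
    proof (cases "0 < x")
      case True
      have "(r has_real_derivative \<alpha> * x powr (\<alpha> - 1)) (at x)"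
        by (rule has_field_derivative_transform_within_open[of "\<lambda>x. x powr \<alpha>" _ _ "{0<..}"])
          (use True in \<open>auto intro!: derivative_eq_intros simp: r_def\<close>)
      from DERIV_unique[OF \<psi>'(2) DERIV_mult[OF this \<Psi>(3)]]
      have "\<psi>' x = \<alpha> * x powr (\<alpha> - 1) * \<Psi> x + \<Psi>' x * x powr \<alpha>" using True by (simp add: r_def)
      also have "x powr (\<alpha> - 1) = x powr \<alpha> / x" using True by (simp add: powr_diff)
      finally have e: "\<psi>' x - \<alpha> / x * (r x * \<Psi> x) = x powr \<alpha> * \<Psi>' x" using True by (simp add: r_def)
      have "x powr \<alpha> * x powr (- \<alpha>) = 1" using True by (simp add: powr_add[symmetric])
      then show ?thesis unfolding e using True by (simp add: q_def algebra_simps)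
    next
      case False
      then have "u x = 0" "\<psi>' x = 0" "\<Psi> x = 0" "\<Psi>' x = 0" using u \<psi>' \<Psi> by (auto simp: test_fun_def)
      then show ?thesis by simp
    qed
    then have "(LINT x|lborel. \<Psi>' x * v x - u x * (q x * v x)) = 0"
      using weak[OF u(1,2) \<psi>'(2)] by simp
    then have "(LINT x|lborel. \<Psi>' x * v x) = (LINT x|lborel. u x * (q x * v x))"
      using loc_int_test_fun_mult[OF lv \<Psi>(2)] loc_int_test_fun_mult[OF lqv u(1)] by simp
    also have "\<dots> = - (LINT x|lborel. (r x * \<Psi> x) * Q x)"
      unfolding Q_def by (rule integral_by_parts_loc_int[OF lqv u(1) t\<psi> u(2)])
    finally show ?thesis by (simp add: mult_ac)
  qed
  \<comment> \<open>A fixed normaliser removes the constraint of \<open>step1\<close>. The price is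
    the constant \<open>B\<close>: the weak derivative of \<open>v\<close> is
    \<open>r * (Q + B)\<close>.\<close>
  obtain \<Psi>\<^sub>0 where \<Psi>0: "test_fun \<Psi>\<^sub>0" "(LINT x|lborel. r x * \<Psi>\<^sub>0 x) = 1"
  proof (rule test_fun_normalized[of r])
    show "0 < r x" if "0 < x" for x using that by (simp add: r_def)
  qed (use cr in blast)+
  obtain \<Psi>\<^sub>0' where \<Psi>0': "test_fun \<Psi>\<^sub>0'" "\<And>x. (\<Psi>\<^sub>0 has_real_derivative \<Psi>\<^sub>0' x) (at x)"
    using \<Psi>0(1) by (rule test_fun_deriv) blast
  define B where "B = - (LINT x|lborel. \<Psi>\<^sub>0' x * v x) - (LINT x|lborel. \<Psi>\<^sub>0 x * (r x * Q x))"
  define g where "g x = r x * (Q x + B)" for x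
  have cg: "isCont g x" if "0 < x" for x
    unfolding g_def by (intro continuous_mult continuous_add continuous_const cr cQ that)
  have lg: "loc_int g" by (rule loc_int_cont[OF cg])
  define G where "G = primitive g"
  have dG: "(G has_real_derivative g x) (at x)" if "0 < x" for x unfolding G_def by (rule DERIV_primitive[OF cg that])
  have lG: "loc_int G" by (rule loc_int_cont[OF DERIV_isCont[OF dG]])
  have step2: "(LINT x|lborel. \<Psi>' x * v x) = (LINT x|lborel. \<Psi>' x * G x)"
    if \<Psi>: "test_fun \<Psi>" "test_fun \<Psi>'" "\<And>x. (\<Psi> has_real_derivative \<Psi>' x) (at x)" for \<Psi> \<Psi>'
  proof -
    define c where "c = (LINT x|lborel. r x * \<Psi> x)"
    have ir: "integrable lborel (\<lambda>x. r x * \<Psi> x)" "integrable lborel (\<lambda>x. r x * \<Psi>\<^sub>0 x)"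
      by (rule test_fun_integrable[OF test_fun_mult[OF _ sr]], fact)+
    have iv: "integrable lborel (\<lambda>x. \<Psi>' x * v x)" "integrable lborel (\<lambda>x. \<Psi>\<^sub>0' x * v x)"
      by (rule loc_int_test_fun_mult[OF lv], fact)+
    have iQ: "integrable lborel (\<lambda>x. \<Psi> x * (r x * Q x))" "integrable lborel (\<lambda>x. \<Psi>\<^sub>0 x * (r x * Q x))"
      by (rule loc_int_test_fun_mult[OF lrQ], fact)+
    have "(LINT x|lborel. r x * (\<Psi> x - c * \<Psi>\<^sub>0 x)) = (LINT x|lborel. r x * \<Psi> x - c * (r x * \<Psi>\<^sub>0 x))"
      by (simp add: algebra_simps)
    also have "\<dots> = 0" using ir \<Psi>0(2) by (simp add: c_def)
    finally have z: "(LINT x|lborel. r x * (\<Psi> x - c * \<Psi>\<^sub>0 x)) = 0" .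
    have "(LINT x|lborel. (\<Psi>' x - c * \<Psi>\<^sub>0' x) * v x) = - (LINT x|lborel. (\<Psi> x - c * \<Psi>\<^sub>0 x) * (r x * Q x))"
      by (rule step1) (use z \<Psi> \<Psi>0 \<Psi>0' in \<open>auto intro!: test_fun_diff_cmult DERIV_diff DERIV_cmult\<close>)
    moreover have "(LINT x|lborel. (\<Psi>' x - c * \<Psi>\<^sub>0' x) * v x)
        = (LINT x|lborel. \<Psi>' x * v x) - c * (LINT x|lborel. \<Psi>\<^sub>0' x * v x)"
      using iv by (simp add: left_diff_distrib mult.assoc)
    moreover have "(LINT x|lborel. (\<Psi> x - c * \<Psi>\<^sub>0 x) * (r x * Q x))
        = (LINT x|lborel. \<Psi> x * (r x * Q x)) - c * (LINT x|lborel. \<Psi>\<^sub>0 x * (r x * Q x))"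
      using iQ by (simp add: left_diff_distrib mult.assoc)
    ultimately have "(LINT x|lborel. \<Psi>' x * v x) = - ((LINT x|lborel. \<Psi> x * (r x * Q x)) + B * c)"
      by (simp add: B_def algebra_simps)
    also have "(LINT x|lborel. \<Psi> x * (r x * Q x)) + B * c = (LINT x|lborel. \<Psi> x * g x)"
    proof -
      have "(LINT x|lborel. \<Psi> x * g x) = (LINT x|lborel. \<Psi> x * (r x * Q x) + B * (r x * \<Psi> x))"
        by (simp add: g_def algebra_simps)
      also have "\<dots> = (LINT x|lborel. \<Psi> x * (r x * Q x)) + B * c"
        using ir iQ by (simp add: c_def)
      finally show ?thesis by simp
    qed
    also have "- (LINT x|lborel. \<Psi> x * g x) = (LINT x|lborel. \<Psi>' x * G x)"
      unfolding G_def using integral_by_parts_loc_int[OF lg \<Psi>] by simp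
    finally show ?thesis .
  qed
  \<comment> \<open>Second use of the same device: test functions of mean zero are derivatives of
    test functions, so \<open>v - G\<close> can only be a constant, namely \<open>c\<close>.\<close>
  obtain \<psi>\<^sub>0 where \<psi>0: "test_fun \<psi>\<^sub>0" "(LINT x|lborel. 1 * \<psi>\<^sub>0 x) = 1"
    by (rule test_fun_normalized[of "\<lambda>_. 1"]) auto
  have lvG: "loc_int (\<lambda>x. v x - G x)" by (rule loc_int_diff[OF lv lG])
  define c where "c = (LINT x|lborel. \<psi>\<^sub>0 x * (v x - G x))"
  define y where "y x = G x + c" for x
  have cy: "isCont y x" if "0 < x" for x
    unfolding y_def using DERIV_isCont[OF dG[OF that]] by simp
  have ae: "AE x in lborel. 0 < x \<longrightarrow> v x - y x = 0"
  proof (rule fundamental_lemma[OF loc_int_diff[OF lv loc_int_cont[OF cy]]])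
    fix \<psi> assume \<psi>: "test_fun \<psi>"
    define d where "d = (LINT x|lborel. \<psi> x)"
    have i: "integrable lborel \<psi>" "integrable lborel \<psi>\<^sub>0" by (rule test_fun_integrable, fact)+
    have t: "test_fun (\<lambda>x. \<psi> x - d * \<psi>\<^sub>0 x)" by (rule test_fun_diff_cmult[OF \<psi> \<psi>0(1)])
    have "(LINT x|lborel. \<psi> x - d * \<psi>\<^sub>0 x) = 0" using i \<psi>0(2) by (simp add: d_def)
    with t obtain \<Psi> where \<Psi>: "test_fun \<Psi>" "\<And>x. (\<Psi> has_real_derivative \<psi> x - d * \<psi>\<^sub>0 x) (at x)"
      by (rule test_fun_primitive) blast
    have i2: "integrable lborel (\<lambda>x. \<psi> x * (v x - G x))" "integrable lborel (\<lambda>x. \<psi>\<^sub>0 x * (v x - G x))"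
      by (rule loc_int_test_fun_mult[OF lvG], fact)+
    have i3: "integrable lborel (\<lambda>x. (\<psi> x - d * \<psi>\<^sub>0 x) * v x)" "integrable lborel (\<lambda>x. (\<psi> x - d * \<psi>\<^sub>0 x) * G x)"
      by (rule loc_int_test_fun_mult[OF lv t] loc_int_test_fun_mult[OF lG t])+
    have "0 = (LINT x|lborel. (\<psi> x - d * \<psi>\<^sub>0 x) * v x) - (LINT x|lborel. (\<psi> x - d * \<psi>\<^sub>0 x) * G x)"
      using step2[OF \<Psi>(1) t \<Psi>(2)] by simp
    also have "\<dots> = (LINT x|lborel. (\<psi> x - d * \<psi>\<^sub>0 x) * v x - (\<psi> x - d * \<psi>\<^sub>0 x) * G x)" using i3 by simp
    also have "\<dots> = (LINT x|lborel. \<psi> x * (v x - G x) - d * (\<psi>\<^sub>0 x * (v x - G x)))" by (simp add: algebra_simps)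
    also have "\<dots> = (LINT x|lborel. \<psi> x * (v x - G x)) - d * c" using i2 by (simp add: c_def)
    also have "\<dots> = (LINT x|lborel. \<psi> x * (v x - G x) - c * \<psi> x)" using i2 i by (simp add: d_def)
    also have "\<dots> = (LINT x|lborel. \<psi> x * (v x - y x))" by (simp add: y_def algebra_simps)
    finally show "(LINT x|lborel. \<psi> x * (v x - y x)) = 0" by simp
  qed
  have cqy: "isCont (\<lambda>x. q x * y x) x" if "0 < x" for x
    by (intro continuous_mult isCont_q cy that)
  \<comment> \<open>Replacing \<open>v\<close> by its continuous representative \<open>y\<close>
    under the integral leaves \<open>Q\<close> unchanged and makes it differentiable.\<close>
  have Qy: "Q x = primitive (\<lambda>x. q x * y x) x" if "0 < x" for x
    unfolding Q_def
  proof (rule primitive_cong_AE[OF lqv loc_int_cont[OF cqy] _ that])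
    show "AE t in lborel. 0 < t \<longrightarrow> q t * v t = q t * y t" using ae by eventually_elim auto
  qed
  have y0: "y x = 0" if "0 < x" for x
  proof (rule L2_solution_zero[where y = y and x = x and P = "\<lambda>x. Q x + B"])
    show "(y has_real_derivative x powr \<alpha> * (Q x + B)) (at x)" if "0 < x" for x
      unfolding y_def using DERIV_add[OF dG[OF that] DERIV_const[of c]] that by (simp add: g_def r_def)
    show "((\<lambda>x. Q x + B) has_real_derivative q x * y x) (at x)" if "0 < x" for x
    proof (rule has_field_derivative_transform_within_open[of "\<lambda>x. primitive (\<lambda>x. q x * y x) x + B" _ _ "{0<..}"])
      show "((\<lambda>x. primitive (\<lambda>x. q x * y x) x + B) has_real_derivative q x * y x) (at x)"
        using DERIV_add[OF DERIV_primitive[OF cqy that] DERIV_const[of B]] by simp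
    qed (use that Qy in auto)
    have m: "(\<lambda>x. indicator {0<..} x * y x) \<in> borel_measurable borel"
    proof -
      have "continuous_on {0<..} y" using cy by (auto intro: continuous_at_imp_continuous_on)
      then have "(\<lambda>x. indicator {0<..} x *\<^sub>R y x) \<in> borel_measurable borel"
        by (intro borel_measurable_continuous_on_indicator) auto
      then show ?thesis by simp
    qed
    have e: "(\<lambda>x. indicator {0<..} x * (x powr (- \<alpha>) * (y x)\<^sup>2))
        = (\<lambda>x. x powr (- \<alpha>) * (indicator {0<..} x * y x)\<^sup>2)" 
      by (auto simp: fun_eq_iff indicator_def)
    show "integrable lborel (\<lambda>x. indicator {0<..} x * (x powr (- \<alpha>) * (y x)\<^sup>2))"
    proof (rule integrable_cong_AE_imp[OF int])
      show "(\<lambda>x. indicator {0<..} x * (x powr (- \<alpha>) * (y x)\<^sup>2)) \<in> borel_measurable lborel"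
        unfolding e using m by simp
      show "AE x in lborel. indicator {0<..} x * (\<bar>x\<bar> powr (- \<alpha>) * (v x)\<^sup>2) =
          indicator {0<..} x * (x powr (- \<alpha>) * (y x)\<^sup>2)"
        using ae by eventually_elim (auto simp: indicator_def)
    qed
  qed (rule that)
  show ?thesis using ae by eventually_elim (use y0 in auto)
qed

end

section \<open>The Fourier components\<close>

lemma L2_omega_line_iff:
  "L2 (omega_line \<alpha>) f \<longleftrightarrow> f \<in> borel_measurable borel \<and> integrable lborel (\<lambda>x. \<bar>x\<bar> powr (- \<alpha>) * (f x)\<^sup>2)"
  unfolding L2_def omega_line_def
  by (auto simp: integrable_real_density)

lemma L2_inner_omega_line:
  assumes "f \<in> borel_measurable borel" "g \<in> borel_measurable borel"
  shows "L2_inner (omega_line \<alpha>) f g = (LINT x|lborel. \<bar>x\<bar> powr (- \<alpha>) * (f x * g x))"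
  unfolding L2_inner_def omega_line_def by (subst integral_real_density) (use assms in auto)

text \<open>The coefficients are singular only at 0. Functions that vanish near 0 therefore need no
  attention there, which lets all integrations by parts on the core run over the full line.\<close>

lemma isCont_annular:
  fixes g :: "real \<Rightarrow> real"
  assumes "0 < a" "\<And>x. x \<noteq> 0 \<Longrightarrow> isCont g x" "\<And>x. \<bar>x\<bar> < a \<Longrightarrow> g x = 0"
  shows "isCont g x"
proof (cases "x = 0")
  case True
  have "isCont (\<lambda>x. 0 :: real) x" by simp
  moreover have "\<forall>\<^sub>F t in nhds x. g t = 0"
  proof (rule eventually_nhds_in_open[of "{-a<..<a}" x, THEN eventually_mono])
    show "g t = 0" if "t \<in> {-a<..<a}" for t using assms(3)[of t] that by (auto simp: abs_less_iff)
  qed (use True assms(1) in auto)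
  ultimately show ?thesis by (subst isCont_cong[of _ "\<lambda>_. 0"]) auto
qed (rule assms(2))

lemma integrable_annular:
  fixes g :: "real \<Rightarrow> real"
  assumes "0 < a" "\<And>x. x \<noteq> 0 \<Longrightarrow> isCont g x" "\<And>x. \<bar>x\<bar> < a \<or> b < \<bar>x\<bar> \<Longrightarrow> g x = 0"
  shows "integrable lborel g"
proof (rule integrable_continuous_compact_support[of _ "- b" b])
  show "isCont g x" for x by (rule isCont_annular[OF assms(1,2)]) (use assms(3) in auto)
  show "g x = 0" if "x < - b \<or> b < x" for x by (rule assms(3)) (use that in linarith)
qed

lemma isCont_const_divide: "x \<noteq> 0 \<Longrightarrow> isCont (\<lambda>x::real. c / x) x"
  by (intro isCont_divide) auto

lemma isCont_abs_powr': "x \<noteq> 0 \<Longrightarrow> isCont (\<lambda>x::real. \<bar>x\<bar> powr a) x"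
  by (rule smooth1_on_isCont[OF smooth1_on_abs_powr]) simp

lemma DERIV_annular:
  fixes F f :: "real \<Rightarrow> real"
  assumes "0 < a" "\<And>x. x \<noteq> 0 \<Longrightarrow> (F has_real_derivative f x) (at x)"
    "\<And>x. \<bar>x\<bar> < a \<Longrightarrow> F x = 0" "\<And>x. \<bar>x\<bar> < a \<Longrightarrow> f x = 0"
  shows "(F has_real_derivative f x) (at x)"
proof (cases "x = 0")
  case True
  have "(F has_real_derivative 0) (at x)"
    by (rule has_field_derivative_transform_within_open[OF DERIV_const[of 0], of "{-a<..<a}"])
      (use True assms in \<open>auto simp: abs_less_iff\<close>)
  then show ?thesis using assms(1,4) True by simp
qed (rule assms(2))

lemma integral_DERIV_annular:
  fixes F f :: "real \<Rightarrow> real"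
  assumes "0 < a" "\<And>x. x \<noteq> 0 \<Longrightarrow> (F has_real_derivative f x) (at x)" "\<And>x. x \<noteq> 0 \<Longrightarrow> isCont f x"
    "\<And>x. \<bar>x\<bar> < a \<or> b < \<bar>x\<bar> \<Longrightarrow> F x = 0" "\<And>x. \<bar>x\<bar> < a \<Longrightarrow> f x = 0"
  shows "(LINT x|lborel. f x) = 0"
proof (rule integral_DERIV_compact_support(2)[of F f "- b" b])
  show "(F has_real_derivative f x) (at x)" for x by (rule DERIV_annular[OF assms(1,2)]) (use assms(4,5) in auto)
  show "isCont f x" for x by (rule isCont_annular[OF assms(1,3,5)])
  show "F x = 0" if "x < - b \<or> b < x" for x by (rule assms(4)) (use that in linarith)
qed

text \<open>Integration by parts for \<open>U'' - \<alpha> / x * U' = \<bar>x\<bar> powr \<alpha> * (\<bar>x\<bar> powr (- \<alpha>) * U')'\<close>.\<close>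
lemma radial_energy:
  fixes U U' U'' W W' :: "real \<Rightarrow> real"
  assumes a: "0 < a" and U: "\<And>x. (U has_real_derivative U' x) (at x)" "\<And>x. (U' has_real_derivative U'' x) (at x)"
    "\<And>x. isCont U'' x" and W: "\<And>x. (W has_real_derivative W' x) (at x)" "\<And>x. isCont W' x"
    and supp: "\<And>x. \<bar>x\<bar> < a \<or> b < \<bar>x\<bar> \<Longrightarrow> U' x = 0" "\<And>x. \<bar>x\<bar> < a \<or> b < \<bar>x\<bar> \<Longrightarrow> U'' x = 0"
  shows "(LINT x|lborel. \<bar>x\<bar> powr (- \<alpha>) * ((U'' x - \<alpha> / x * U' x) * W x))
    = - (LINT x|lborel. \<bar>x\<bar> powr (- \<alpha>) * (U' x * W' x))"
proof -
  let ?f = "\<lambda>x. \<bar>x\<bar> powr (- \<alpha>) * ((U'' x - \<alpha> / x * U' x) * W x)"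
  let ?g = "\<lambda>x. \<bar>x\<bar> powr (- \<alpha>) * (U' x * W' x)"
  have c: "isCont U' x" "isCont W x" for x using U(2) W(1) DERIV_isCont by blast+
  have cf: "isCont ?f x" if "x \<noteq> 0" for x
    by (intro continuous_mult continuous_diff isCont_const_divide continuous_const c U(3) isCont_abs_powr' that)
  have cg: "isCont ?g x" if "x \<noteq> 0" for x
    by (intro continuous_mult c W(2) isCont_abs_powr' that)
  have i: "integrable lborel ?f" "integrable lborel ?g"
    by (rule integrable_annular[OF a cf, of b] integrable_annular[OF a cg, of b]; use supp in simp)+
  have "(LINT x|lborel. ?f x + ?g x) = 0"
  proof (rule integral_DERIV_annular[OF a, of "\<lambda>x. (\<bar>x\<bar> powr (- \<alpha>) * U' x) * W x" _ b])
    fix x :: real assume x: "x \<noteq> 0"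
    have "((\<lambda>x. (\<bar>x\<bar> powr (- \<alpha>) * U' x) * W x) has_real_derivative
      (- \<alpha> / x * \<bar>x\<bar> powr (- \<alpha>) * U' x + U'' x * \<bar>x\<bar> powr (- \<alpha>)) * W x + W' x * (\<bar>x\<bar> powr (- \<alpha>) * U' x)) (at x)"
      by (intro DERIV_mult DERIV_abs_powr x U W)
    then show "((\<lambda>x. (\<bar>x\<bar> powr (- \<alpha>) * U' x) * W x) has_real_derivative ?f x + ?g x) (at x)"
      by (rule DERIV_cong) (simp add: algebra_simps)
    show "isCont (\<lambda>x. ?f x + ?g x) x" by (intro continuous_add cf cg x)
  qed (use supp in auto)
  then show ?thesis using i by simp
qed

lemma Cc_line_lap_k:
  assumes "D 0 = u" "\<And>n x. (D n has_real_derivative D (Suc n) x) (at x)"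
  shows "deriv u = D 1" "lap_k \<alpha> k u = (\<lambda>x. D 2 x - \<alpha> / x * D 1 x - (of_int k)\<^sup>2 * \<bar>x\<bar> powr (2 * \<alpha>) * D 0 x)"
proof -
  show d1: "deriv u = D 1" using assms(2)[of 0] assms(1) by (auto intro!: ext DERIV_imp_deriv)
  have "deriv (D 1) = D 2" using assms(2)[of 1] by (auto intro!: ext DERIV_imp_deriv simp: numeral_2_eq_2)
  then show "lap_k \<alpha> k u = (\<lambda>x. D 2 x - \<alpha> / x * D 1 x - (of_int k)\<^sup>2 * \<bar>x\<bar> powr (2 * \<alpha>) * D 0 x)"
    unfolding lap_k_def d1 using assms(1) by simp
qed

lemma measurable_annular:
  fixes g :: "real \<Rightarrow> real"
  assumes "0 < a" "\<And>x. x \<noteq> 0 \<Longrightarrow> isCont g x" "\<And>x. \<bar>x\<bar> < a \<Longrightarrow> g x = 0"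
  shows "g \<in> borel_measurable borel"
  by (intro borel_measurable_continuous_onI continuous_at_imp_continuous_on ballI isCont_annular[OF assms])

lemma L2_omega_line_annular:
  assumes "0 < a" "\<And>x. x \<noteq> 0 \<Longrightarrow> isCont g x" "\<And>x. \<bar>x\<bar> < a \<or> b < \<bar>x\<bar> \<Longrightarrow> g x = 0"
  shows "L2 (omega_line \<alpha>) g"
  unfolding L2_omega_line_iff
proof
  show "g \<in> borel_measurable borel" by (rule measurable_annular[OF assms(1,2)]) (use assms(3) in auto)
  show "integrable lborel (\<lambda>x. \<bar>x\<bar> powr (- \<alpha>) * (g x)\<^sup>2)"
    by (rule integrable_annular[OF assms(1), of _ b])
      (use assms(3) in \<open>auto intro!: continuous_mult continuous_power assms(2) isCont_abs_powr'\<close>)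
qed

lemma Cc_line_L2:
  assumes "u \<in> Cc_line" shows "L2 (omega_line \<alpha>) u" "L2 (omega_line \<alpha>) (lap_k \<alpha> k u)"
proof -
  obtain D a b where D: "D 0 = u" "\<And>n x. (D n has_real_derivative D (Suc n) x) (at x)" "0 < a" "a < b"
    "\<And>n x. \<bar>x\<bar> < a \<or> b < \<bar>x\<bar> \<Longrightarrow> D n x = 0" using assms by (rule Cc_lineE) blast
  have c: "isCont (D n) x" for n x using D(2) DERIV_isCont by blast
  have "L2 (omega_line \<alpha>) (D 0)" by (rule L2_omega_line_annular[OF D(3) c]) (rule D(5))
  then show "L2 (omega_line \<alpha>) u" using D(1) by simp
  show "L2 (omega_line \<alpha>) (lap_k \<alpha> k u)" unfolding Cc_line_lap_k(2)[OF D(1,2)]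
  proof (rule L2_omega_line_annular[OF D(3), of _ b])
    show "isCont (\<lambda>x. D 2 x - \<alpha> / x * D 1 x - (of_int k)\<^sup>2 * \<bar>x\<bar> powr (2 * \<alpha>) * D 0 x) x" if "x \<noteq> 0" for x
      by (intro continuous_mult continuous_diff isCont_const_divide continuous_const c isCont_abs_powr' that)
  qed (use D(5) in auto)
qed

text \<open>The right-hand side is minus the Dirichlet form with its potential term; its visible
  symmetry and sign supply both \<open>sym\<close> and \<open>neg\<close> of the self-adjointness
  criterion.\<close>

lemma line_energy:
  assumes "u \<in> Cc_line" "w \<in> Cc_line"
  shows "L2_inner (omega_line \<alpha>) (lap_k \<alpha> k u) w
    = - (LINT x|lborel. \<bar>x\<bar> powr (- \<alpha>) * (deriv u x * deriv w x))
      - (LINT x|lborel. \<bar>x\<bar> powr (- \<alpha>) * ((of_int k)\<^sup>2 * \<bar>x\<bar> powr (2 * \<alpha>) * (u x * w x)))"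
proof -
  obtain D a b where D: "D 0 = u" "\<And>n x. (D n has_real_derivative D (Suc n) x) (at x)" "0 < a" "a < b"
    "\<And>n x. \<bar>x\<bar> < a \<or> b < \<bar>x\<bar> \<Longrightarrow> D n x = 0" using assms(1) by (rule Cc_lineE) blast
  obtain E c d where E: "E 0 = w" "\<And>n x. (E n has_real_derivative E (Suc n) x) (at x)" "0 < c" "c < d"
    "\<And>n x. \<bar>x\<bar> < c \<or> d < \<bar>x\<bar> \<Longrightarrow> E n x = 0" using assms(2) by (rule Cc_lineE) blast
  have cont: "isCont (D n) x" "isCont (E n) x" for n x using D(2) E(2) DERIV_isCont by blast+
  let ?f = "\<lambda>x. \<bar>x\<bar> powr (- \<alpha>) * ((D 2 x - \<alpha> / x * D 1 x) * E 0 x)"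
  let ?g = "\<lambda>x. \<bar>x\<bar> powr (- \<alpha>) * ((of_int k)\<^sup>2 * \<bar>x\<bar> powr (2 * \<alpha>) * (D 0 x * E 0 x))"
  have i: "integrable lborel ?f" "integrable lborel ?g"
  proof -
    have f: "isCont ?f x" if "x \<noteq> 0" for x
      by (intro continuous_mult continuous_diff isCont_const_divide continuous_const cont isCont_abs_powr' that)
    show "integrable lborel ?f" by (rule integrable_annular[OF D(3) f, of b]) (use D(5) in auto)
    have g: "isCont ?g x" if "x \<noteq> 0" for x
      by (intro continuous_mult continuous_const cont isCont_abs_powr' that)
    show "integrable lborel ?g" by (rule integrable_annular[OF D(3) g, of b]) (use D(5) in auto)
  qed
  have "L2_inner (omega_line \<alpha>) (lap_k \<alpha> k u) w = (LINT x|lborel. \<bar>x\<bar> powr (- \<alpha>) * (lap_k \<alpha> k u x * w x))"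
    using Cc_line_L2[OF assms(1)] Cc_line_L2[OF assms(2)] by (intro L2_inner_omega_line) (auto simp: L2_omega_line_iff)
  also have "\<dots> = (LINT x|lborel. ?f x - ?g x)"
    unfolding Cc_line_lap_k(2)[OF D(1,2)] by (simp add: E(1)[symmetric] algebra_simps)
  also have "\<dots> = (LINT x|lborel. ?f x) - (LINT x|lborel. ?g x)" using i by simp
  also have "(LINT x|lborel. ?f x) = - (LINT x|lborel. \<bar>x\<bar> powr (- \<alpha>) * (D 1 x * E 1 x))"
    by (rule radial_energy[OF D(3), of "D 0" "D 1" "D 2" "E 0" "E 1" b])
      (use D(2)[of 0] D(2)[of 1] E(2)[of 0] cont D(5) in \<open>simp_all add: numeral_2_eq_2\<close>)
  finally show ?thesis
    using Cc_line_lap_k(1)[OF D(1,2)] Cc_line_lap_k(1)[OF E(1,2)] D(1) E(1) by simp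
qed

lemma Cc_line_add_cmult:
  assumes "u \<in> Cc_line" "v \<in> Cc_line" shows "(\<lambda>x. u x + c * v x) \<in> Cc_line"
proof -
  obtain a b where 1: "smooth1_on (- {0}) u" "0 < a" "\<forall>x. \<bar>x\<bar> < a \<or> b < \<bar>x\<bar> \<longrightarrow> u x = 0"
    using assms(1) unfolding Cc_line_def by blast
  obtain a' b' where 2: "smooth1_on (- {0}) v" "0 < a'" "\<forall>x. \<bar>x\<bar> < a' \<or> b' < \<bar>x\<bar> \<longrightarrow> v x = 0"
    using assms(2) unfolding Cc_line_def by blast
  have "smooth1_on (- {0}) (\<lambda>x. u x + c * v x)"
    by (intro smooth1_on_add smooth1_on_mult smooth1_on_const 1 2)
  moreover have "0 < min a a' \<and> (\<forall>x. \<bar>x\<bar> < min a a' \<or> max b b' < \<bar>x\<bar> \<longrightarrow> u x + c * v x = 0)" using 1 2 by auto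
  ultimately show ?thesis unfolding Cc_line_def by blast
qed

lemma lap_k_add_cmult:
  assumes "u \<in> Cc_line" "v \<in> Cc_line"
  shows "lap_k \<alpha> k (\<lambda>x. u x + c * v x) = (\<lambda>x. lap_k \<alpha> k u x + c * lap_k \<alpha> k v x)"
proof -
  obtain D where D: "D 0 = u" "\<And>n x. (D n has_real_derivative D (Suc n) x) (at x)"
    using assms(1) by (rule Cc_lineE) blast
  obtain E where E: "E 0 = v" "\<And>n x. (E n has_real_derivative E (Suc n) x) (at x)"
    using assms(2) by (rule Cc_lineE) blast
  have "((\<lambda>x. D n x + c * E n x) has_real_derivative D (Suc n) x + c * E (Suc n) x) (at x)" for n x
    by (intro DERIV_add DERIV_cmult D E)
  then have "lap_k \<alpha> k (\<lambda>x. u x + c * v x) = (\<lambda>x. (D 2 x + c * E 2 x) - \<alpha> / x * (D 1 x + c * E 1 x)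
      - (of_int k)\<^sup>2 * \<bar>x\<bar> powr (2 * \<alpha>) * (D 0 x + c * E 0 x))"
    by (intro Cc_line_lap_k(2)[of "\<lambda>n x. D n x + c * E n x"]) (auto simp: D E)
  then show ?thesis unfolding Cc_line_lap_k(2)[OF D] Cc_line_lap_k(2)[OF E]
    by (simp add: algebra_simps)
qed

text \<open>This says exactly that \<open>x powr ((\<alpha> - 1) / 2)\<close> is a subsolution of \<open>lap_k \<alpha> k u = u\<close>.\<close>
definition limit_point :: "real \<Rightarrow> int \<Rightarrow> bool" where
  "limit_point \<alpha> k \<longleftrightarrow> (\<forall>x>0. (1 - (1 + \<alpha>)\<^sup>2 / 4) / x\<^sup>2 \<le> 1 + (of_int k)\<^sup>2 * x powr (2 * \<alpha>))"

text \<open>The coefficient on the left equals \<open>- (\<alpha> + 3) * (\<alpha> - 1) / 4\<close>,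
  which is nonpositive here, while the right-hand side is positive.\<close>

lemma limit_point_outer:
  assumes "\<alpha> \<le> -3 \<or> 1 \<le> \<alpha>" shows "limit_point \<alpha> k"
proof -
  have "0 \<le> (\<alpha> + 3) * (\<alpha> - 1)" using assms by (auto intro: mult_nonneg_nonneg mult_nonpos_nonpos)
  then have "1 - (1 + \<alpha>)\<^sup>2 / 4 \<le> 0" by (simp add: power2_eq_square algebra_simps)
  then have "(1 - (1 + \<alpha>)\<^sup>2 / 4) / x\<^sup>2 \<le> 0" for x by (intro divide_nonpos_nonneg) auto
  moreover have "0 \<le> 1 + (of_int k)\<^sup>2 * x powr (2 * \<alpha>)" for x by (intro add_nonneg_nonneg) auto
  ultimately show ?thesis unfolding limit_point_def using order_trans by blast
qed

text \<open>The coefficient is at most 1. For \<open>x \<ge> 1\<close> the constant 1 dominates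
  \<open>1 / x\<^sup>2\<close>; for \<open>x < 1\<close> the potential does, because
  \<open>k\<^sup>2 \<ge> 1\<close> and \<open>2 * \<alpha> \<le> -2\<close>.\<close>

lemma limit_point_middle:
  assumes "\<alpha> \<le> -1" "k \<noteq> 0" shows "limit_point \<alpha> k"
  unfolding limit_point_def
proof (intro allI impI)
  fix x :: real assume x: "0 < x"
  have k: "1 \<le> (of_int k :: real)\<^sup>2" using assms(2)
    by (metis of_int_1_le_iff of_int_power zero_less_power2 int_one_le_iff_zero_less)
  have "(1 - (1 + \<alpha>)\<^sup>2 / 4) / x\<^sup>2 \<le> 1 / x\<^sup>2" by (intro divide_right_mono) auto
  also have "1 / x\<^sup>2 \<le> 1 + (of_int k)\<^sup>2 * x powr (2 * \<alpha>)"
  proof (cases "1 \<le> x")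
    case True
    then have "1 / x\<^sup>2 \<le> 1" by (simp add: one_le_power)
    also have "1 \<le> 1 + (of_int k)\<^sup>2 * x powr (2 * \<alpha>)" by simp
    finally show ?thesis .
  next
    case False
    have "1 / x\<^sup>2 = x powr (- 2)" using x by (simp add: powr_minus_divide)
    also have "\<dots> \<le> x powr (2 * \<alpha>)" using False x assms(1) by (intro powr_mono') auto
    also have "\<dots> \<le> (of_int k)\<^sup>2 * x powr (2 * \<alpha>)" using mult_right_mono[OF k, of "x powr (2 * \<alpha>)"] by simp
    finally show ?thesis by simp
  qed
  finally show "(1 - (1 + \<alpha>)\<^sup>2 / 4) / x\<^sup>2 \<le> 1 + (of_int k)\<^sup>2 * x powr (2 * \<alpha>)" .
qed

section \<open>The kernel on both half lines\<close>

lemma Cc_line_reflect: 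
  assumes "u \<in> Cc_line" shows "(\<lambda>x. u (- x)) \<in> Cc_line"
proof -
  obtain a b where 1: "smooth1_on (- {0}) u" "0 < a" "\<forall>x. \<bar>x\<bar> < a \<or> b < \<bar>x\<bar> \<longrightarrow> u x = 0"
    using assms(1) unfolding Cc_line_def by blast
  have "smooth1_on (- {0}) (\<lambda>x. u (-1 * x + 0))" by (rule smooth1_on_affine[OF 1(1)]) auto
  then have "smooth1_on (- {0}) (\<lambda>x. u (- x))" by simp
  moreover have "0 < a \<and> (\<forall>x. \<bar>x\<bar> < a \<or> b < \<bar>x\<bar> \<longrightarrow> u (- x) = 0)" using 1 by simp
  ultimately show ?thesis unfolding Cc_line_def by blast
qed

lemma integral_reflect_lborel: "(LINT x|lborel. f (- x)) = (LINT x|lborel. f x)" for f :: "real \<Rightarrow> real"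
  using lborel_integral_real_affine[of "-1" f 0] by simp

text \<open>Test functions supported on one side see only that side. The operator and the weight are
  invariant under reflection, so the result for the right half line also applies to
  \<open>h (- x)\<close>.\<close>

lemma line_kernel:
  assumes lp: "limit_point \<alpha> k" and h: "L2 (omega_line \<alpha>) h"
    and weak: "\<And>u. u \<in> Cc_line \<Longrightarrow> L2_inner (omega_line \<alpha>) (lap_k \<alpha> k u) h = L2_inner (omega_line \<alpha>) u h"
  shows "AE x in lborel. x \<noteq> 0 \<longrightarrow> h x = 0"
proof -
  interpret radial_ode \<alpha> "(of_int k)\<^sup>2"
    by standard (use lp in \<open>auto simp: limit_point_def\<close>)
  have hm [measurable]: "h \<in> borel_measurable borel" and hi: "integrable lborel (\<lambda>x. \<bar>x\<bar> powr (- \<alpha>) * (h x)\<^sup>2)"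
    using h by (auto simp: L2_omega_line_iff)
  have weak': "(LINT x|lborel. \<bar>x\<bar> powr (- \<alpha>) * ((lap_k \<alpha> k u x - u x) * h x)) = 0" if u: "u \<in> Cc_line" for u
  proof -
    have "L2_inner (omega_line \<alpha>) (\<lambda>x. lap_k \<alpha> k u x - u x) h = 0"
      using weak[OF u] L2_inner_diff_left[OF Cc_line_L2(2)[OF u] Cc_line_L2(1)[OF u] h] by simp
    moreover have "L2_inner (omega_line \<alpha>) (\<lambda>x. lap_k \<alpha> k u x - u x) h
      = (LINT x|lborel. \<bar>x\<bar> powr (- \<alpha>) * ((lap_k \<alpha> k u x - u x) * h x))"
      by (rule L2_inner_omega_line) (use L2_diff[OF Cc_line_L2(2)[OF u] Cc_line_L2(1)[OF u]] in \<open>auto simp: L2_omega_line_iff\<close>)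
    ultimately show ?thesis by simp
  qed
  have lap: "lap_k \<alpha> k u x = u'' x - \<alpha> / x * u' x - (of_int k)\<^sup>2 * \<bar>x\<bar> powr (2 * \<alpha>) * u x"
    if "\<And>x. (u has_real_derivative u' x) (at x)" "\<And>x. (u' has_real_derivative u'' x) (at x)" for u u' u'' x
  proof -
    have "deriv u = u'" "deriv u' = u''" using that by (auto intro!: ext DERIV_imp_deriv)
    then show ?thesis by (simp add: lap_k_def)
  qed
  have half: "AE x in lborel. 0 < x \<longrightarrow> h x = 0"
  proof (rule half_line_kernel[OF hm])
    show "integrable lborel (\<lambda>x. indicator {0<..} x * (\<bar>x\<bar> powr (- \<alpha>) * (h x)\<^sup>2))"
      using integrable_mult_indicator[OF _ hi, of "{0<..}"] by simp
    fix u u' u'' assume u: "test_fun u" "\<And>x. (u has_real_derivative u' x) (at x)" "\<And>x. (u' has_real_derivative u'' x) (at x)"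
    then show "(LINT x|lborel. \<bar>x\<bar> powr (- \<alpha>) *
        ((u'' x - \<alpha> / x * u' x - (of_int k)\<^sup>2 * \<bar>x\<bar> powr (2 * \<alpha>) * u x - u x) * h x)) = 0"
      using weak'[of u] lap[OF u(2,3)] by (simp add: test_fun_def)
  qed
  have half': "AE x in lborel. 0 < x \<longrightarrow> h (- x) = 0"
  proof (rule half_line_kernel)
    show "(\<lambda>x. h (- x)) \<in> borel_measurable borel" by simp
    have "integrable lborel (\<lambda>x. \<bar>- x\<bar> powr (- \<alpha>) * (h (- x))\<^sup>2)"
      using lborel_integrable_real_affine[OF hi, of "-1" 0] by simp
    from integrable_mult_indicator[OF _ this, of "{0<..}"]
    show "integrable lborel (\<lambda>x. indicator {0<..} x * (\<bar>x\<bar> powr (- \<alpha>) * (h (- x))\<^sup>2))" by simp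
    fix u u' u'' assume u: "test_fun u" "\<And>x. (u has_real_derivative u' x) (at x)" "\<And>x. (u' has_real_derivative u'' x) (at x)"
    let ?u = "\<lambda>x. u (- x)"
    have d1: "(?u has_real_derivative - u' (- x)) (at x)" for x
      using DERIV_chain2[where g = uminus, OF u(2) DERIV_minus[OF DERIV_ident]] by simp
    have d2: "((\<lambda>x. - u' (- x)) has_real_derivative u'' (- x)) (at x)" for x
      using DERIV_minus[OF DERIV_chain2[where g = uminus, OF u(3) DERIV_minus[OF DERIV_ident]]] by simp
    have "?u \<in> Cc_line" using u(1) by (simp add: test_fun_def Cc_line_reflect)
    from weak'[OF this] have "(LINT x|lborel. \<bar>- x\<bar> powr (- \<alpha>) * ((lap_k \<alpha> k ?u (- x) - ?u (- x)) * h (- x))) = 0"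
      by (subst integral_reflect_lborel)
    then show "(LINT x|lborel. \<bar>x\<bar> powr (- \<alpha>) *
        ((u'' x - \<alpha> / x * u' x - (of_int k)\<^sup>2 * \<bar>x\<bar> powr (2 * \<alpha>) * u x - u x) * h (- x))) = 0"
      unfolding lap[OF d1 d2] by simp
  qed
  have "AE x in distr lborel borel uminus. 0 < - x \<longrightarrow> h x = 0"
    by (subst AE_distr_iff) (use half' in auto)
  then have "AE x in lborel. 0 < - x \<longrightarrow> h x = 0" unfolding lborel_distr_uminus .
  with half show ?thesis by eventually_elim auto
qed

lemma AE_omega_line: "AE x in lborel. x \<noteq> 0 \<longrightarrow> P x \<Longrightarrow> AE x in omega_line \<alpha>. P x"
  unfolding omega_line_def by (subst AE_density) auto

lemma ess_self_adjoint_line: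
  assumes "limit_point \<alpha> k"
  shows "ess_self_adjoint (omega_line \<alpha>) Cc_line (lap_k \<alpha> k)"
proof (rule ess_self_adjoint_criterion)
  have "(\<lambda>_. 0) \<in> Cc_line" unfolding Cc_line_def by (auto intro: smooth1_on_const exI[of _ 1])
  then show "Cc_line \<noteq> {}" by blast
  show "L2_inner (omega_line \<alpha>) (lap_k \<alpha> k u) v = L2_inner (omega_line \<alpha>) u (lap_k \<alpha> k v)"
    if "u \<in> Cc_line" "v \<in> Cc_line" for u v
    unfolding L2_inner_commute[of _ u] line_energy[OF that] line_energy[OF that(2,1)] by (simp add: mult.commute)
  show "L2_inner (omega_line \<alpha>) (lap_k \<alpha> k u) u \<le> 0" if "u \<in> Cc_line" for u
  proof -
    have "0 \<le> (LINT x|lborel. \<bar>x\<bar> powr (- \<alpha>) * (deriv u x * deriv u x))"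
      "0 \<le> (LINT x|lborel. \<bar>x\<bar> powr (- \<alpha>) * ((of_int k)\<^sup>2 * \<bar>x\<bar> powr (2 * \<alpha>) * (u x * u x)))"
      by (intro integral_nonneg_AE AE_I2; simp)+
    then show ?thesis unfolding line_energy[OF that that] by linarith
  qed
  show "AE x in omega_line \<alpha>. h x = 0" if "L2 (omega_line \<alpha>) h"
    "\<And>u. u \<in> Cc_line \<Longrightarrow> L2_inner (omega_line \<alpha>) (lap_k \<alpha> k u) h = L2_inner (omega_line \<alpha>) u h" for h
    by (rule AE_omega_line[OF line_kernel[OF assms that]])
qed (auto intro: Cc_line_add_cmult lap_k_add_cmult Cc_line_L2)

section \<open>Solutions with a nonzero boundary form\<close>

lemma powr_bound_integrable:
  fixes v :: "real \<Rightarrow> real"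
  assumes m: "v \<in> borel_measurable borel" and s: "-1 < s"
    and b: "\<And>x. 0 < x \<Longrightarrow> x < c \<Longrightarrow> \<bar>v x\<bar> \<le> C * x powr s" and z: "\<And>x. x \<le> 0 \<or> c \<le> x \<Longrightarrow> v x = 0"
  shows "integrable lborel v"
proof (cases "0 < c")
  case True
  have "(\<lambda>x. x powr s) absolutely_integrable_on {0..c}"
    using integrable_on_powr_from_0[OF s, of c] True by (intro nonnegative_absolutely_integrable_1) auto
  then have "integrable lebesgue (\<lambda>x. indicator {0..c} x * x powr s)"
    by (simp add: set_integrable_def)
  then have "integrable lborel (\<lambda>x. indicator {0..c} x * x powr s)"
    by (subst (asm) integrable_completion) auto
  then have "integrable lborel (\<lambda>x. C * (indicator {0..c} x * x powr s))" by simp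
  then show ?thesis
  proof (rule Bochner_Integration.integrable_bound)
    show "AE x in lborel. norm (v x) \<le> norm (C * (indicator {0..c} x * x powr s))"
    proof (rule AE_I2)
      fix x show "norm (v x) \<le> norm (C * (indicator {0..c} x * x powr s))"
      proof (cases "0 < x \<and> x < c")
        case True
        then have "\<bar>v x\<bar> \<le> \<bar>C * x powr s\<bar>" using b[of x] by linarith
        then show ?thesis using True by simp
      next
        case False
        then show ?thesis using z[of x] by auto
      qed
    qed
  qed (use m in simp)
next
  case False
  then have "v = (\<lambda>_. 0)" using z by (intro ext) (metis linorder_linear not_less order.trans)
  then show ?thesis by simp
qed

text \<open>The function \<open>g\<close> is the conormal derivative \<open>x powr (- \<alpha>) * h'\<close>, so the two differential
  equations say that \<open>h\<close> solves the homogeneous equation.\<close>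
locale cut_solution =
  fixes \<alpha> K :: real and h g :: "real \<Rightarrow> real" and \<eta> \<eta>' \<eta>'' :: "real \<Rightarrow> real"
  assumes h: "\<And>x. 0 < x \<Longrightarrow> (h has_real_derivative x powr \<alpha> * g x) (at x)"
    and g: "\<And>x. 0 < x \<Longrightarrow> (g has_real_derivative K * x powr \<alpha> * h x) (at x)"
    and \<eta>: "\<And>x. (\<eta> has_real_derivative \<eta>' x) (at x)" "\<And>x. (\<eta>' has_real_derivative \<eta>'' x) (at x)" "\<And>x. isCont \<eta>'' x"
    and \<eta>_near: "\<And>x. x < 1 \<Longrightarrow> \<eta> x = 1" and \<eta>_far: "\<And>x. 2 < x \<Longrightarrow> \<eta> x = 0" and \<eta>_bound: "\<And>x. \<bar>\<eta> x\<bar> \<le> 1"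
begin

lemma \<eta>'_zero: "x < 1 \<or> 2 < x \<Longrightarrow> \<eta>' x = 0"
proof -
  assume "x < 1 \<or> 2 < x"
  then have "(\<eta> has_real_derivative 0) (at x)"
  proof
    assume "x < 1"
    then show ?thesis
      by (intro has_field_derivative_transform_within_open[OF DERIV_const[of 1], of "{..<1}"]) (use \<eta>_near in auto)
  next
    assume "2 < x"
    then show ?thesis
      by (intro has_field_derivative_transform_within_open[OF DERIV_const[of 0], of "{2<..}"]) (use \<eta>_far in auto)
  qed
  then show ?thesis using \<eta>(1) DERIV_unique by blast
qed

lemma \<eta>''_zero: "x < 1 \<or> 2 < x \<Longrightarrow> \<eta>'' x = 0"
proof -
  assume x: "x < 1 \<or> 2 < x"
  have "open {x::real. x < 1 \<or> 2 < x}" by (intro open_Collect_disj open_Collect_less continuous_intros)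
  then have "(\<eta>' has_real_derivative 0) (at x)"
    by (rule has_field_derivative_transform_within_open[OF DERIV_const[of 0]]) (use x \<eta>'_zero in auto)
  then show ?thesis using \<eta>(2) DERIV_unique by blast
qed

lemma \<eta>_cont: "isCont \<eta> x" "isCont \<eta>' x"
  using \<eta> DERIV_isCont by blast+

lemma hg_cont: "0 < x \<Longrightarrow> isCont h x" "0 < x \<Longrightarrow> isCont g x"
  using h g DERIV_isCont by blast+

definition v :: "real \<Rightarrow> real" where "v x = (if 0 < x then \<eta> x * h x else 0)"

text \<open>The conormal derivative \<open>x powr (- \<alpha>) * v' x\<close>.\<close>
definition a :: "real \<Rightarrow> real" where "a x = \<bar>x\<bar> powr (- \<alpha>) * (\<eta>' x * h x) + \<eta> x * g x"

text \<open>What is left of the operator applied to \<open>v = \<eta> * h\<close>: the terms in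
  which no derivative falls on the cutoff cancel by the equation for \<open>h\<close>. Hence
  \<open>w\<close> is supported where \<open>\<eta>\<close> varies, away from the origin.\<close>

definition w :: "real \<Rightarrow> real" where
  "w x = (if 0 < x then \<eta>'' x * h x + \<eta>' x * (2 * (x powr \<alpha> * g x) - \<alpha> / x * h x) else 0)"

lemma powr_cancel: "0 < x \<Longrightarrow> x powr \<alpha> * x powr (- \<alpha>) = 1"
  by (simp add: powr_add[symmetric])

lemma v_deriv: "0 < x \<Longrightarrow> (v has_real_derivative x powr \<alpha> * a x) (at x)"
proof -
  assume x: "0 < x"
  have "((\<lambda>x. \<eta> x * h x) has_real_derivative \<eta>' x * h x + x powr \<alpha> * g x * \<eta> x) (at x)"
    by (intro DERIV_mult \<eta> h x)
  also have "\<eta>' x * h x + x powr \<alpha> * g x * \<eta> x = x powr \<alpha> * a x"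
  proof -
    have "x powr \<alpha> * a x = (x powr \<alpha> * x powr (- \<alpha>)) * (\<eta>' x * h x) + x powr \<alpha> * g x * \<eta> x"
      using x by (simp add: a_def algebra_simps)
    then show ?thesis using powr_cancel[OF x] by simp
  qed
  finally show ?thesis
    by (rule has_field_derivative_transform_within_open[where S = "{0<..}"]) (use x in \<open>auto simp: v_def\<close>)
qed

lemma a_deriv: "0 < x \<Longrightarrow> (a has_real_derivative \<bar>x\<bar> powr (- \<alpha>) * w x + K * \<bar>x\<bar> powr \<alpha> * v x) (at x)"
proof -
  assume x: "0 < x"
  have "(a has_real_derivative
      (- \<alpha> / x * \<bar>x\<bar> powr (- \<alpha>) * (\<eta>' x * h x) + (\<eta>'' x * h x + x powr \<alpha> * g x * \<eta>' x) * \<bar>x\<bar> powr (- \<alpha>))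
      + (\<eta>' x * g x + K * x powr \<alpha> * h x * \<eta> x)) (at x)"
    unfolding a_def using x by (intro DERIV_add DERIV_mult DERIV_abs_powr \<eta> h g) auto
  also have "(- \<alpha> / x * \<bar>x\<bar> powr (- \<alpha>) * (\<eta>' x * h x) + (\<eta>'' x * h x + x powr \<alpha> * g x * \<eta>' x) * \<bar>x\<bar> powr (- \<alpha>))
      + (\<eta>' x * g x + K * x powr \<alpha> * h x * \<eta> x) = \<bar>x\<bar> powr (- \<alpha>) * w x + K * \<bar>x\<bar> powr \<alpha> * v x"
  proof -
    have "\<eta>' x * g x = (x powr \<alpha> * x powr (- \<alpha>)) * (\<eta>' x * g x)" using powr_cancel[OF x] by simp
    then show ?thesis using x by (simp add: w_def v_def algebra_simps)
  qed
  finally show ?thesis .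
qed

lemma w_cont: "isCont w x"
proof (rule isCont_annular[of 1])
  show "w x = 0" if "\<bar>x\<bar> < 1" for x
  proof -
    have "x < 1" using that by simp
    then show ?thesis using \<eta>'_zero[of x] \<eta>''_zero[of x] by (simp add: w_def)
  qed
  show "isCont w x" if "x \<noteq> 0" for x
  proof (cases "0 < x")
    case True
    have c: "isCont (\<lambda>x. \<eta>'' x * h x + \<eta>' x * (2 * (\<bar>x\<bar> powr \<alpha> * g x) - \<alpha> / x * h x)) x"
      using True by (intro continuous_mult continuous_add continuous_diff continuous_const isCont_const_divide
        \<eta> \<eta>_cont hg_cont isCont_abs_powr) auto
    have "\<forall>\<^sub>F t in nhds x. w t = \<eta>'' t * h t + \<eta>' t * (2 * (\<bar>t\<bar> powr \<alpha> * g t) - \<alpha> / t * h t)"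
      using eventually_nhds_in_open[of "{0<..}" x] True
      by (auto elim!: eventually_mono simp: w_def)
    from isCont_cong[OF this] c show ?thesis by blast
  next
    case False
    then have "\<forall>\<^sub>F t in nhds x. w t = 0"
      using eventually_nhds_in_open[of "{..<0}" x] that by (auto elim!: eventually_mono simp: w_def)
    from isCont_cong[OF this] show ?thesis by simp
  qed
qed simp

lemma w_zero: "x < 1 \<or> 2 < x \<Longrightarrow> w x = 0"
  using \<eta>'_zero[of x] \<eta>''_zero[of x] by (simp add: w_def)

lemma v_cont: "x \<noteq> 0 \<Longrightarrow> isCont v x"
proof (cases "0 < x")
  case True
  then show ?thesis by (intro DERIV_isCont[OF v_deriv])
next
  case False
  assume "x \<noteq> 0"
  then have "\<forall>\<^sub>F t in nhds x. v t = 0"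
    using eventually_nhds_in_open[of "{..<0}" x] False by (auto elim!: eventually_mono simp: v_def)
  from isCont_cong[OF this] show ?thesis by simp
qed

lemma v_zero: "x \<le> 0 \<or> 2 < x \<Longrightarrow> v x = 0"
  using \<eta>_far[of x] by (auto simp: v_def)

lemma v_measurable [measurable]: "v \<in> borel_measurable borel"
proof -
  have "continuous_on {0<..} v" using v_cont by (intro continuous_at_imp_continuous_on) auto
  then have "(\<lambda>x. indicator {0<..} x *\<^sub>R v x) \<in> borel_measurable borel"
    by (intro borel_measurable_continuous_on_indicator) auto
  also have "(\<lambda>x. indicator {0<..} x *\<^sub>R v x) = v" by (auto simp: fun_eq_iff indicator_def v_def)
  finally show ?thesis .
qed

lemma w_measurable [measurable]: "w \<in> borel_measurable borel"
  by (intro borel_measurable_continuous_onI continuous_at_imp_continuous_on ballI w_cont)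

text \<open>The difference of the integrands is the derivative of the boundary form
  \<open>x powr (- \<alpha>) * (U' * v - U * v')\<close>. It vanishes near 0 because
  \<open>U\<close> does, whatever \<open>v\<close> does there.\<close>

lemma green:
  assumes d: "0 < d" and U: "\<And>x. (U has_real_derivative U' x) (at x)" "\<And>x. (U' has_real_derivative U'' x) (at x)"
    "\<And>x. isCont U'' x"
    and supp: "\<And>x. \<bar>x\<bar> < d \<or> b < \<bar>x\<bar> \<Longrightarrow> U x = 0" "\<And>x. \<bar>x\<bar> < d \<or> b < \<bar>x\<bar> \<Longrightarrow> U' x = 0"
      "\<And>x. \<bar>x\<bar> < d \<or> b < \<bar>x\<bar> \<Longrightarrow> U'' x = 0"
  shows "(LINT x|lborel. \<bar>x\<bar> powr (- \<alpha>) * ((U'' x - \<alpha> / x * U' x - K * \<bar>x\<bar> powr (2 * \<alpha>) * U x) * v x))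
    = (LINT x|lborel. \<bar>x\<bar> powr (- \<alpha>) * (U x * w x))"
proof -
  let ?f = "\<lambda>x. \<bar>x\<bar> powr (- \<alpha>) * ((U'' x - \<alpha> / x * U' x - K * \<bar>x\<bar> powr (2 * \<alpha>) * U x) * v x)"
  let ?g = "\<lambda>x. \<bar>x\<bar> powr (- \<alpha>) * (U x * w x)"
  have c: "isCont U x" "isCont U' x" for x using U DERIV_isCont by blast+
  have cf: "isCont ?f x" if "x \<noteq> 0" for x
    by (intro continuous_mult continuous_diff isCont_const_divide continuous_const c U(3) v_cont isCont_abs_powr' that)
  have cg: "isCont ?g x" if "x \<noteq> 0" for x
    by (intro continuous_mult c w_cont isCont_abs_powr' that)
  have i: "integrable lborel ?f" "integrable lborel ?g"
    by (rule integrable_annular[OF d cf, of b] integrable_annular[OF d cg, of b]; use supp in simp)+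
  let ?F = "\<lambda>x. if 0 < x then (\<bar>x\<bar> powr (- \<alpha>) * U' x) * v x - U x * a x else 0"
  have "(LINT x|lborel. ?f x - ?g x) = 0"
  proof (rule integral_DERIV_annular[OF d, of ?F _ b])
    fix x :: real assume x: "x \<noteq> 0"
    show "isCont (\<lambda>x. ?f x - ?g x) x" by (intro continuous_diff cf cg x)
    show "(?F has_real_derivative ?f x - ?g x) (at x)"
    proof (cases "0 < x")
      case True
      have "((\<lambda>x. (\<bar>x\<bar> powr (- \<alpha>) * U' x) * v x - U x * a x) has_real_derivative
        ((- \<alpha> / x * \<bar>x\<bar> powr (- \<alpha>) * U' x + U'' x * \<bar>x\<bar> powr (- \<alpha>)) * v x + x powr \<alpha> * a x * (\<bar>x\<bar> powr (- \<alpha>) * U' x))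
        - (U' x * a x + (\<bar>x\<bar> powr (- \<alpha>) * w x + K * \<bar>x\<bar> powr \<alpha> * v x) * U x)) (at x)"
        using True by (intro DERIV_diff DERIV_mult DERIV_abs_powr U v_deriv a_deriv) auto
      then have "((\<lambda>x. (\<bar>x\<bar> powr (- \<alpha>) * U' x) * v x - U x * a x) has_real_derivative ?f x - ?g x) (at x)"
      proof (rule DERIV_cong)
        have e1: "x powr \<alpha> * a x * (\<bar>x\<bar> powr (- \<alpha>) * U' x) = U' x * a x"
        proof -
          have "x powr \<alpha> * a x * (\<bar>x\<bar> powr (- \<alpha>) * U' x) = (x powr \<alpha> * x powr (- \<alpha>)) * (U' x * a x)"
            using True by simp
          then show ?thesis using powr_cancel[OF True] by simp
        qed
        have "\<bar>x\<bar> powr (- \<alpha>) * \<bar>x\<bar> powr (2 * \<alpha>) = \<bar>x\<bar> powr \<alpha>" by (simp add: powr_add[symmetric])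
        moreover have "\<bar>x\<bar> powr (- \<alpha>) * (K * \<bar>x\<bar> powr (2 * \<alpha>) * U x * v x)
            = (\<bar>x\<bar> powr (- \<alpha>) * \<bar>x\<bar> powr (2 * \<alpha>)) * (K * v x * U x)" by (simp only: mult_ac)
        ultimately have e2: "\<bar>x\<bar> powr (- \<alpha>) * (K * \<bar>x\<bar> powr (2 * \<alpha>) * U x * v x) = K * \<bar>x\<bar> powr \<alpha> * v x * U x"
          by (simp only: mult_ac)
        have fx: "?f x = \<bar>x\<bar> powr (- \<alpha>) * ((U'' x - \<alpha> / x * U' x) * v x) - K * \<bar>x\<bar> powr \<alpha> * v x * U x"
          unfolding e2[symmetric] by (simp add: algebra_simps)
        show "((- \<alpha> / x * \<bar>x\<bar> powr (- \<alpha>) * U' x + U'' x * \<bar>x\<bar> powr (- \<alpha>)) * v x + x powr \<alpha> * a x * (\<bar>x\<bar> powr (- \<alpha>) * U' x))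
          - (U' x * a x + (\<bar>x\<bar> powr (- \<alpha>) * w x + K * \<bar>x\<bar> powr \<alpha> * v x) * U x) = ?f x - ?g x"
          unfolding e1 fx by (simp add: algebra_simps)
      qed
      then show ?thesis
        by (rule has_field_derivative_transform_within_open[where S = "{0<..}"]) (use True in auto)
    next
      case False
      have "0 = ?f x - ?g x" using False by (simp add: v_def w_def)
      then have "((\<lambda>_. 0) has_real_derivative ?f x - ?g x) (at x)" by (rule DERIV_cong[OF DERIV_const])
      then show ?thesis
        by (rule has_field_derivative_transform_within_open[where S = "{..<0}"]) (use False x in auto)
    qed
  qed (use supp in auto)
  then show ?thesis using i by simp
qed

end

section \<open>Pairs in the adjoint with a nonzero boundary form\<close>

lemma smooth_cutoff:
  obtains \<eta> \<eta>' \<eta>'' :: "real \<Rightarrow> real" where "\<And>x. (\<eta> has_real_derivative \<eta>' x) (at x)"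
    "\<And>x. (\<eta>' has_real_derivative \<eta>'' x) (at x)" "\<And>x. isCont \<eta>'' x"
    "\<And>x. x < 1 \<Longrightarrow> \<eta> x = 1" "\<And>x. 2 < x \<Longrightarrow> \<eta> x = 0" "\<And>x. \<bar>\<eta> x\<bar> \<le> 1"
proof -
  obtain \<sigma> :: "real \<Rightarrow> real" where \<sigma>: "smooth1_on UNIV \<sigma>" "\<And>x. x \<le> 0 \<Longrightarrow> \<sigma> x = 0" "\<And>x. x \<ge> 1 \<Longrightarrow> \<sigma> x = 1"
    "\<And>x. 0 \<le> \<sigma> x" "\<And>x. \<sigma> x \<le> 1" by (rule smooth_step) blast
  define \<eta> where "\<eta> x = \<sigma> (-1 * x + 2)" for x
  have "smooth1_on UNIV \<eta>" unfolding \<eta>_def by (rule smooth1_on_affine[OF \<sigma>(1)]) simp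
  then obtain D where D: "D 0 = \<eta>" "\<And>n x. (D n has_real_derivative D (Suc n) x) (at x)"
    unfolding smooth1_on_def by blast
  show ?thesis
  proof (rule that[of "D 0" "D 1" "D 2"])
    show "(D 0 has_real_derivative D 1 x) (at x)" "(D 1 has_real_derivative D 2 x) (at x)" for x
      using D(2)[of 0 x] D(2)[of 1 x] by (simp_all add: numeral_2_eq_2)
    show "isCont (D 2) x" for x using D(2) DERIV_isCont by blast
    show "D 0 x = 1" if "x < 1" for x unfolding D(1) \<eta>_def by (rule \<sigma>(3)) (use that in simp)
    show "D 0 x = 0" if "2 < x" for x unfolding D(1) \<eta>_def by (rule \<sigma>(2)) (use that in simp)
    show "\<bar>D 0 x\<bar> \<le> 1" for x unfolding D(1) \<eta>_def using \<sigma>(4,5) by simp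
  qed
qed

text \<open>The pair \<open>(v, w)\<close> lies in the graph of the adjoint.  Testing against arbitrary \<open>U\<close> instead of
  \<open>Cc_line\<close> makes this usable slicewise on the cylinder when \<open>K = 0\<close>.\<close>
definition boundary_pair :: "real \<Rightarrow> real \<Rightarrow> (real \<Rightarrow> real) \<Rightarrow> (real \<Rightarrow> real) \<Rightarrow> bool" where
  "boundary_pair \<alpha> K v w \<longleftrightarrow> L2 (omega_line \<alpha>) v \<and> L2 (omega_line \<alpha>) w \<and>
    (\<forall>d b U U' U''. 0 < d \<longrightarrow> (\<forall>x. (U has_real_derivative U' x) (at x)) \<longrightarrow> (\<forall>x. (U' has_real_derivative U'' x) (at x)) \<longrightarrow>
      (\<forall>x. isCont U'' x) \<longrightarrow> (\<forall>x. \<bar>x\<bar> < d \<or> b < \<bar>x\<bar> \<longrightarrow> U x = 0 \<and> U' x = 0 \<and> U'' x = 0) \<longrightarrow>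
      (LINT x|lborel. \<bar>x\<bar> powr (- \<alpha>) * ((U'' x - \<alpha> / x * U' x - K * \<bar>x\<bar> powr (2 * \<alpha>) * U x) * v x))
      = (LINT x|lborel. \<bar>x\<bar> powr (- \<alpha>) * (U x * w x)))"

lemma boundary_pairD:
  assumes "boundary_pair \<alpha> K v w"
    and "0 < d" "\<And>x. (U has_real_derivative U' x) (at x)" "\<And>x. (U' has_real_derivative U'' x) (at x)"
      "\<And>x. isCont U'' x" "\<And>x. \<bar>x\<bar> < d \<or> b < \<bar>x\<bar> \<Longrightarrow> U x = 0 \<and> U' x = 0 \<and> U'' x = 0"
  shows "(LINT x|lborel. \<bar>x\<bar> powr (- \<alpha>) * ((U'' x - \<alpha> / x * U' x - K * \<bar>x\<bar> powr (2 * \<alpha>) * U x) * v x))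
      = (LINT x|lborel. \<bar>x\<bar> powr (- \<alpha>) * (U x * w x))"
proof -
  note assms(1)[unfolded boundary_pair_def, THEN conjunct2, THEN conjunct2, rule_format, of d U U' U'' b]
  then show ?thesis using assms(2-) by auto
qed

text \<open>The defect of symmetry is the integral of the derivative of the boundary form
  \<open>?W\<close> of the two cut solutions. That form is 0 beyond the cutoff and equals the
  nonzero Wronskian below it. The power bounds provide square integrability near the origin.\<close>

lemma boundary_pairs_exist:
  fixes h\<^sub>1 h\<^sub>2 g\<^sub>1 g\<^sub>2 :: "real \<Rightarrow> real"
  assumes h: "\<And>x. 0 < x \<Longrightarrow> (h\<^sub>1 has_real_derivative x powr \<alpha> * g\<^sub>1 x) (at x)"
      "\<And>x. 0 < x \<Longrightarrow> (h\<^sub>2 has_real_derivative x powr \<alpha> * g\<^sub>2 x) (at x)"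
    and g: "\<And>x. 0 < x \<Longrightarrow> (g\<^sub>1 has_real_derivative K * x powr \<alpha> * h\<^sub>1 x) (at x)"
      "\<And>x. 0 < x \<Longrightarrow> (g\<^sub>2 has_real_derivative K * x powr \<alpha> * h\<^sub>2 x) (at x)"
    and wronskian: "\<And>x. 0 < x \<Longrightarrow> g\<^sub>1 x * h\<^sub>2 x - h\<^sub>1 x * g\<^sub>2 x \<noteq> 0"
    and s: "-1 < s"
    and bound: "\<And>x. 0 < x \<Longrightarrow> x < 3 \<Longrightarrow> x powr (- \<alpha>) * (h\<^sub>1 x)\<^sup>2 \<le> C * x powr s"
      "\<And>x. 0 < x \<Longrightarrow> x < 3 \<Longrightarrow> x powr (- \<alpha>) * (h\<^sub>2 x)\<^sup>2 \<le> C * x powr s"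
  obtains v\<^sub>1 w\<^sub>1 v\<^sub>2 w\<^sub>2 where "boundary_pair \<alpha> K v\<^sub>1 w\<^sub>1" "boundary_pair \<alpha> K v\<^sub>2 w\<^sub>2"
    "L2_inner (omega_line \<alpha>) w\<^sub>1 v\<^sub>2 \<noteq> L2_inner (omega_line \<alpha>) v\<^sub>1 w\<^sub>2"
proof -
  obtain \<eta> \<eta>' \<eta>'' :: "real \<Rightarrow> real" where \<eta>: "\<And>x. (\<eta> has_real_derivative \<eta>' x) (at x)"
    "\<And>x. (\<eta>' has_real_derivative \<eta>'' x) (at x)" "\<And>x. isCont \<eta>'' x"
    "\<And>x. x < 1 \<Longrightarrow> \<eta> x = 1" "\<And>x. 2 < x \<Longrightarrow> \<eta> x = 0" "\<And>x. \<bar>\<eta> x\<bar> \<le> 1" by (rule smooth_cutoff) blast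
  interpret c1: cut_solution \<alpha> K h\<^sub>1 g\<^sub>1 \<eta> \<eta>' \<eta>'' by standard (use h g \<eta> in auto)
  interpret c2: cut_solution \<alpha> K h\<^sub>2 g\<^sub>2 \<eta> \<eta>' \<eta>'' by standard (use h g \<eta> in auto)
  have bp: "boundary_pair \<alpha> K (cut_solution.v h \<eta>) (cut_solution.w \<alpha> h g \<eta>' \<eta>'')"
    if "cut_solution \<alpha> K h g \<eta> \<eta>' \<eta>''" and b: "\<And>x. 0 < x \<Longrightarrow> x < 3 \<Longrightarrow> x powr (- \<alpha>) * (h x)\<^sup>2 \<le> C * x powr s" for h g
  proof -
    interpret c: cut_solution \<alpha> K h g \<eta> \<eta>' \<eta>'' by fact
    have "L2 (omega_line \<alpha>) c.v" unfolding L2_omega_line_iff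
    proof
      show "integrable lborel (\<lambda>x. \<bar>x\<bar> powr (- \<alpha>) * (c.v x)\<^sup>2)"
      proof (rule powr_bound_integrable[OF _ s, of _ 3 C])
        show "\<bar>\<bar>x\<bar> powr (- \<alpha>) * (c.v x)\<^sup>2\<bar> \<le> C * x powr s" if x: "0 < x" "x < 3" for x
        proof -
          have "(\<eta> x)\<^sup>2 \<le> 1" using power_mono[OF \<eta>(6)[of x], of 2] by simp
          then have "(\<eta> x)\<^sup>2 * (x powr (- \<alpha>) * (h x)\<^sup>2) \<le> 1 * (x powr (- \<alpha>) * (h x)\<^sup>2)"
            by (intro mult_right_mono) auto
          also have "\<dots> \<le> C * x powr s" using b[OF x] by simp
          finally have "x powr (- \<alpha>) * ((\<eta> x)\<^sup>2 * (h x)\<^sup>2) \<le> C * x powr s" by (simp only: mult_ac)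
          then show ?thesis using x by (simp add: c.v_def power_mult_distrib)
        qed
      qed (use c.v_zero in auto)
    qed simp
    moreover have w0: "c.w x = 0" if "\<bar>x\<bar> < 1 \<or> 2 < \<bar>x\<bar>" for x
      using c.w_zero[of x] that by (cases "0 < x") (auto simp: c.w_def)
    have "L2 (omega_line \<alpha>) c.w"
      by (rule L2_omega_line_annular[of 1 _ 2]) (use c.w_cont w0 in auto)
    ultimately show ?thesis unfolding boundary_pair_def using c.green by blast
  qed
  have L: "boundary_pair \<alpha> K c1.v c1.w" "boundary_pair \<alpha> K c2.v c2.w"
    by (rule bp[OF c1.cut_solution_axioms bound(1)] bp[OF c2.cut_solution_axioms bound(2)]; assumption)+
  then have L2s: "L2 (omega_line \<alpha>) c1.v" "L2 (omega_line \<alpha>) c1.w" "L2 (omega_line \<alpha>) c2.v" "L2 (omega_line \<alpha>) c2.w"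
    by (auto simp: boundary_pair_def)
  let ?W = "\<lambda>x. c1.a x * c2.v x - c1.v x * c2.a x"
  let ?f = "\<lambda>x. \<bar>x\<bar> powr (- \<alpha>) * (c1.w x * c2.v x - c1.v x * c2.w x)"
  have W: "(?W has_real_derivative ?f x) (at x)" if x: "0 < x" for x
  proof -
    have "(?W has_real_derivative
      ((\<bar>x\<bar> powr (- \<alpha>) * c1.w x + K * \<bar>x\<bar> powr \<alpha> * c1.v x) * c2.v x + x powr \<alpha> * c2.a x * c1.a x)
      - (x powr \<alpha> * c1.a x * c2.a x + (\<bar>x\<bar> powr (- \<alpha>) * c2.w x + K * \<bar>x\<bar> powr \<alpha> * c2.v x) * c1.v x)) (at x)"
      by (intro DERIV_diff DERIV_mult c1.a_deriv c1.v_deriv c2.a_deriv c2.v_deriv x)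
    then show ?thesis by (rule DERIV_cong) (simp add: algebra_simps)
  qed
  \<comment> \<open>The integrand lives where the cutoff varies, in the interval from 1 to 2; at 1/2
    the cutoff is 1 and at 3 it is 0.\<close>
  have "has_bochner_integral lborel (\<lambda>x. ?f x * indicator {1/2..3} x) (?W 3 - ?W (1/2))"
  proof (rule has_bochner_integral_FTC_Icc_real)
    fix x :: real assume "1/2 \<le> x" "x \<le> 3"
    then have x: "0 < x" "x \<noteq> 0" by auto
    show "(?W has_real_derivative ?f x) (at x)" by (rule W[OF x(1)])
    show "isCont ?f x"
      by (intro continuous_mult continuous_diff c1.v_cont c2.v_cont c1.w_cont c2.w_cont isCont_abs_powr' x)
  qed simp
  moreover have "(\<lambda>x. ?f x * indicator {1/2..3} x) = ?f"
  proof
    fix x show "?f x * indicator {1/2..3} x = ?f x"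
      using c1.w_zero[of x] c2.w_zero[of x] by (cases "x \<in> {1/2..3}") auto
  qed
  moreover have "?W 3 = 0" using c1.v_zero[of 3] c2.v_zero[of 3] by simp
  moreover have "?W (1/2) = g\<^sub>1 (1/2) * h\<^sub>2 (1/2) - h\<^sub>1 (1/2) * g\<^sub>2 (1/2)"
    using \<eta>(4)[of "1/2"] c1.\<eta>'_zero[of "1/2"]
    by (simp add: c1.a_def c2.a_def c1.v_def c2.v_def)
  ultimately have nz: "(LINT x|lborel. ?f x) \<noteq> 0" using wronskian[of "1/2"] by (simp add: has_bochner_integral_iff)
  have int: "integrable lborel (\<lambda>x. \<bar>x\<bar> powr (- \<alpha>) * (f x * g x))" if "L2 (omega_line \<alpha>) f" "L2 (omega_line \<alpha>) g" for f g
    using L2_integrable_mult[OF that] that unfolding omega_line_def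
    by (subst (asm) integrable_real_density) (auto simp: L2_omega_line_iff[unfolded omega_line_def])
  have "(LINT x|lborel. ?f x) = (LINT x|lborel. \<bar>x\<bar> powr (- \<alpha>) * (c1.w x * c2.v x) - \<bar>x\<bar> powr (- \<alpha>) * (c1.v x * c2.w x))"
    by (simp add: right_diff_distrib)
  also have "\<dots> = L2_inner (omega_line \<alpha>) c1.w c2.v - L2_inner (omega_line \<alpha>) c1.v c2.w"
    using int L2s by (simp add: L2_inner_omega_line)
  finally have "L2_inner (omega_line \<alpha>) c1.w c2.v \<noteq> L2_inner (omega_line \<alpha>) c1.v c2.w" using nz by simp
  then show ?thesis using that L by blast
qed

lemma boundary_pair_adjoint:
  assumes "boundary_pair \<alpha> ((of_int k)\<^sup>2) v w"
  shows "(v, w) \<in> L2_adjoint (omega_line \<alpha>) (op_graph Cc_line (lap_k \<alpha> k))"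
proof -
  have L: "L2 (omega_line \<alpha>) v" "L2 (omega_line \<alpha>) w" using assms by (auto simp: boundary_pair_def)
  have "L2_inner (omega_line \<alpha>) (lap_k \<alpha> k u) v = L2_inner (omega_line \<alpha>) u w" if u: "u \<in> Cc_line" for u
  proof -
    obtain D d b where D: "D 0 = u" "\<And>n x. (D n has_real_derivative D (Suc n) x) (at x)" "0 < d" "d < b"
      "\<And>n x. \<bar>x\<bar> < d \<or> b < \<bar>x\<bar> \<Longrightarrow> D n x = 0" using u by (rule Cc_lineE) blast
    have D1: "\<forall>x. (D 0 has_real_derivative D 1 x) (at x)" "\<forall>x. (D 1 has_real_derivative D 2 x) (at x)"
      using D(2)[of 0] D(2)[of 1] by (simp_all add: numeral_2_eq_2)
    have "(LINT x|lborel. \<bar>x\<bar> powr (- \<alpha>) * ((D 2 x - \<alpha> / x * D 1 x - (of_int k)\<^sup>2 * \<bar>x\<bar> powr (2 * \<alpha>) * D 0 x) * v x))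
      = (LINT x|lborel. \<bar>x\<bar> powr (- \<alpha>) * (D 0 x * w x))"
      by (rule boundary_pairD[OF assms D(3), of "D 0" "D 1" "D 2" b])
        (use D1 D(5) DERIV_isCont[OF D(2)] in auto)
    then show ?thesis
      using Cc_line_L2(1)[OF u, of \<alpha>] Cc_line_L2(2)[OF u, of \<alpha> k] L D(1)
      by (simp add: L2_inner_omega_line L2_omega_line_iff Cc_line_lap_k(2)[OF D(1,2)])
  qed
  then show ?thesis using L by (auto simp: L2_adjoint_def op_graph_def)
qed

section \<open>Explicit solutions near the origin\<close>

text \<open>Since \<open>\<alpha> > -1\<close> the variable \<open>y\<close> stays bounded near the
  origin, hence so do all solutions; since \<open>\<alpha> < 1\<close> the weight itself is
  integrable there.\<close>

lemma boundary_pairs_inner: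
  fixes k :: real
  assumes "-1 < \<alpha>" "\<alpha> < 1"
  obtains v\<^sub>1 w\<^sub>1 v\<^sub>2 w\<^sub>2 where "boundary_pair \<alpha> (k\<^sup>2) v\<^sub>1 w\<^sub>1" "boundary_pair \<alpha> (k\<^sup>2) v\<^sub>2 w\<^sub>2"
    "L2_inner (omega_line \<alpha>) w\<^sub>1 v\<^sub>2 \<noteq> L2_inner (omega_line \<alpha>) v\<^sub>1 w\<^sub>2"
proof -
  define y where "y x = x powr (\<alpha> + 1) / (\<alpha> + 1)" for x
  have y: "(y has_real_derivative x powr \<alpha>) (at x)" if "0 < x" for x
    unfolding y_def using that assms(1) by (auto intro!: derivative_eq_intros)
  have ybound: "\<bar>y x\<bar> \<le> Y" if "0 < x" "x < 3" "Y = 3 powr (\<alpha> + 1) / (\<alpha> + 1)" for x Y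
    using that assms(1) by (auto simp: y_def intro!: divide_right_mono powr_mono2)
  define Y where "Y = 3 powr (\<alpha> + 1) / (\<alpha> + 1)"
  have Y: "\<bar>y x\<bar> \<le> Y" if "0 < x" "x < 3" for x using ybound[OF that] by (simp add: Y_def)
  show ?thesis
  proof (cases "k = 0")
    \<comment> \<open>For \<open>k = 0\<close> the hyperbolic pair degenerates, as
      \<open>sinh\<close> gives 0; the solutions are then 1 and \<open>y\<close>.\<close>
    case True
    have bound: "x powr (- \<alpha>) * t\<^sup>2 \<le> (1 + Y)\<^sup>2 * x powr (- \<alpha>)" if "\<bar>t\<bar> \<le> 1 + Y" for t x
      using mult_left_mono[OF power_mono[OF that abs_ge_zero, of 2] powr_ge_zero[of x "- \<alpha>"]]
      by (simp add: mult.commute)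
    have Y0: "0 \<le> Y" using Y[of 1] by simp
    show ?thesis
    proof (rule boundary_pairs_exist[of "\<lambda>_. 1" \<alpha> "\<lambda>_. 0" y "\<lambda>_. 1" "k\<^sup>2" "- \<alpha>" "(1 + Y)\<^sup>2"])
      show "x powr (- \<alpha>) * 1\<^sup>2 \<le> (1 + Y)\<^sup>2 * x powr (- \<alpha>)" for x by (rule bound) (use Y0 in simp)
      show "x powr (- \<alpha>) * (y x)\<^sup>2 \<le> (1 + Y)\<^sup>2 * x powr (- \<alpha>)" if "0 < x" "x < 3" for x
        by (rule bound) (use Y[OF that] in simp)
    qed (use y True assms that in auto)
  next
    case False
    have e: "\<bar>cosh (k * y x)\<bar> \<le> exp (\<bar>k\<bar> * Y)" "\<bar>sinh (k * y x)\<bar> \<le> exp (\<bar>k\<bar> * Y)" if "0 < x" "x < 3" for x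
    proof -
      have "\<bar>k * y x\<bar> \<le> \<bar>k\<bar> * Y" using Y[OF that] by (simp add: abs_mult mult_left_mono)
      then have "exp (k * y x) \<le> exp (\<bar>k\<bar> * Y)" "exp (- (k * y x)) \<le> exp (\<bar>k\<bar> * Y)" by auto
      moreover have "\<bar>(A + B) / 2\<bar> \<le> E" "\<bar>(A - B) / 2\<bar> \<le> E" if "A \<le> E" "B \<le> E" "0 < A" "0 < B" for A B E :: real
        using that by (auto simp: abs_le_iff)
      ultimately show "\<bar>cosh (k * y x)\<bar> \<le> exp (\<bar>k\<bar> * Y)" "\<bar>sinh (k * y x)\<bar> \<le> exp (\<bar>k\<bar> * Y)"
        unfolding cosh_field_def sinh_field_def using exp_gt_zero by blast+
    qed
    have bound: "x powr (- \<alpha>) * t\<^sup>2 \<le> (exp (\<bar>k\<bar> * Y))\<^sup>2 * x powr (- \<alpha>)" if "\<bar>t\<bar> \<le> exp (\<bar>k\<bar> * Y)" for t x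
      using mult_left_mono[OF power_mono[OF that abs_ge_zero, of 2] powr_ge_zero[of x "- \<alpha>"]]
      by (simp add: mult.commute)
    show ?thesis
    proof (rule boundary_pairs_exist[of "\<lambda>x. cosh (k * y x)" \<alpha> "\<lambda>x. k * sinh (k * y x)"
        "\<lambda>x. sinh (k * y x)" "\<lambda>x. k * cosh (k * y x)" "k\<^sup>2" "- \<alpha>" "(exp (\<bar>k\<bar> * Y))\<^sup>2"])
      fix x :: real assume x: "0 < x"
      show "((\<lambda>x. cosh (k * y x)) has_real_derivative x powr \<alpha> * (k * sinh (k * y x))) (at x)"
        "((\<lambda>x. sinh (k * y x)) has_real_derivative x powr \<alpha> * (k * cosh (k * y x))) (at x)"
        "((\<lambda>x. k * sinh (k * y x)) has_real_derivative k\<^sup>2 * x powr \<alpha> * cosh (k * y x)) (at x)"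
        "((\<lambda>x. k * cosh (k * y x)) has_real_derivative k\<^sup>2 * x powr \<alpha> * sinh (k * y x)) (at x)"
        by (auto intro!: derivative_eq_intros y[OF x] simp: power2_eq_square)
      have "k * sinh (k * y x) * sinh (k * y x) - cosh (k * y x) * (k * cosh (k * y x)) = - k * ((cosh (k * y x))\<^sup>2 - (sinh (k * y x))\<^sup>2)"
        by (simp add: power2_eq_square algebra_simps)
      also have "\<dots> = - k" by (simp add: hyperbolic_pythagoras)
      finally show "k * sinh (k * y x) * sinh (k * y x) - cosh (k * y x) * (k * cosh (k * y x)) \<noteq> 0" using False by simp
    next
      fix x :: real assume "0 < x" "x < 3"
      from e[OF this] show "x powr (- \<alpha>) * (cosh (k * y x))\<^sup>2 \<le> (exp (\<bar>k\<bar> * Y))\<^sup>2 * x powr (- \<alpha>)"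
        "x powr (- \<alpha>) * (sinh (k * y x))\<^sup>2 \<le> (exp (\<bar>k\<bar> * Y))\<^sup>2 * x powr (- \<alpha>)" by (blast intro: bound)+
    qed (use assms that in auto)
  qed
qed

text \<open>With \<open>t = sqrt x\<close> the quantity is \<open>4 * (t * ln t)\<^sup>2\<close>,
  and \<open>-1 \<le> t * ln t \<le> 2\<close> follows from \<open>ln s \<le> s - 1\<close> at
  \<open>t\<close> and at \<open>1 / t\<close>.\<close>

lemma x_ln_squared_bound: "0 < x \<Longrightarrow> x < 3 \<Longrightarrow> x * (ln x)\<^sup>2 \<le> 36" for x :: real
proof -
  assume x: "0 < x" "x < 3"
  define t where "t = sqrt x"
  have t: "0 < t" "x = t\<^sup>2" using x by (auto simp: t_def)
  have "t\<^sup>2 < 2\<^sup>2" using x t by simp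
  then have t2: "t < 2" using power2_less_imp_less[of t 2] by simp
  have lnx: "ln x = 2 * ln t" using t by (simp add: ln_realpow)
  have "t * ln t \<le> t * (t - 1)" using t ln_le_minus_one[of t] by simp
  also have "\<dots> \<le> 2 * 1" using t t2 by (smt (verit) mult_left_le mult_left_mono mult_nonneg_nonpos mult.commute)
  finally have u: "t * ln t \<le> 2" by simp
  have "- ln t \<le> 1 / t - 1" using ln_le_minus_one[of "1 / t"] t by (simp add: ln_div)
  then have "t * - ln t \<le> t * (1 / t - 1)" using t by (intro mult_left_mono) auto
  also have "\<dots> \<le> 1" using t by (simp add: right_diff_distrib)
  finally have l: "- 1 \<le> t * ln t" by simp
  have "x * (ln x)\<^sup>2 = 4 * (t * ln t)\<^sup>2" by (simp only: lnx) (simp add: t(2) power_mult_distrib)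
  also have "\<dots> \<le> 4 * 2\<^sup>2" using u l by (intro mult_left_mono abs_le_square_iff[THEN iffD1]) auto
  finally show ?thesis by simp
qed

text \<open>Here \<open>y\<close> is unbounded at the origin, but its weighted square is a multiple
  of \<open>x powr (\<alpha> + 2)\<close>, integrable because \<open>\<alpha> > -3\<close>. The
  constant solution has the milder weighted square \<open>x powr (- \<alpha>)\<close>. At
  \<open>\<alpha> = -1\<close> the logarithm takes the place of the power.\<close>

lemma boundary_pairs_middle:
  assumes "-3 < \<alpha>" "\<alpha> \<le> -1"
  obtains v\<^sub>1 w\<^sub>1 v\<^sub>2 w\<^sub>2 where "boundary_pair \<alpha> 0 v\<^sub>1 w\<^sub>1" "boundary_pair \<alpha> 0 v\<^sub>2 w\<^sub>2"
    "L2_inner (omega_line \<alpha>) w\<^sub>1 v\<^sub>2 \<noteq> L2_inner (omega_line \<alpha>) v\<^sub>1 w\<^sub>2"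
proof (cases "\<alpha> = -1")
  case True
  show ?thesis
  proof (rule boundary_pairs_exist[of "\<lambda>_. 1" \<alpha> "\<lambda>_. 0" ln "\<lambda>_. 1" 0 0 36])
    show "(ln has_real_derivative x powr \<alpha> * 1) (at x)" if "0 < x" for x
      using that True by (auto intro!: derivative_eq_intros simp: powr_minus_divide)
    show "x powr - \<alpha> * (ln x)\<^sup>2 \<le> 36 * x powr 0" if "0 < x" "x < 3" for x
      using x_ln_squared_bound[OF that] that True by simp
  qed (use True that in auto)
next
  case False
  then have neg: "\<alpha> < -1" using assms by simp
  define y where "y x = x powr (\<alpha> + 1) / (\<alpha> + 1)" for x
  have y: "(y has_real_derivative x powr \<alpha>) (at x)" if "0 < x" for x
    unfolding y_def using that neg by (auto intro!: derivative_eq_intros)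
  \<comment> \<open>The first summand serves the constant solution, through \<open>x powr (-
    \<alpha>) = x powr (\<alpha> + 2) * (x\<^sup>2) powr (-1 - \<alpha>)\<close> and
    \<open>x\<^sup>2 < 9\<close>; the second is the prefactor of \<open>y\<^sup>2\<close>.\<close>
  define C where "C = 9 powr (-1 - \<alpha>) + 1 / (\<alpha> + 1)\<^sup>2"
  have C: "1 / (\<alpha> + 1)\<^sup>2 \<le> C" "9 powr (-1 - \<alpha>) \<le> C" by (auto simp: C_def)
  show ?thesis
  proof (rule boundary_pairs_exist[of "\<lambda>_. 1" \<alpha> "\<lambda>_. 0" y "\<lambda>_. 1" 0 "\<alpha> + 2" C])
    fix x :: real assume x: "0 < x" "x < 3"
    have "x powr (- \<alpha>) = x powr (\<alpha> + 2) * x powr (2 * (-1 - \<alpha>))" by (simp add: powr_add[symmetric])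
    also have "x powr (2 * (-1 - \<alpha>)) = (x powr 2) powr (-1 - \<alpha>)" by (simp add: powr_powr)
    also have "\<dots> \<le> 9 powr (-1 - \<alpha>)"
      using x neg power_mono[of x 3 2] by (intro powr_mono2) auto
    finally have "x powr (- \<alpha>) \<le> 9 powr (-1 - \<alpha>) * x powr (\<alpha> + 2)" by (simp add: mult.commute mult_right_mono)
    also have "\<dots> \<le> C * x powr (\<alpha> + 2)" by (intro mult_right_mono C) auto
    finally show "x powr (- \<alpha>) * 1\<^sup>2 \<le> C * x powr (\<alpha> + 2)" by simp
    have "x powr (- \<alpha>) * (y x)\<^sup>2 = 1 / (\<alpha> + 1)\<^sup>2 * (x powr (- \<alpha>) * (x powr (\<alpha> + 1))\<^sup>2)"
      by (simp add: y_def power_divide)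
    also have "x powr (- \<alpha>) * (x powr (\<alpha> + 1))\<^sup>2 = x powr (\<alpha> + 2)"
      by (simp add: power2_eq_square powr_add[symmetric])
    also have "1 / (\<alpha> + 1)\<^sup>2 * x powr (\<alpha> + 2) \<le> C * x powr (\<alpha> + 2)" by (intro mult_right_mono C) auto
    finally show "x powr (- \<alpha>) * (y x)\<^sup>2 \<le> C * x powr (\<alpha> + 2)" .
  qed (use y assms that in auto)
qed

lemma not_ess_self_adjoint_line:
  assumes "boundary_pair \<alpha> ((of_int k)\<^sup>2) v\<^sub>1 w\<^sub>1" "boundary_pair \<alpha> ((of_int k)\<^sup>2) v\<^sub>2 w\<^sub>2"
    "L2_inner (omega_line \<alpha>) w\<^sub>1 v\<^sub>2 \<noteq> L2_inner (omega_line \<alpha>) v\<^sub>1 w\<^sub>2"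
  shows "\<not> ess_self_adjoint (omega_line \<alpha>) Cc_line (lap_k \<alpha> k)"
  by (rule not_ess_self_adjointI[OF _ boundary_pair_adjoint[OF assms(1)] boundary_pair_adjoint[OF assms(2)] assms(3)])
    (auto intro: Cc_line_L2)

section \<open>Completeness of the trigonometric system\<close>

inductive trig_poly :: "(real \<Rightarrow> real) \<Rightarrow> bool" where
  cos: "trig_poly (\<lambda>t. cos (of_int k * t))"
| sin: "trig_poly (\<lambda>t. sin (of_int k * t))"
| add: "trig_poly f \<Longrightarrow> trig_poly g \<Longrightarrow> trig_poly (\<lambda>t. f t + g t)"
| cmult: "trig_poly f \<Longrightarrow> trig_poly (\<lambda>t. c * f t)"

lemma trig_poly_const: "trig_poly (\<lambda>t. c)"
  using trig_poly.cmult[OF trig_poly.cos[of 0], of c] by simp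

text \<open>Product-to-sum formulas; integer frequencies of either sign make \<open>k - l\<close>
  admissible without a case distinction.\<close>

lemma trig_poly_mult_cos: "trig_poly g \<Longrightarrow> trig_poly (\<lambda>t. cos (of_int k * t) * g t)"
proof (induction rule: trig_poly.induct)
  case (cos l)
  have eq: "(\<lambda>t::real. cos (of_int k * t) * cos (of_int l * t))
      = (\<lambda>t. 1/2 * cos (of_int (k - l) * t) + 1/2 * cos (of_int (k + l) * t))"
    by (auto simp: fun_eq_iff cos_times_cos algebra_simps add_divide_distrib)
  show ?case unfolding eq by (intro trig_poly.intros)
next
  case (sin l)
  have eq: "(\<lambda>t::real. cos (of_int k * t) * sin (of_int l * t))
      = (\<lambda>t. 1/2 * sin (of_int (k + l) * t) + (-1/2) * sin (of_int (k - l) * t))"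
    by (auto simp: fun_eq_iff cos_times_sin algebra_simps diff_divide_distrib)
  show ?case unfolding eq by (intro trig_poly.intros)
next
  case (add f g)
  from trig_poly.add[OF add.IH] show ?case by (simp add: distrib_left)
next
  case (cmult f c)
  from trig_poly.cmult[OF cmult.IH, of c] show ?case by (simp add: mult.left_commute)
qed

lemma trig_poly_mult_sin: "trig_poly g \<Longrightarrow> trig_poly (\<lambda>t. sin (of_int k * t) * g t)"
proof (induction rule: trig_poly.induct)
  case (cos l)
  from trig_poly_mult_cos[OF trig_poly.sin[of k], of l] show ?case by (simp add: mult.commute)
next
  case (sin l)
  have eq: "(\<lambda>t::real. sin (of_int k * t) * sin (of_int l * t))
      = (\<lambda>t. 1/2 * cos (of_int (k - l) * t) + (-1/2) * cos (of_int (k + l) * t))"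
    by (auto simp: fun_eq_iff sin_times_sin algebra_simps diff_divide_distrib)
  show ?case unfolding eq by (intro trig_poly.intros)
next
  case (add f g)
  from trig_poly.add[OF add.IH] show ?case by (simp add: distrib_left)
next
  case (cmult f c)
  from trig_poly.cmult[OF cmult.IH, of c] show ?case by (simp add: mult.left_commute)
qed

lemma trig_poly_mult: "trig_poly f \<Longrightarrow> trig_poly g \<Longrightarrow> trig_poly (\<lambda>t. f t * g t)"
proof (induction rule: trig_poly.induct)
  case (add f h)
  from trig_poly.add[OF add.IH(1)[OF add.prems] add.IH(2)[OF add.prems]] show ?case by (simp add: distrib_right)
next
  case (cmult f c)
  from trig_poly.cmult[OF cmult.IH[OF cmult.prems], of c] show ?case by (simp add: mult.assoc)
qed (auto intro: trig_poly_mult_cos trig_poly_mult_sin)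

lemma trig_poly_bounded: "trig_poly f \<Longrightarrow> \<exists>C. \<forall>t. \<bar>f t\<bar> \<le> C"
proof (induction rule: trig_poly.induct)
  case (add f g)
  then obtain C D where "\<forall>t. \<bar>f t\<bar> \<le> C" "\<forall>t. \<bar>g t\<bar> \<le> D" by blast
  then have "\<forall>t. \<bar>f t + g t\<bar> \<le> C + D" by (meson abs_triangle_ineq add_mono order_trans)
  then show ?case by blast
next
  case (cmult f c)
  then obtain C where "\<forall>t. \<bar>f t\<bar> \<le> C" by blast
  then have "\<forall>t. \<bar>c * f t\<bar> \<le> \<bar>c\<bar> * C" by (simp add: abs_mult mult_left_mono)
  then show ?case by blast
qed (auto intro: exI[of _ 1])

lemma trig_poly_measurable: "trig_poly f \<Longrightarrow> f \<in> borel_measurable borel"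
  by (induction rule: trig_poly.induct) auto

lemma integrable_mult_bounded:
  fixes f g :: "'a \<Rightarrow> real"
  assumes "integrable M g" "f \<in> borel_measurable M" "\<And>x. \<bar>f x\<bar> \<le> C"
  shows "integrable M (\<lambda>x. g x * f x)"
proof (rule Bochner_Integration.integrable_bound)
  show "integrable M (\<lambda>x. C * g x)" using assms(1) by simp
  show "(\<lambda>x. g x * f x) \<in> borel_measurable M" using assms by auto
  have "\<bar>g x\<bar> * \<bar>f x\<bar> \<le> \<bar>C\<bar> * \<bar>g x\<bar>" for x
    using mult_left_mono[of "\<bar>f x\<bar>" "\<bar>C\<bar>" "\<bar>g x\<bar>"] assms(3)[of x] by (simp add: mult.commute)
  then show "AE x in M. norm (g x * f x) \<le> norm (C * g x)" by (simp add: abs_mult)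
qed

text \<open>The strict bounds on \<open>t\<close> keep away from the point where 0 and
  \<open>2 * pi\<close> are identified, so \<open>s\<close> may be either endpoint of the closed
  range.\<close>

lemma cis_eq_imp_eq:
  assumes "cis t = cis s" "0 < t" "t < 2 * pi" "0 \<le> s" "s \<le> 2 * pi"
  shows "t = s"
proof -
  have "cos t = cos s" "sin t = sin s" using assms(1) by (auto simp: complex_eq_iff)
  then have "cos (t - s) = (cos s)\<^sup>2 + (sin s)\<^sup>2" by (simp add: cos_diff power2_eq_square)
  then have "cos (t - s) = 1" by (simp add: cos_squared_eq)
  then obtain n where n: "t - s = real_of_int n * 2 * pi" unfolding cos_one_2pi_int by blast
  have "\<bar>t - s\<bar> < 2 * pi" using assms by linarith
  then have "\<bar>real_of_int n\<bar> * (2 * pi) < 1 * (2 * pi)" unfolding n by (simp add: abs_mult)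
  then have "\<bar>real_of_int n\<bar> < 1" by (rule mult_right_less_imp_less) simp
  then have "n = 0" by linarith
  then show ?thesis using n by simp
qed

text \<open>By Stone--Weierstrass, \<open>f\<close> annihilates the continuous functions on the circle; distance
  functions to arcs then yield the indicators of intervals.\<close>
lemma fourier_complete:
  fixes f :: "real \<Rightarrow> real"
  assumes int: "integrable lborel (\<lambda>t. indicator {0..<2 * pi} t * f t)"
    and z: "\<And>k::int. (LINT t|lborel. indicator {0..<2 * pi} t * f t * cos (of_int k * t)) = 0"
      "\<And>k::int. (LINT t|lborel. indicator {0..<2 * pi} t * f t * sin (of_int k * t)) = 0"
  shows "AE t in lborel. indicator {0..<2 * pi} t * f t = 0"
proof -
  define G where "G t = indicator {0..<2 * pi} t * f t" for t
  have iG: "integrable lborel G" using int unfolding G_def .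
  then have [measurable]: "G \<in> borel_measurable borel" by auto
  have iGp: "integrable lborel (\<lambda>t. G t * p t)" if "trig_poly p" for p
    using trig_poly_bounded[OF that] trig_poly_measurable[OF that] integrable_mult_bounded[OF iG, of p] by auto
  have orth: "(LINT t|lborel. G t * p t) = 0" if "trig_poly p" for p
    using that
  proof (induction rule: trig_poly.induct)
    case (add f g)
    then show ?case using iGp[OF add.hyps(1)] iGp[OF add.hyps(2)] by (simp add: distrib_left)
  next
    case (cmult f c)
    then show ?case by (simp add: mult.left_commute)
  qed (use z in \<open>auto simp: G_def\<close>)
  have mcis [measurable]: "cis \<in> borel_measurable borel"
    by (intro borel_measurable_continuous_onI continuous_intros)
  have circ: "(LINT t|lborel. G t * F (cis t)) = 0" if F: "continuous_on UNIV F" for F :: "complex \<Rightarrow> real"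
  proof (rule ccontr)
    assume nz: "(LINT t|lborel. G t * F (cis t)) \<noteq> 0"
    define I where "I = (LINT t|lborel. \<bar>G t\<bar>)"
    have I: "0 \<le> I" by (simp add: I_def)
    \<comment> \<open>The approximation error is chosen so that \<open>e * I\<close> stays below the
      supposedly nonzero integral; the summand 1 covers \<open>I = 0\<close>.\<close>
    define e where "e = \<bar>LINT t|lborel. G t * F (cis t)\<bar> / (I + 1)"
    have e: "0 < e" using nz I by (simp add: e_def)
    \<comment> \<open>Periodicity is built in by approximating on the unit circle: the algebra
      consists of the continuous functions whose pullback along \<open>cis\<close> is a
      trigonometric polynomial.\<close>
    let ?P = "\<lambda>H::complex \<Rightarrow> real. continuous_on (sphere 0 1) H \<and> trig_poly (\<lambda>t. H (cis t))"
    have "\<exists>H. ?P H \<and> (\<forall>x\<in>sphere 0 1. \<bar>F x - H x\<bar> < e)"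
    proof (rule Stone_Weierstrass_HOL[of "sphere 0 1" ?P F e])
      show "\<exists>f. ?P f \<and> f x \<noteq> f y" if "x \<in> sphere 0 1 \<and> y \<in> sphere 0 1 \<and> x \<noteq> y" for x y :: complex
      proof -
        have "?P Re" "?P Im"
          using trig_poly.cos[of 1] trig_poly.sin[of 1] by (auto intro!: continuous_intros)
        moreover have "Re x \<noteq> Re y \<or> Im x \<noteq> Im y" using that by (auto simp: complex_eq_iff)
        ultimately show ?thesis by blast
      qed
      show "continuous_on (sphere 0 1) F" using F continuous_on_subset by blast
    qed (use e in \<open>auto intro!: continuous_intros trig_poly_const trig_poly.add trig_poly_mult\<close>)
    then obtain H where H: "trig_poly (\<lambda>t. H (cis t))" "\<And>x. norm x = 1 \<Longrightarrow> \<bar>F x - H x\<bar> < e" by auto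
    have mF: "(\<lambda>t. F (cis t)) \<in> borel_measurable borel"
      by (intro borel_measurable_continuous_onI continuous_on_compose2[OF F] continuous_intros) auto
    have d: "\<bar>F (cis t) - H (cis t)\<bar> \<le> e" for t using H(2)[of "cis t"] by simp
    have mH: "(\<lambda>t. H (cis t)) \<in> borel_measurable borel" by (rule trig_poly_measurable[OF H(1)])
    have iD: "integrable lborel (\<lambda>t. G t * (F (cis t) - H (cis t)))"
      by (rule integrable_mult_bounded[OF iG _ d]) (use mF mH in simp)
    have "(LINT t|lborel. G t * F (cis t)) = (LINT t|lborel. G t * (F (cis t) - H (cis t)) + G t * H (cis t))"
      by (simp add: algebra_simps)
    also have "\<dots> = (LINT t|lborel. G t * (F (cis t) - H (cis t)))"
      using iD iGp[OF H(1)] orth[OF H(1)] by simp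
    finally have "\<bar>LINT t|lborel. G t * F (cis t)\<bar> \<le> (LINT t|lborel. \<bar>G t * (F (cis t) - H (cis t))\<bar>)"
      using integral_abs_bound[of lborel "\<lambda>t. G t * (F (cis t) - H (cis t))"] by simp
    also have "\<dots> \<le> (LINT t|lborel. e * \<bar>G t\<bar>)"
      using iG by (intro integral_mono integrable_abs iD) (auto simp: abs_mult mult.commute[of e] intro!: mult_left_mono d)
    also have "\<dots> = e * I" by (simp add: I_def)
    also have "\<dots> < e * (I + 1)" using e by simp
    also have "\<dots> = \<bar>LINT t|lborel. G t * F (cis t)\<bar>" using I by (simp add: e_def)
    finally show False by simp
  qed
  have arc: "(LINT t|lborel. indicator {a..b} t * G t) = 0" if ab: "0 \<le> a" "a \<le> b" "b \<le> 2 * pi" for a b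
  proof -
    define A where "A = cis ` {a..b}"
    have A: "closed A" "A \<noteq> {}"
      unfolding A_def using ab by (auto intro!: compact_imp_closed compact_continuous_image continuous_intros)
    \<comment> \<open>Continuous functions on the plane that decrease to the indicator of the closed
      arc \<open>A\<close>.\<close>
    define F where "F n z = max 0 (1 - real n * infdist z A)" for n z
    have cF: "continuous_on UNIV (F n)" for n unfolding F_def by (intro continuous_intros)
    have "(\<lambda>n. LINT t|lborel. G t * F n (cis t)) \<longlonglongrightarrow> (LINT t|lborel. indicator {a..b} t * G t)"
    proof (rule integral_dominated_convergence[where w = "\<lambda>t. \<bar>G t\<bar>"])
      show "(\<lambda>t. G t * F n (cis t)) \<in> borel_measurable lborel" for n
      proof -
        have "(\<lambda>t. F n (cis t)) \<in> borel_measurable borel"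
          by (intro borel_measurable_continuous_onI continuous_on_compose2[OF cF] continuous_intros) auto
        then show ?thesis by simp
      qed
      show "AE t in lborel. norm (G t * F n (cis t)) \<le> \<bar>G t\<bar>" for n
      proof (rule AE_I2)
        fix t
        have "0 \<le> F n (cis t)" "F n (cis t) \<le> 1" by (auto simp: F_def infdist_nonneg)
        then show "norm (G t * F n (cis t)) \<le> \<bar>G t\<bar>" by (simp add: abs_mult mult_left_le)
      qed
      \<comment> \<open>At \<open>t = 0\<close> the point \<open>cis t\<close> lies on the arc also
        when only \<open>b = 2 * pi\<close> reaches it, so the pointwise limit may be wrong there; a
        single point is negligible.\<close>
      have "AE t in lborel. t \<noteq> (0::real)" by (rule AE_lborel_singleton)
      then show "AE t in lborel. (\<lambda>n. G t * F n (cis t)) \<longlonglongrightarrow> indicator {a..b} t * G t"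
      proof eventually_elim
        case (elim t)
        show ?case
        proof (cases "t \<in> {0..<2 * pi}")
          case True
          then have t: "0 < t" "t < 2 * pi" using elim by auto
          have mem: "cis t \<in> A \<longleftrightarrow> t \<in> {a..b}"
          proof
            assume "cis t \<in> A"
            then obtain s where "s \<in> {a..b}" "cis t = cis s" by (auto simp: A_def)
            then show "t \<in> {a..b}" using cis_eq_imp_eq[of t s] t ab by auto
          qed (auto simp: A_def)
          have "(\<lambda>n. F n (cis t)) \<longlonglongrightarrow> indicator {a..b} t"
          proof (cases "t \<in> {a..b}")
            case True
            then have "infdist (cis t) A = 0" using mem by simp
            then show ?thesis using True by (simp add: F_def)
          next
            case False
            then have d: "0 < infdist (cis t) A"
              using mem A by (metis in_closed_iff_infdist_zero infdist_nonneg order_le_less)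
            obtain N :: nat where N: "1 / infdist (cis t) A < N" using reals_Archimedean2 by blast
            have "F n (cis t) = 0" if "n \<ge> N" for n
            proof -
              have "1 / infdist (cis t) A \<le> real n" using N that by linarith
              then show ?thesis using d by (simp add: F_def field_simps)
            qed
            then show ?thesis using False by (intro tendsto_eventually) (auto simp: eventually_sequentially)
          qed
          from tendsto_mult[OF tendsto_const this, of "G t"] show ?thesis by (simp add: mult.commute)
        next
          case False
          then show ?thesis by (simp add: G_def)
        qed
      qed
    qed (use iG in auto)
    then show ?thesis using circ[OF cF] by (simp add: LIMSEQ_const_iff)
  qed
  have "AE t in lborel. G t = 0"
  proof (rule AE_zero_if_interval_integrals_zero[OF iG])
    fix a b :: real
    define a' b' where "a' = max a 0" and "b' = min b (2 * pi)"
    have ae: "AE t in lborel. indicator {a<..<b} t * G t = indicator {a'..b'} t * G t"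
      using AE_lborel_singleton[of a] AE_lborel_singleton[of b]
      by eventually_elim (auto simp: indicator_def G_def a'_def b'_def)
    have "(LINT t|lborel. indicator {a<..<b} t * G t) = (LINT t|lborel. indicator {a'..b'} t * G t)"
      by (rule integral_cong_AE[OF _ _ ae]) auto
    also have "\<dots> = 0"
    proof (cases "a' \<le> b'")
      case True
      then show ?thesis by (intro arc) (auto simp: a'_def b'_def)
    next
      case False
      then show ?thesis by simp
    qed
    finally show "(LINT t|lborel. indicator {a<..<b} t * G t) = 0" .
  qed
  then show ?thesis unfolding G_def .
qed

section \<open>The Laplace--Beltrami operator on the cylinder\<close>

lemma measurable_fst_borel [measurable]: "fst \<in> borel_measurable (borel :: (real \<times> real) measure)"
  and measurable_snd_borel [measurable]: "snd \<in> borel_measurable (borel :: (real \<times> real) measure)"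
  by (intro borel_measurable_continuous_onI continuous_intros)+

definition weight :: "real \<Rightarrow> real \<times> real \<Rightarrow> real" where
  "weight \<alpha> p = indicator {0..<2 * pi} (snd p) * \<bar>fst p\<bar> powr (- \<alpha>)"

lemma weight_measurable [measurable]: "weight \<alpha> \<in> borel_measurable borel"
  unfolding weight_def[abs_def] by measurable

lemma weight_nonneg: "0 \<le> weight \<alpha> p"
  by (simp add: weight_def)

lemma omega_M_eq: "omega_M \<alpha> = density lborel (\<lambda>p. ennreal (weight \<alpha> p))"
  by (simp add: omega_M_def weight_def)

lemma L2_omega_M_iff:
  "L2 (omega_M \<alpha>) f \<longleftrightarrow> f \<in> borel_measurable borel \<and> integrable lborel (\<lambda>p. weight \<alpha> p * (f p)\<^sup>2)"
  unfolding L2_def omega_M_eq by (auto simp: integrable_real_density weight_nonneg)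

lemma omega_M_integrable:
  assumes "L2 (omega_M \<alpha>) f" "L2 (omega_M \<alpha>) g"
  shows "integrable lborel (\<lambda>p. weight \<alpha> p * (f p * g p))"
  using L2_integrable_mult[OF assms] assms unfolding omega_M_eq
  by (subst (asm) integrable_real_density) (auto simp: weight_nonneg L2_omega_M_iff[unfolded omega_M_eq])

lemma L2_inner_omega_M:
  assumes "L2 (omega_M \<alpha>) f" "L2 (omega_M \<alpha>) g"
  shows "L2_inner (omega_M \<alpha>) f g = (LINT p|lborel. weight \<alpha> p * (f p * g p))"
  using assms unfolding L2_inner_def L2_omega_M_iff unfolding omega_M_eq
  by (subst integral_real_density) (auto simp: weight_nonneg)

lemma lborel_fubini:
  fixes F :: "real \<times> real \<Rightarrow> real"
  assumes "integrable lborel F"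
  shows "(LINT p|lborel. F p) = (LINT x|lborel. LINT t|lborel. F (x, t))"
    "(LINT p|lborel. F p) = (LINT t|lborel. LINT x|lborel. F (x, t))"
proof -
  have i: "integrable (lborel \<Otimes>\<^sub>M lborel) F" using assms by (simp add: lborel_prod)
  from lborel_pair.integral_fst'[OF i] show 1: "(LINT p|lborel. F p) = (LINT x|lborel. LINT t|lborel. F (x, t))"
    by (simp add: lborel_prod)
  have "integrable (lborel \<Otimes>\<^sub>M lborel) (\<lambda>(x, t). F (x, t))" using i by simp
  from lborel_pair.Fubini_integral[OF this] show "(LINT p|lborel. F p) = (LINT t|lborel. LINT x|lborel. F (x, t))"
    using 1 by simp
qed

text \<open>Both orders of integration are needed: integrating first over the circle suits the
  angular part of the Laplacian, integrating first over the line, as in the next lemma, suits its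
  radial part.\<close>

lemma L2_inner_omega_M_x:
  assumes "L2 (omega_M \<alpha>) f" "L2 (omega_M \<alpha>) g"
  shows "L2_inner (omega_M \<alpha>) f g
    = (LINT x|lborel. \<bar>x\<bar> powr (- \<alpha>) * (LINT t|lborel. indicator {0..<2 * pi} t * (f (x, t) * g (x, t))))"
  unfolding L2_inner_omega_M[OF assms] lborel_fubini(1)[OF omega_M_integrable[OF assms]]
  by (subst integral_mult_right_zero[symmetric]) (simp add: weight_def mult_ac)

lemma L2_inner_omega_M_t:
  assumes "L2 (omega_M \<alpha>) f" "L2 (omega_M \<alpha>) g"
  shows "L2_inner (omega_M \<alpha>) f g
    = (LINT t|lborel. indicator {0..<2 * pi} t * (LINT x|lborel. \<bar>x\<bar> powr (- \<alpha>) * (f (x, t) * g (x, t))))"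
  unfolding L2_inner_omega_M[OF assms] lborel_fubini(2)[OF omega_M_integrable[OF assms]]
  by (subst integral_mult_right_zero[symmetric]) (simp add: weight_def mult_ac)

lemma isCont_annular2:
  fixes g :: "real \<times> real \<Rightarrow> real"
  assumes "0 < a" "\<And>x t. x \<noteq> 0 \<Longrightarrow> isCont g (x, t)" "\<And>x t. \<bar>x\<bar> < a \<Longrightarrow> g (x, t) = 0"
  shows "isCont g p"
proof (cases "fst p = 0")
  case True
  have op: "open {p::real \<times> real. \<bar>fst p\<bar> < a}" by (intro open_Collect_less continuous_intros)
  have "\<forall>\<^sub>F q in nhds p. g q = 0"
    using eventually_nhds_in_open[OF op, of p] True assms(1,3) by (auto elim!: eventually_mono)
  from isCont_cong[OF this] show ?thesis by simp
next
  case False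
  then show ?thesis using assms(2)[of "fst p" "snd p"] by simp
qed

lemma L2_omega_M_annular:
  fixes g :: "real \<times> real \<Rightarrow> real"
  assumes a: "0 < a" and g: "\<And>x t. x \<noteq> 0 \<Longrightarrow> isCont g (x, t)"
    and z: "\<And>x t. \<bar>x\<bar> < a \<or> b < \<bar>x\<bar> \<Longrightarrow> g (x, t) = 0"
  shows "L2 (omega_M \<alpha>) g"
  unfolding L2_omega_M_iff
proof
  have "isCont g p" for p by (rule isCont_annular2[OF a g]) (use z in auto)
  then show "g \<in> borel_measurable borel" by (intro borel_measurable_continuous_onI continuous_at_imp_continuous_on ballI)
  let ?F = "\<lambda>p. \<bar>fst p\<bar> powr (- \<alpha>) * (g p)\<^sup>2"
  have c: "isCont ?F p" for p
  proof (rule isCont_annular2[OF a])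
    fix x t :: real assume "x \<noteq> 0"
    then have "isCont (\<lambda>p::real \<times> real. \<bar>fst p\<bar> powr (- \<alpha>)) (x, t)"
      using isCont_o2[of "(x, t)" fst "\<lambda>x. \<bar>x\<bar> powr (- \<alpha>)"] isCont_abs_powr'[of x] by simp
    then show "isCont ?F (x, t)" using g[OF \<open>x \<noteq> 0\<close>] by (intro continuous_mult continuous_power)
  qed (use z in auto)
  have i: "integrable lborel (\<lambda>p. indicator ({- b..b} \<times> {0..2 * pi}) p *\<^sub>R ?F p)"
    by (intro borel_integrable_compact compact_Times compact_Icc continuous_at_imp_continuous_on ballI c)
  have m: "{p::real \<times> real. snd p \<in> {0..<2 * pi}} \<in> sets lborel"
    using measurable_sets[OF measurable_snd_borel, of "{0..<2 * pi}"] by (simp add: vimage_def)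
  have "integrable lborel (\<lambda>p. indicator {p. snd p \<in> {0..<2 * pi}} p *\<^sub>R (indicator ({- b..b} \<times> {0..2 * pi}) p *\<^sub>R ?F p))"
    by (rule integrable_mult_indicator[OF m i])
  also have "(\<lambda>p. indicator {p. snd p \<in> {0..<2 * pi}} p *\<^sub>R (indicator ({- b..b} \<times> {0..2 * pi}) p *\<^sub>R ?F p)) = (\<lambda>p. weight \<alpha> p * (g p)\<^sup>2)"
  proof
    fix p :: "real \<times> real"
    have "g p = 0" if "fst p \<notin> {- b..b}"
    proof -
      have "b < \<bar>fst p\<bar>" using that by (cases "0 \<le> fst p") auto
      then show ?thesis using z[of "fst p" "snd p"] by simp
    qed
    then show "indicator {p. snd p \<in> {0..<2 * pi}} p *\<^sub>R (indicator ({- b..b} \<times> {0..2 * pi}) p *\<^sub>R ?F p) = weight \<alpha> p * (g p)\<^sup>2"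
      by (cases p) (auto simp: weight_def indicator_def)
  qed
  finally show "integrable lborel (\<lambda>p. weight \<alpha> p * (g p)\<^sup>2)" .
qed

text \<open>Partial derivatives are set to 0 on the line \<open>x = 0\<close>, where smoothness
  prescribes nothing. Support and periodicity pass from \<open>u\<close> to all of them by
  uniqueness of derivatives, inductively first in the angular and then in the radial order.\<close>

lemma Cc_ME:
  assumes "u \<in> Cc_M"
  obtains E a b where "E 0 0 = u"
    "\<And>i j x t. ((\<lambda>s. E i j (s, t)) has_real_derivative E (Suc i) j (x, t)) (at x)"
    "\<And>i j x t. ((\<lambda>s. E i j (x, s)) has_real_derivative E i (Suc j) (x, t)) (at t)"
    "\<And>i j p. isCont (E i j) p" "0 < a" "a < b"
    "\<And>i j x t. \<bar>x\<bar> < a \<or> b < \<bar>x\<bar> \<Longrightarrow> E i j (x, t) = 0"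
    "\<And>i j x t. E i j (x, t + 2 * pi) = E i j (x, t)"
proof -
  obtain D a b where D0: "D 0 0 = u" and D: "\<forall>i j. continuous_on {p. fst p \<noteq> 0} (D i j) \<and>
      (\<forall>x t. (x, t) \<in> {p. fst p \<noteq> 0} \<longrightarrow>
         ((\<lambda>s. D i j (s, t)) has_real_derivative D (Suc i) j (x, t)) (at x) \<and>
         ((\<lambda>s. D i j (x, s)) has_real_derivative D i (Suc j) (x, t)) (at t))"
    and per: "\<forall>x t. u (x, t + 2 * pi) = u (x, t)"
    and a: "0 < a" "\<forall>x t. \<bar>x\<bar> < a \<or> b < \<bar>x\<bar> \<longrightarrow> u (x, t) = 0"
    using assms unfolding Cc_M_def smooth2_on_def by blast
  have Dc: "continuous_on {p. fst p \<noteq> 0} (D i j)" for i j using D by blast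
  have Dx: "((\<lambda>s. D i j (s, t)) has_real_derivative D (Suc i) j (x, t)) (at x)"
    and Dt: "((\<lambda>s. D i j (x, s)) has_real_derivative D i (Suc j) (x, t)) (at t)" if "x \<noteq> 0" for i j x t
    using D that by simp_all
  let ?V = "{x. x \<noteq> 0 \<and> (\<bar>x\<bar> < a \<or> b < \<bar>x\<bar>)}"
  have opV: "open ?V"
    by (intro open_Collect_conj open_Collect_disj open_Collect_less open_Collect_neq continuous_intros)
  have zero: "D i j (x, t) = 0" if "x \<in> ?V" for i j x t
    using that
  proof (induction i arbitrary: j x t)
    case 0
    then show ?case
    proof (induction j arbitrary: x t)
      case 0
      then show ?case using D0 a by auto
    next
      case (Suc j)
      then have "((\<lambda>s. D 0 j (x, s)) has_real_derivative 0) (at t)"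
        by (intro has_field_derivative_transform_within_open[OF DERIV_const[of 0], of UNIV]) auto
      then show ?case using Dt[of x 0 j t] Suc.prems DERIV_unique by auto
    qed
  next
    case (Suc i)
    have "((\<lambda>s. D i j (s, t)) has_real_derivative 0) (at x)"
      by (rule has_field_derivative_transform_within_open[OF DERIV_const[of 0] opV Suc.prems]) (use Suc.IH in auto)
    then show ?case using Dx[of x i j t] Suc.prems DERIV_unique by auto
  qed
  have perD: "D i j (x, t + 2 * pi) = D i j (x, t)" if "x \<noteq> 0" for i j x t
    using that
  proof (induction i arbitrary: j x t)
    case 0
    then show ?case
    proof (induction j arbitrary: x t)
      case 0
      then show ?case using D0 per by auto
    next
      case (Suc j)
      have "((\<lambda>s. D 0 j (x, s + 2 * pi)) has_real_derivative D 0 (Suc j) (x, t + 2 * pi)) (at t)"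
        using Dt[OF Suc.prems, of 0 j "t + 2 * pi"] by (simp add: DERIV_shift)
      then have "((\<lambda>s. D 0 j (x, s)) has_real_derivative D 0 (Suc j) (x, t + 2 * pi)) (at t)"
        using Suc by simp
      then show ?case using Dt[OF Suc.prems] DERIV_unique by blast
    qed
  next
    case (Suc i)
    have "((\<lambda>s. D i j (s, t + 2 * pi)) has_real_derivative D (Suc i) j (x, t)) (at x)"
      by (rule has_field_derivative_transform_within_open[OF Dx[OF Suc.prems], of "- {0}"]) (use Suc in auto)
    then show ?case using Dx[OF Suc.prems, of i j "t + 2 * pi"] DERIV_unique by blast
  qed
  define E where "E i j p = (if fst p = 0 then 0 else D i j p)" for i j p
  have E0: "E i j (x, t) = 0" if "\<bar>x\<bar> < a \<or> b < \<bar>x\<bar>" for i j x t using zero that by (auto simp: E_def)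
  show ?thesis
  proof (rule that[of E a "max b (a + 1)"])
    show "E 0 0 = u"
    proof
      fix p show "E 0 0 p = u p" using D0 a by (cases p) (auto simp: E_def)
    qed
    show "((\<lambda>s. E i j (s, t)) has_real_derivative E (Suc i) j (x, t)) (at x)" for i j x t
    proof (rule DERIV_annular[OF a(1)])
      fix x :: real assume "x \<noteq> 0"
      then have "((\<lambda>s. D i j (s, t)) has_real_derivative E (Suc i) j (x, t)) (at x)"
        using Dx[of x i j t] by (simp add: E_def)
      then show "((\<lambda>s. E i j (s, t)) has_real_derivative E (Suc i) j (x, t)) (at x)"
        by (rule has_field_derivative_transform_within_open[where S = "- {0}"]) (use \<open>x \<noteq> 0\<close> in \<open>auto simp: E_def\<close>)
    qed (use E0 in auto)
    show "((\<lambda>s. E i j (x, s)) has_real_derivative E i (Suc j) (x, t)) (at t)" for i j x t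
      using Dt[of x i j t] by (cases "x = 0") (auto simp: E_def)
    show "isCont (E i j) p" for i j p
    proof (rule isCont_annular2[OF a(1)])
      fix x t :: real assume x: "x \<noteq> 0"
      have op: "open {p::real \<times> real. fst p \<noteq> 0}" by (intro open_Collect_neq continuous_intros)
      have c: "isCont (D i j) (x, t)" using Dc[of i j] x continuous_on_eq_continuous_at[OF op] by auto
      have "\<forall>\<^sub>F q in nhds (x, t). E i j q = D i j q"
        using eventually_nhds_in_open[OF op, of "(x, t)"] x by (auto elim!: eventually_mono simp: E_def)
      from isCont_cong[OF this] c show "isCont (E i j) (x, t)" by simp
    qed (use E0 in auto)
    show "E i j (x, t + 2 * pi) = E i j (x, t)" for i j x t using perD by (auto simp: E_def)
  qed (use a E0 in auto)
qed

lemma isCont_fst_comp: "isCont f x \<Longrightarrow> isCont (\<lambda>p::real \<times> real. f (fst p)) (x, t)"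
  using isCont_o2[of "(x, t)" fst f] by simp

lemma lap_M_eq:
  assumes "E 0 0 = u" "\<And>i j x t. ((\<lambda>s. E i j (s, t)) has_real_derivative E (Suc i) j (x, t)) (at x)"
    "\<And>i j x t. ((\<lambda>s. E i j (x, s)) has_real_derivative E i (Suc j) (x, t)) (at t)"
  shows "deriv (\<lambda>r. u (r, t)) x = E 1 0 (x, t)" "deriv (\<lambda>r. u (x, r)) t = E 0 1 (x, t)"
    "lap_M \<alpha> u = (\<lambda>p. (E 2 0 p - \<alpha> / fst p * E 1 0 p) + \<bar>fst p\<bar> powr (2 * \<alpha>) * E 0 2 p)"
proof -
  have x1: "deriv (\<lambda>r. u (r, t)) = (\<lambda>x. E 1 0 (x, t))" for t
    using assms(2)[of 0 0 t] assms(1) by (auto intro!: ext DERIV_imp_deriv)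
  have t1: "deriv (\<lambda>r. u (x, r)) = (\<lambda>t. E 0 1 (x, t))" for x
    using assms(3)[of 0 0 x] assms(1) by (auto intro!: ext DERIV_imp_deriv)
  have x2: "deriv (\<lambda>r. E 1 0 (r, t)) = (\<lambda>x. E 2 0 (x, t))" for t
    using assms(2)[of 1 0 t] by (auto intro!: ext DERIV_imp_deriv simp: numeral_2_eq_2)
  have t2: "deriv (\<lambda>r. E 0 1 (x, r)) = (\<lambda>t. E 0 2 (x, t))" for x
    using assms(3)[of 0 1 x] by (auto intro!: ext DERIV_imp_deriv simp: numeral_2_eq_2)
  show "deriv (\<lambda>r. u (r, t)) x = E 1 0 (x, t)" "deriv (\<lambda>r. u (x, r)) t = E 0 1 (x, t)" by (simp_all add: x1 t1)
  show "lap_M \<alpha> u = (\<lambda>p. (E 2 0 p - \<alpha> / fst p * E 1 0 p) + \<bar>fst p\<bar> powr (2 * \<alpha>) * E 0 2 p)"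
    unfolding lap_M_def x1 t1 x2 t2 by (auto simp: fun_eq_iff)
qed

lemma circle_FTC:
  fixes F f :: "real \<Rightarrow> real"
  assumes "\<And>t. (F has_real_derivative f t) (at t)" "\<And>t. isCont f t" "F (2 * pi) = F 0"
  shows "(LINT t|lborel. indicator {0..<2 * pi} t * f t) = 0"
proof -
  have hb: "has_bochner_integral lborel (\<lambda>t. f t * indicator {0..2 * pi} t) (F (2 * pi) - F 0)"
    by (rule has_bochner_integral_FTC_Icc_real) (use assms in auto)
  have [measurable]: "f \<in> borel_measurable borel"
    using assms(2) by (intro borel_measurable_continuous_onI continuous_at_imp_continuous_on ballI)
  have ae: "AE t in lborel. indicator {0..<2 * pi} t * f t = f t * indicator {0..2 * pi} t"
    using AE_lborel_singleton[of "2 * pi"] by eventually_elim (auto simp: indicator_def)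
  have "(LINT t|lborel. indicator {0..<2 * pi} t * f t) = (LINT t|lborel. f t * indicator {0..2 * pi} t)"
    by (rule integral_cong_AE[OF _ _ ae]) auto
  also have "\<dots> = 0" using hb assms(3) by (simp add: has_bochner_integral_iff)
  finally show ?thesis .
qed

lemma circle_integrable:
  fixes f :: "real \<Rightarrow> real"
  assumes "\<And>t. isCont f t" shows "integrable lborel (\<lambda>t. indicator {0..<2 * pi} t * f t)"
proof -
  have "integrable lborel (\<lambda>t. f t * indicator {0..2 * pi} t)"
    by (rule borel_integrable_atLeastAtMost) (use assms in auto)
  from integrable_mult_indicator[OF _ this, of "{0..<2 * pi}"]
  have "integrable lborel (\<lambda>t. indicator {0..<2 * pi} t * (f t * indicator {0..2 * pi} t))" by simp
  also have "(\<lambda>t. indicator {0..<2 * pi} t * (f t * indicator {0..2 * pi} t)) = (\<lambda>t. indicator {0..<2 * pi} t * f t)"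
    by (auto simp: fun_eq_iff indicator_def)
  finally show ?thesis .
qed

section \<open>The Dirichlet form\<close>

definition grad_x :: "(real \<times> real \<Rightarrow> real) \<Rightarrow> real \<times> real \<Rightarrow> real" where
  "grad_x u p = deriv (\<lambda>r. u (r, snd p)) (fst p)"

text \<open>The component of the gradient along the unit vector field in the angular direction; the
  factor \<open>|x| powr (2 * \<alpha>)\<close> of the Laplacian is thereby split evenly between
  both arguments.\<close>

definition grad_t :: "real \<Rightarrow> (real \<times> real \<Rightarrow> real) \<Rightarrow> real \<times> real \<Rightarrow> real" where
  "grad_t \<alpha> u p = \<bar>fst p\<bar> powr \<alpha> * deriv (\<lambda>r. u (fst p, r)) (snd p)"

lemma Cc_M_L2:
  assumes "u \<in> Cc_M" shows "L2 (omega_M \<alpha>) u" "L2 (omega_M \<alpha>) (lap_M \<alpha> u)"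
proof -
  obtain E a b where E: "E 0 0 = u"
    "\<And>i j x t. ((\<lambda>s. E i j (s, t)) has_real_derivative E (Suc i) j (x, t)) (at x)"
    "\<And>i j x t. ((\<lambda>s. E i j (x, s)) has_real_derivative E i (Suc j) (x, t)) (at t)"
    "\<And>i j p. isCont (E i j) p" "0 < a" "a < b"
    "\<And>i j x t. \<bar>x\<bar> < a \<or> b < \<bar>x\<bar> \<Longrightarrow> E i j (x, t) = 0" using assms by (rule Cc_ME) blast
  have "L2 (omega_M \<alpha>) (E 0 0)" by (rule L2_omega_M_annular[OF E(5) E(4)]) (rule E(7))
  then show "L2 (omega_M \<alpha>) u" using E(1) by simp
  show "L2 (omega_M \<alpha>) (lap_M \<alpha> u)" unfolding lap_M_eq(3)[OF E(1-3)]
  proof (rule L2_omega_M_annular[OF E(5), of _ b])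
    show "isCont (\<lambda>p. (E 2 0 p - \<alpha> / fst p * E 1 0 p) + \<bar>fst p\<bar> powr (2 * \<alpha>) * E 0 2 p) (x, t)" if "x \<noteq> 0" for x t
      using isCont_fst_comp[OF isCont_const_divide[OF that], of t \<alpha>] isCont_fst_comp[OF isCont_abs_powr'[OF that], of t "2 * \<alpha>"]
      by (intro continuous_add continuous_diff continuous_mult E(4))
  qed (use E(7) in auto)
qed

text \<open>The radial part \<open>A\<close> and the angular part \<open>B\<close> of the Laplacian
  are separately square integrable, so each can be integrated by parts slicewise in its own
  variable. The resulting form is symmetric and nonpositive by inspection.\<close>

lemma M_energy:
  assumes "u \<in> Cc_M" "w \<in> Cc_M"
  shows "L2_inner (omega_M \<alpha>) (lap_M \<alpha> u) w
    = - L2_inner (omega_M \<alpha>) (grad_x u) (grad_x w) - L2_inner (omega_M \<alpha>) (grad_t \<alpha> u) (grad_t \<alpha> w)"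
proof -
  obtain E a b where E: "E 0 0 = u"
    "\<And>i j x t. ((\<lambda>s. E i j (s, t)) has_real_derivative E (Suc i) j (x, t)) (at x)"
    "\<And>i j x t. ((\<lambda>s. E i j (x, s)) has_real_derivative E i (Suc j) (x, t)) (at t)"
    "\<And>i j p. isCont (E i j) p" "0 < a" "a < b"
    "\<And>i j x t. \<bar>x\<bar> < a \<or> b < \<bar>x\<bar> \<Longrightarrow> E i j (x, t) = 0"
    "\<And>i j x t. E i j (x, t + 2 * pi) = E i j (x, t)" using assms(1) by (rule Cc_ME) blast
  obtain H c d where H: "H 0 0 = w"
    "\<And>i j x t. ((\<lambda>s. H i j (s, t)) has_real_derivative H (Suc i) j (x, t)) (at x)"
    "\<And>i j x t. ((\<lambda>s. H i j (x, s)) has_real_derivative H i (Suc j) (x, t)) (at t)"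
    "\<And>i j p. isCont (H i j) p" "0 < c" "c < d"
    "\<And>i j x t. \<bar>x\<bar> < c \<or> d < \<bar>x\<bar> \<Longrightarrow> H i j (x, t) = 0"
    "\<And>i j x t. H i j (x, t + 2 * pi) = H i j (x, t)" using assms(2) by (rule Cc_ME) blast
  define A where "A p = E 2 0 p - \<alpha> / fst p * E 1 0 p" for p
  define B where "B p = \<bar>fst p\<bar> powr (2 * \<alpha>) * E 0 2 p" for p
  have cx: "isCont (\<lambda>p::real \<times> real. \<alpha> / fst p) (x, t)" "isCont (\<lambda>p::real \<times> real. \<bar>fst p\<bar> powr s) (x, t)"
    if "x \<noteq> 0" for x t s
    using isCont_fst_comp[OF isCont_const_divide[OF that], of t \<alpha>] isCont_fst_comp[OF isCont_abs_powr'[OF that], of t s] .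
  have LA: "L2 (omega_M \<alpha>) A"
  proof (rule L2_omega_M_annular[OF E(5), of _ b])
    show "isCont A (x, t)" if "x \<noteq> 0" for x t unfolding A_def by (intro continuous_diff continuous_mult E(4) cx that)
  qed (use E(7) in \<open>auto simp: A_def\<close>)
  have LB: "L2 (omega_M \<alpha>) B"
  proof (rule L2_omega_M_annular[OF E(5), of _ b])
    show "isCont B (x, t)" if "x \<noteq> 0" for x t unfolding B_def by (intro continuous_mult E(4) cx that)
  qed (use E(7) in \<open>auto simp: B_def\<close>)
  have Lw: "L2 (omega_M \<alpha>) w" by (rule Cc_M_L2[OF assms(2)])
  have gx: "grad_x u = E 1 0" "grad_x w = H 1 0"
    by (auto simp: fun_eq_iff grad_x_def lap_M_eq(1)[OF E(1-3)] lap_M_eq(1)[OF H(1-3)])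
  have gt: "grad_t \<alpha> u = (\<lambda>p. \<bar>fst p\<bar> powr \<alpha> * E 0 1 p)" "grad_t \<alpha> w = (\<lambda>p. \<bar>fst p\<bar> powr \<alpha> * H 0 1 p)"
    by (auto simp: fun_eq_iff grad_t_def lap_M_eq(2)[OF E(1-3)] lap_M_eq(2)[OF H(1-3)])
  have Lgx: "L2 (omega_M \<alpha>) (grad_x u)" "L2 (omega_M \<alpha>) (grad_x w)"
    unfolding gx by (rule L2_omega_M_annular[OF E(5,4,7)] L2_omega_M_annular[OF H(5,4,7)]; assumption)+
  have Lgt: "L2 (omega_M \<alpha>) (grad_t \<alpha> u)" "L2 (omega_M \<alpha>) (grad_t \<alpha> w)"
  proof -
    show "L2 (omega_M \<alpha>) (grad_t \<alpha> u)" unfolding gt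
    proof (rule L2_omega_M_annular[OF E(5), of _ b])
      show "isCont (\<lambda>p. \<bar>fst p\<bar> powr \<alpha> * E 0 1 p) (x, t)" if "x \<noteq> 0" for x t
        by (intro continuous_mult E(4) cx that)
    qed (use E(7) in auto)
    show "L2 (omega_M \<alpha>) (grad_t \<alpha> w)" unfolding gt
    proof (rule L2_omega_M_annular[OF H(5), of _ d])
      show "isCont (\<lambda>p. \<bar>fst p\<bar> powr \<alpha> * H 0 1 p) (x, t)" if "x \<noteq> 0" for x t
        by (intro continuous_mult H(4) cx that)
    qed (use H(7) in auto)
  qed
  have comp: "isCont (\<lambda>x. E i j (x, t)) x" "isCont (\<lambda>t. E i j (x, t)) t"
    "isCont (\<lambda>x. H i j (x, t)) x" "isCont (\<lambda>t. H i j (x, t)) t" for i j x t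
    by (rule DERIV_isCont[OF E(2)] DERIV_isCont[OF E(3)] DERIV_isCont[OF H(2)] DERIV_isCont[OF H(3)])+
  have radial: "(LINT x|lborel. \<bar>x\<bar> powr (- \<alpha>) * (A (x, t) * w (x, t)))
      = - (LINT x|lborel. \<bar>x\<bar> powr (- \<alpha>) * (grad_x u (x, t) * grad_x w (x, t)))" for t
    unfolding gx A_def fst_conv
    by (rule radial_energy[OF E(5), of "\<lambda>x. E 0 0 (x, t)" _ _ _ _ b])
      (use E(2)[of 0 0 t] E(2)[of 1 0 t] H(2)[of 0 0 t] comp E(7) in \<open>simp_all add: numeral_2_eq_2 H(1)[symmetric]\<close>)
  have "L2_inner (omega_M \<alpha>) A w = - L2_inner (omega_M \<alpha>) (grad_x u) (grad_x w)"
    unfolding L2_inner_omega_M_t[OF LA Lw] L2_inner_omega_M_t[OF Lgx] radial by simp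
  moreover have angular: "(LINT t|lborel. indicator {0..<2 * pi} t * (B (x, t) * w (x, t)))
      = - (LINT t|lborel. indicator {0..<2 * pi} t * (grad_t \<alpha> u (x, t) * grad_t \<alpha> w (x, t)))" for x
  proof -
    \<comment> \<open>Periodicity of both factors cancels the boundary terms at 0 and
      \<open>2 * pi\<close>.\<close>
    have "E 0 1 (x, 2 * pi) * H 0 0 (x, 2 * pi) = E 0 1 (x, 0) * H 0 0 (x, 0)"
      using E(8)[of 0 1 x 0] H(8)[of 0 0 x 0] by simp
    then have "(LINT t|lborel. indicator {0..<2 * pi} t * (E 0 2 (x, t) * H 0 0 (x, t) + E 0 1 (x, t) * H 0 1 (x, t))) = 0"
    proof (intro circle_FTC[of "\<lambda>t. E 0 1 (x, t) * H 0 0 (x, t)"])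
      show "((\<lambda>t. E 0 1 (x, t) * H 0 0 (x, t)) has_real_derivative
          E 0 2 (x, t) * H 0 0 (x, t) + E 0 1 (x, t) * H 0 1 (x, t)) (at t)" for t
        using DERIV_mult[OF E(3)[of 0 1 x t] H(3)[of 0 0 x t]] by (simp add: numeral_2_eq_2 algebra_simps)
    qed (intro continuous_add continuous_mult comp)
    then have "(LINT t|lborel. indicator {0..<2 * pi} t * (E 0 2 (x, t) * H 0 0 (x, t)))
        = - (LINT t|lborel. indicator {0..<2 * pi} t * (E 0 1 (x, t) * H 0 1 (x, t)))"
      unfolding distrib_left
      by (subst (asm) Bochner_Integration.integral_add)
        (auto intro!: circle_integrable continuous_mult comp)
    moreover have "(LINT t|lborel. indicator {0..<2 * pi} t * (B (x, t) * w (x, t)))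
        = \<bar>x\<bar> powr (2 * \<alpha>) * (LINT t|lborel. indicator {0..<2 * pi} t * (E 0 2 (x, t) * H 0 0 (x, t)))"
      by (subst integral_mult_right_zero[symmetric]) (simp add: B_def H(1) mult_ac)
    moreover have "(LINT t|lborel. indicator {0..<2 * pi} t * (grad_t \<alpha> u (x, t) * grad_t \<alpha> w (x, t)))
        = \<bar>x\<bar> powr (2 * \<alpha>) * (LINT t|lborel. indicator {0..<2 * pi} t * (E 0 1 (x, t) * H 0 1 (x, t)))"
    proof -
      have "\<bar>x\<bar> powr (2 * \<alpha>) = \<bar>x\<bar> powr \<alpha> * \<bar>x\<bar> powr \<alpha>" by (simp add: powr_add[symmetric])
      then show ?thesis
        by (subst integral_mult_right_zero[symmetric]) (simp add: gt mult_ac)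
    qed
    ultimately show ?thesis by simp
  qed
  have "L2_inner (omega_M \<alpha>) B w = - L2_inner (omega_M \<alpha>) (grad_t \<alpha> u) (grad_t \<alpha> w)"
    unfolding L2_inner_omega_M_x[OF LB Lw] L2_inner_omega_M_x[OF Lgt] angular by simp
  moreover have "L2_inner (omega_M \<alpha>) (lap_M \<alpha> u) w = L2_inner (omega_M \<alpha>) A w + L2_inner (omega_M \<alpha>) B w"
    unfolding lap_M_eq(3)[OF E(1-3)] using L2_inner_add_left[OF LA LB Lw] by (simp add: A_def B_def)
  ultimately show ?thesis by simp
qed

lemma smooth2_on_add_cmult:
  assumes "smooth2_on S u" "smooth2_on S v" shows "smooth2_on S (\<lambda>p. u p + c * v p)"
proof -
  obtain D where D: "D 0 0 = u" "\<And>i j. continuous_on S (D i j)"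
    "\<And>i j x t. (x, t) \<in> S \<Longrightarrow> ((\<lambda>s. D i j (s, t)) has_real_derivative D (Suc i) j (x, t)) (at x)"
    "\<And>i j x t. (x, t) \<in> S \<Longrightarrow> ((\<lambda>s. D i j (x, s)) has_real_derivative D i (Suc j) (x, t)) (at t)"
    using assms(1) unfolding smooth2_on_def by auto
  obtain E where E: "E 0 0 = v" "\<And>i j. continuous_on S (E i j)"
    "\<And>i j x t. (x, t) \<in> S \<Longrightarrow> ((\<lambda>s. E i j (s, t)) has_real_derivative E (Suc i) j (x, t)) (at x)"
    "\<And>i j x t. (x, t) \<in> S \<Longrightarrow> ((\<lambda>s. E i j (x, s)) has_real_derivative E i (Suc j) (x, t)) (at t)"
    using assms(2) unfolding smooth2_on_def by auto
  show ?thesis unfolding smooth2_on_def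
    by (intro exI[of _ "\<lambda>i j p. D i j p + c * E i j p"] conjI allI impI)
      (auto simp: D(1) E(1) intro!: continuous_intros D(2) E(2) DERIV_add DERIV_cmult D(3,4) E(3,4))
qed

lemma Cc_M_add_cmult:
  assumes "u \<in> Cc_M" "v \<in> Cc_M" shows "(\<lambda>p. u p + c * v p) \<in> Cc_M"
proof -
  obtain a b where 1: "smooth2_on {p. fst p \<noteq> 0} u" "\<forall>x t. u (x, t + 2 * pi) = u (x, t)" "0 < a"
      "\<forall>x t. \<bar>x\<bar> < a \<or> b < \<bar>x\<bar> \<longrightarrow> u (x, t) = 0"
    using assms(1) unfolding Cc_M_def by blast
  obtain a' b' where 2: "smooth2_on {p. fst p \<noteq> 0} v" "\<forall>x t. v (x, t + 2 * pi) = v (x, t)" "0 < a'"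
      "\<forall>x t. \<bar>x\<bar> < a' \<or> b' < \<bar>x\<bar> \<longrightarrow> v (x, t) = 0"
    using assms(2) unfolding Cc_M_def by blast
  have "0 < min a a' \<and> (\<forall>x t. \<bar>x\<bar> < min a a' \<or> max b b' < \<bar>x\<bar> \<longrightarrow> u (x, t) + c * v (x, t) = 0)"
    using 1 2 by auto
  moreover have "\<forall>x t. u (x, t + 2 * pi) + c * v (x, t + 2 * pi) = u (x, t) + c * v (x, t)" using 1(2) 2(2) by simp
  ultimately show ?thesis using smooth2_on_add_cmult[OF 1(1) 2(1)] unfolding Cc_M_def by blast
qed

lemma lap_M_add_cmult:
  assumes "u \<in> Cc_M" "v \<in> Cc_M"
  shows "lap_M \<alpha> (\<lambda>p. u p + c * v p) = (\<lambda>p. lap_M \<alpha> u p + c * lap_M \<alpha> v p)"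
proof -
  obtain E where E: "E 0 0 = u"
    "\<And>i j x t. ((\<lambda>s. E i j (s, t)) has_real_derivative E (Suc i) j (x, t)) (at x)"
    "\<And>i j x t. ((\<lambda>s. E i j (x, s)) has_real_derivative E i (Suc j) (x, t)) (at t)"
    using assms(1) by (rule Cc_ME) blast
  obtain H where H: "H 0 0 = v"
    "\<And>i j x t. ((\<lambda>s. H i j (s, t)) has_real_derivative H (Suc i) j (x, t)) (at x)"
    "\<And>i j x t. ((\<lambda>s. H i j (x, s)) has_real_derivative H i (Suc j) (x, t)) (at t)"
    using assms(2) by (rule Cc_ME) blast
  have eq: "lap_M \<alpha> (\<lambda>p. u p + c * v p) = (\<lambda>p. ((E 2 0 p + c * H 2 0 p) - \<alpha> / fst p * (E 1 0 p + c * H 1 0 p))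
      + \<bar>fst p\<bar> powr (2 * \<alpha>) * (E 0 2 p + c * H 0 2 p))"
    by (rule lap_M_eq(3)[of "\<lambda>i j p. E i j p + c * H i j p"])
      (auto simp: E(1) H(1) intro!: DERIV_add DERIV_cmult E(2,3) H(2,3))
  show ?thesis unfolding eq lap_M_eq(3)[OF E] lap_M_eq(3)[OF H] by (simp add: algebra_simps)
qed

text \<open>With \<open>c = 0\<close> and \<open>c = - pi / 2\<close> the angular factors are \<open>cos (k * t)\<close> and \<open>sin (k * t)\<close>.\<close>
lemma mode_Cc_M:
  fixes k :: int and c :: real
  assumes \<phi>: "\<phi> \<in> Cc_line"
  shows "(\<lambda>p. \<phi> (fst p) * cos (of_int k * snd p + c)) \<in> Cc_M"
    "lap_M \<alpha> (\<lambda>p. \<phi> (fst p) * cos (of_int k * snd p + c))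
      = (\<lambda>p. lap_k \<alpha> k \<phi> (fst p) * cos (of_int k * snd p + c))"
proof -
  obtain D a b where D: "D 0 = \<phi>" "\<And>n x. (D n has_real_derivative D (Suc n) x) (at x)" "0 < a" "a < b"
    "\<And>n x. \<bar>x\<bar> < a \<or> b < \<bar>x\<bar> \<Longrightarrow> D n x = 0" using \<phi> by (rule Cc_lineE) blast
  \<comment> \<open>The derivative of order \<open>j\<close> of \<open>cos (k * t + c)\<close>: each
    differentiation multiplies by \<open>k\<close> and advances the phase by
    \<open>pi / 2\<close>.\<close>
  define e where "e j t = of_int k ^ j * cos (of_int k * t + c + real j * (pi / 2))" for j :: nat and t :: real
  have e: "(e j has_real_derivative e (Suc j) t) (at t)" for j t
  proof -
    have "of_int k * t + c + real (Suc j) * (pi / 2) = (of_int k * t + c + real j * (pi / 2)) + pi / 2"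
      by (simp add: algebra_simps add_divide_distrib)
    moreover have "cos (y + pi / 2) = - sin y" for y :: real by (simp add: cos_add)
    ultimately have "cos (of_int k * t + c + real (Suc j) * (pi / 2)) = - sin (of_int k * t + c + real j * (pi / 2))"
      by (simp only:)
    then show ?thesis unfolding e_def[abs_def]
      by (auto intro!: derivative_eq_intros)
  qed
  define E where "E i j p = D i (fst p) * e j (snd p)" for i j and p :: "real \<times> real"
  have E0: "E 0 0 = (\<lambda>p. \<phi> (fst p) * cos (of_int k * snd p + c))"
    by (simp add: E_def e_def D(1) fun_eq_iff)
  have Ex: "((\<lambda>s. E i j (s, t)) has_real_derivative E (Suc i) j (x, t)) (at x)" for i j x t
    unfolding E_def using DERIV_mult[OF D(2) DERIV_const[of "e j t"]] by simp
  have Et: "((\<lambda>s. E i j (x, s)) has_real_derivative E i (Suc j) (x, t)) (at t)" for i j x t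
    unfolding E_def using DERIV_cmult[OF e] by simp
  have cont: "continuous_on S (E i j)" for i j S
  proof -
    have "continuous_on UNIV (D i)" "continuous_on UNIV (e j)"
      by (auto intro!: continuous_at_imp_continuous_on DERIV_isCont[OF D(2)] DERIV_isCont[OF e])
    moreover have "continuous_on S fst" "continuous_on S snd" by (intro continuous_intros)+
    ultimately have "continuous_on S (\<lambda>p. D i (fst p))" "continuous_on S (\<lambda>p. e j (snd p))"
      using continuous_on_compose2[of UNIV "D i" S fst] continuous_on_compose2[of UNIV "e j" S snd] by auto
    then show ?thesis unfolding E_def by (rule continuous_on_mult)
  qed
  have smooth: "smooth2_on {p. fst p \<noteq> 0} (E 0 0)" unfolding smooth2_on_def
    by (rule exI[of _ E]) (use Ex Et cont in auto)
  have "cos (of_int k * (t + 2 * pi) + c) = cos (of_int k * t + c)" for t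
  proof -
    have "of_int k * (t + 2 * pi) + c = (of_int k * t + c) + 2 * pi * of_int k" by (simp add: algebra_simps)
    then show ?thesis by (simp only: cos_add cos_int_2pin sin_int_2pin) simp
  qed
  then have "\<forall>x t. E 0 0 (x, t + 2 * pi) = E 0 0 (x, t)" by (simp add: E0)
  moreover have "0 < a \<and> (\<forall>x t. \<bar>x\<bar> < a \<or> b < \<bar>x\<bar> \<longrightarrow> E 0 0 (x, t) = 0)" using D(3,5) by (auto simp: E_def)
  ultimately have "E 0 0 \<in> Cc_M" using smooth unfolding Cc_M_def by blast
  then show "(\<lambda>p. \<phi> (fst p) * cos (of_int k * snd p + c)) \<in> Cc_M" unfolding E0 .
  have e2: "e 2 t = - ((of_int k)\<^sup>2 * e 0 t)" for t by (simp add: e_def)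
  show "lap_M \<alpha> (\<lambda>p. \<phi> (fst p) * cos (of_int k * snd p + c))
      = (\<lambda>p. lap_k \<alpha> k \<phi> (fst p) * cos (of_int k * snd p + c))"
    unfolding lap_M_eq(3)[OF E0 Ex Et] Cc_line_lap_k(2)[OF D(1,2)]
    by (simp add: fun_eq_iff E_def e2) (simp add: e_def algebra_simps)
qed

section \<open>Fourier coefficients in the angle\<close>

definition circ :: "real measure" where
  "circ = density lborel (\<lambda>t. ennreal (indicator {0..<2 * pi} t))"

lemma L2_circ_iff:
  "L2 circ f \<longleftrightarrow> f \<in> borel_measurable borel \<and> integrable lborel (\<lambda>t. indicator {0..<2 * pi} t * (f t)\<^sup>2)"
  unfolding L2_def circ_def by (auto simp: integrable_real_density)

lemma circ_integrable:
  assumes "L2 circ f" "L2 circ g" shows "integrable lborel (\<lambda>t. indicator {0..<2 * pi} t * (f t * g t))"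
  using L2_integrable_mult[OF assms] assms unfolding circ_def
  by (subst (asm) integrable_real_density) (auto simp: L2_circ_iff[unfolded circ_def])

lemma L2_inner_circ:
  assumes "L2 circ f" "L2 circ g"
  shows "L2_inner circ f g = (LINT t|lborel. indicator {0..<2 * pi} t * (f t * g t))"
  using assms unfolding L2_inner_def L2_circ_iff unfolding circ_def by (subst integral_real_density) auto

lemma slice_measurable:
  "h \<in> borel_measurable (borel :: (real \<times> real) measure) \<Longrightarrow> (\<lambda>t. h (x, t)) \<in> borel_measurable (borel :: real measure)"
proof -
  assume "h \<in> borel_measurable (borel :: (real \<times> real) measure)"
  moreover have "(\<lambda>t::real. (x, t)) \<in> borel \<rightarrow>\<^sub>M (borel :: (real \<times> real) measure)"
    by (intro borel_measurable_continuous_onI continuous_intros)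
  ultimately show ?thesis by measurable
qed

lemma slice_integral_measurable:
  fixes h :: "real \<times> real \<Rightarrow> real"
  assumes "h \<in> borel_measurable borel"
  shows "(\<lambda>x. LINT t|lborel. h (x, t)) \<in> borel_measurable borel"
proof -
  have "(\<lambda>(x, t). h (x, t)) \<in> borel_measurable (borel \<Otimes>\<^sub>M lborel)"
    using assms unfolding measurable_cong_sets[OF sets_pair_measure_cong[OF refl sets_lborel] refl] borel_prod by simp
  then show ?thesis by (rule lborel.borel_measurable_lebesgue_integral)
qed

lemma AE_slice_L2:
  assumes "L2 (omega_M \<alpha>) h"
  shows "AE x in lborel. x \<noteq> 0 \<longrightarrow> L2 circ (\<lambda>t. h (x, t))"
proof -
  have m: "h \<in> borel_measurable borel" and i: "integrable (lborel \<Otimes>\<^sub>M lborel) (\<lambda>p. weight \<alpha> p * (h p)\<^sup>2)"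
    using assms by (auto simp: L2_omega_M_iff lborel_prod)
  from lborel_pair.AE_integrable_fst'[OF i] show ?thesis
  proof eventually_elim
    case (elim x)
    show ?case
    proof
      assume x: "x \<noteq> 0"
      have "integrable lborel (\<lambda>t. \<bar>x\<bar> powr \<alpha> * (weight \<alpha> (x, t) * (h (x, t))\<^sup>2))" using elim by simp
      also have "(\<lambda>t. \<bar>x\<bar> powr \<alpha> * (weight \<alpha> (x, t) * (h (x, t))\<^sup>2)) = (\<lambda>t. indicator {0..<2 * pi} t * (h (x, t))\<^sup>2)"
      proof
        fix t
        have "\<bar>x\<bar> powr \<alpha> * \<bar>x\<bar> powr (- \<alpha>) = 1" using x by (simp add: powr_add[symmetric])
        moreover have "\<bar>x\<bar> powr \<alpha> * (weight \<alpha> (x, t) * (h (x, t))\<^sup>2)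
            = (\<bar>x\<bar> powr \<alpha> * \<bar>x\<bar> powr (- \<alpha>)) * (indicator {0..<2 * pi} t * (h (x, t))\<^sup>2)"
          by (simp add: weight_def mult_ac)
        ultimately show "\<bar>x\<bar> powr \<alpha> * (weight \<alpha> (x, t) * (h (x, t))\<^sup>2) = indicator {0..<2 * pi} t * (h (x, t))\<^sup>2" by simp
      qed
      finally show "L2 circ (\<lambda>t. h (x, t))" using slice_measurable[OF m] by (simp add: L2_circ_iff)
    qed
  qed
qed

text \<open>Unnormalised, because only its vanishing matters; the phase \<open>c\<close> treats
  cosine and sine coefficients at once.\<close>

definition fourier_coeff :: "int \<Rightarrow> real \<Rightarrow> (real \<times> real \<Rightarrow> real) \<Rightarrow> real \<Rightarrow> real" where
  "fourier_coeff k c h x = (LINT t|lborel. indicator {0..<2 * pi} t * (cos (of_int k * t + c) * h (x, t)))"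

lemma L2_circ_cos: "L2 circ (\<lambda>t. cos (k * t + c))"
  unfolding L2_circ_iff
  by (auto intro!: circle_integrable continuous_intros)

text \<open>Cauchy--Schwarz on the slice bounds the squared coefficient by \<open>N\<close>, the
  squared norm of the angular factor, times the squared slice norm of \<open>h\<close>, which is
  integrable against the weight by Fubini.\<close>

lemma fourier_coeff_L2:
  assumes h: "L2 (omega_M \<alpha>) h" shows "L2 (omega_line \<alpha>) (fourier_coeff k c h)"
  unfolding L2_omega_line_iff
proof
  have m [measurable]: "h \<in> borel_measurable borel" using h by (simp add: L2_omega_M_iff)
  have "(\<lambda>p. indicator {0..<2 * pi} (snd p) * (cos (of_int k * snd p + c) * h p)) \<in> borel_measurable borel"
    by measurable
  from slice_integral_measurable[OF this] show mc: "fourier_coeff k c h \<in> borel_measurable borel"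
    by (simp add: fourier_coeff_def[abs_def])
  have i: "integrable (lborel \<Otimes>\<^sub>M lborel) (\<lambda>p. weight \<alpha> p * (h p)\<^sup>2)"
    using h by (simp add: L2_omega_M_iff lborel_prod)
  define N where "N = L2_inner circ (\<lambda>t. cos (of_int k * t + c)) (\<lambda>t. cos (of_int k * t + c))"
  show "integrable lborel (\<lambda>x. \<bar>x\<bar> powr (- \<alpha>) * (fourier_coeff k c h x)\<^sup>2)"
  proof (rule Bochner_Integration.integrable_bound)
    show "integrable lborel (\<lambda>x. N * (LINT t|lborel. weight \<alpha> (x, t) * (h (x, t))\<^sup>2))"
      using lborel_pair.integrable_fst'[OF i] by simp
    show "(\<lambda>x. \<bar>x\<bar> powr (- \<alpha>) * (fourier_coeff k c h x)\<^sup>2) \<in> borel_measurable lborel" using mc by simp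
    show "AE x in lborel. norm (\<bar>x\<bar> powr (- \<alpha>) * (fourier_coeff k c h x)\<^sup>2)
        \<le> norm (N * (LINT t|lborel. weight \<alpha> (x, t) * (h (x, t))\<^sup>2))"
      using AE_slice_L2[OF h]
    proof eventually_elim
      case (elim x)
      show ?case
      proof (cases "x = 0")
        case False
        then have Lx: "L2 circ (\<lambda>t. h (x, t))" using elim by simp
        have "(fourier_coeff k c h x)\<^sup>2 \<le> N * L2_inner circ (\<lambda>t. h (x, t)) (\<lambda>t. h (x, t))"
          using L2_Cauchy_Schwarz[OF L2_circ_cos[of "of_int k" c] Lx]
          unfolding N_def L2_inner_circ[OF L2_circ_cos Lx] fourier_coeff_def .
        then have "\<bar>x\<bar> powr (- \<alpha>) * (fourier_coeff k c h x)\<^sup>2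
            \<le> \<bar>x\<bar> powr (- \<alpha>) * (N * L2_inner circ (\<lambda>t. h (x, t)) (\<lambda>t. h (x, t)))" by (intro mult_left_mono) auto
        also have "\<dots> = N * (\<bar>x\<bar> powr (- \<alpha>) * (LINT t|lborel. indicator {0..<2 * pi} t * (h (x, t) * h (x, t))))"
          by (simp add: L2_inner_circ[OF Lx Lx])
        also have "\<bar>x\<bar> powr (- \<alpha>) * (LINT t|lborel. indicator {0..<2 * pi} t * (h (x, t) * h (x, t)))
            = (LINT t|lborel. weight \<alpha> (x, t) * (h (x, t))\<^sup>2)"
          by (subst integral_mult_right_zero[symmetric]) (simp add: weight_def power2_eq_square mult_ac)
        finally show ?thesis by simp
      qed simp
    qed
  qed
qed

text \<open>Taking a coefficient is adjoint to multiplying a radial function by the mode. This moves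
  the weak equation from the cylinder to the line.\<close>

lemma fourier_coeff_inner:
  assumes h: "L2 (omega_M \<alpha>) h" and \<phi>: "L2 (omega_line \<alpha>) \<phi>"
    and L: "L2 (omega_M \<alpha>) (\<lambda>p. \<phi> (fst p) * cos (of_int k * snd p + c))"
  shows "L2_inner (omega_line \<alpha>) \<phi> (fourier_coeff k c h)
    = L2_inner (omega_M \<alpha>) (\<lambda>p. \<phi> (fst p) * cos (of_int k * snd p + c)) h"
proof -
  have "(LINT t|lborel. indicator {0..<2 * pi} t * ((\<phi> x * cos (of_int k * t + c)) * h (x, t))) = \<phi> x * fourier_coeff k c h x" for x
    unfolding fourier_coeff_def by (subst integral_mult_right_zero[symmetric]) (simp add: mult_ac)
  then show ?thesis
    unfolding L2_inner_omega_M_x[OF L h]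
    using \<phi> fourier_coeff_L2[OF h, of k c] by (simp add: L2_inner_omega_line L2_omega_line_iff)
qed

text \<open>Tested against single modes, the weak equation for \<open>h\<close> becomes the weak
  equation for each coefficient, so \<open>line_kernel\<close> annihilates all of them. Completeness
  of the trigonometric system on almost every circle then kills \<open>h\<close>.\<close>

lemma M_kernel:
  assumes lp: "\<And>k. limit_point \<alpha> k" and h: "L2 (omega_M \<alpha>) h"
    and weak: "\<And>u. u \<in> Cc_M \<Longrightarrow> L2_inner (omega_M \<alpha>) (lap_M \<alpha> u) h = L2_inner (omega_M \<alpha>) u h"
  shows "AE p in omega_M \<alpha>. h p = 0"
proof -
  have m [measurable]: "h \<in> borel_measurable borel" using h by (simp add: L2_omega_M_iff)
  have coeff: "AE x in lborel. x \<noteq> 0 \<longrightarrow> fourier_coeff k c h x = 0" for k c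
  proof (rule line_kernel[OF lp fourier_coeff_L2[OF h]])
    fix \<phi> assume \<phi>: "\<phi> \<in> Cc_line"
    let ?u = "\<lambda>p. \<phi> (fst p) * cos (of_int k * snd p + c)"
    have u: "?u \<in> Cc_M" by (rule mode_Cc_M[OF \<phi>])
    have Llap: "L2 (omega_M \<alpha>) (\<lambda>p. lap_k \<alpha> k \<phi> (fst p) * cos (of_int k * snd p + c))"
      using Cc_M_L2(2)[OF u, of \<alpha>] unfolding mode_Cc_M(2)[OF \<phi>] .
    show "L2_inner (omega_line \<alpha>) (lap_k \<alpha> k \<phi>) (fourier_coeff k c h) = L2_inner (omega_line \<alpha>) \<phi> (fourier_coeff k c h)"
      unfolding fourier_coeff_inner[OF h Cc_line_L2(2)[OF \<phi>] Llap] fourier_coeff_inner[OF h Cc_line_L2(1)[OF \<phi>] Cc_M_L2(1)[OF u]]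
      using weak[OF u] unfolding mode_Cc_M(2)[OF \<phi>] .
  qed
  \<comment> \<open>The frequencies are countable, so the exceptional null sets merge into one
    before a slice is fixed.\<close>
  have "AE x in lborel. \<forall>k. x \<noteq> 0 \<longrightarrow> fourier_coeff k 0 h x = 0"
    by (intro AE_all_countable[THEN iffD2] allI coeff)
  moreover have "AE x in lborel. \<forall>k. x \<noteq> 0 \<longrightarrow> fourier_coeff k (- (pi / 2)) h x = 0"
    by (intro AE_all_countable[THEN iffD2] allI coeff)
  moreover note AE_slice_L2[OF h] AE_lborel_singleton[of "0::real"]
  ultimately have "AE x in lborel. AE t in lborel. indicator {0..<2 * pi} t * h (x, t) = 0"
  proof eventually_elim
    case (elim x)
    then have L: "L2 circ (\<lambda>t. h (x, t))" by simp
    show ?case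
    proof (rule fourier_complete)
      show "integrable lborel (\<lambda>t. indicator {0..<2 * pi} t * h (x, t))"
        using circ_integrable[OF L2_circ_cos[of 0 0] L] by simp
      have "cos (of_int k * t + - (pi / 2)) = sin (of_int k * t)" for k :: int and t
        by (simp add: cos_diff)
      then show "(LINT t|lborel. indicator {0..<2 * pi} t * h (x, t) * sin (of_int k * t)) = 0" for k :: int
        using elim by (simp add: fourier_coeff_def mult_ac)
      show "(LINT t|lborel. indicator {0..<2 * pi} t * h (x, t) * cos (of_int k * t)) = 0" for k :: int
        using elim by (simp add: fourier_coeff_def mult_ac)
    qed
  qed
  then have ae: "AE x in lborel. AE t in lborel. indicator {0..<2 * pi} (snd (x, t)) * h (x, t) = 0" by simp
  have "{p \<in> space (lborel \<Otimes>\<^sub>M lborel). indicator {0..<2 * pi} (snd p) * h p = 0} \<in> sets (lborel \<Otimes>\<^sub>M lborel)"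
    unfolding lborel_prod by measurable
  from lborel_pair.AE_pair_measure[OF this ae]
  have "AE p in lborel. indicator {0..<2 * pi} (snd p) * h p = 0" unfolding lborel_prod .
  then have "AE p in lborel. 0 < ennreal (weight \<alpha> p) \<longrightarrow> h p = 0"
    by eventually_elim (auto simp: weight_def indicator_def split: if_splits)
  then show ?thesis unfolding omega_M_eq by (subst AE_density) auto
qed

lemma ess_self_adjoint_M:
  assumes "\<And>k. limit_point \<alpha> k"
  shows "ess_self_adjoint (omega_M \<alpha>) Cc_M (lap_M \<alpha>)"
proof (rule ess_self_adjoint_criterion)
  have "(\<lambda>_. 0) \<in> Cc_line" unfolding Cc_line_def by (auto intro: smooth1_on_const exI[of _ 1])
  from mode_Cc_M(1)[OF this] show "Cc_M \<noteq> {}" by blast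
  show "L2_inner (omega_M \<alpha>) (lap_M \<alpha> u) v = L2_inner (omega_M \<alpha>) u (lap_M \<alpha> v)"
    if "u \<in> Cc_M" "v \<in> Cc_M" for u v
    unfolding L2_inner_commute[of _ u] M_energy[OF that] M_energy[OF that(2,1)]
    by (simp add: L2_inner_commute[of _ "grad_x v"] L2_inner_commute[of _ "grad_t \<alpha> v"])
  show "L2_inner (omega_M \<alpha>) (lap_M \<alpha> u) u \<le> 0" if "u \<in> Cc_M" for u
    using L2_inner_self_nonneg[of "omega_M \<alpha>" "grad_x u"] L2_inner_self_nonneg[of "omega_M \<alpha>" "grad_t \<alpha> u"]
    unfolding M_energy[OF that that] by linarith
  show "AE p in omega_M \<alpha>. h p = 0" if "L2 (omega_M \<alpha>) h"
    "\<And>u. u \<in> Cc_M \<Longrightarrow> L2_inner (omega_M \<alpha>) (lap_M \<alpha> u) h = L2_inner (omega_M \<alpha>) u h" for h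
    by (rule M_kernel[OF assms that])
qed (auto intro: Cc_M_add_cmult lap_M_add_cmult Cc_M_L2)

section \<open>Lifting pairs from the line to the cylinder\<close>

lemma integral_circle_const: "(LINT t|lborel. indicator {0..<2 * pi} t * c) = 2 * pi * c"
  by simp

lemma L2_lift:
  assumes "L2 (omega_line \<alpha>) v" shows "L2 (omega_M \<alpha>) (\<lambda>p. v (fst p))"
  unfolding L2_omega_M_iff
proof
  have [measurable]: "v \<in> borel_measurable borel" and i: "integrable lborel (\<lambda>x. \<bar>x\<bar> powr (- \<alpha>) * (v x)\<^sup>2)"
    using assms by (auto simp: L2_omega_line_iff)
  show "(\<lambda>p. v (fst p)) \<in> borel_measurable (borel :: (real \<times> real) measure)" by measurable
  then have [measurable]: "(\<lambda>p. weight \<alpha> p * (v (fst p))\<^sup>2) \<in> borel_measurable (lborel \<Otimes>\<^sub>M lborel)"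
    by (simp add: lborel_prod)
  have eq: "weight \<alpha> (x, t) * (v x)\<^sup>2 = indicator {0..<2 * pi} t * (\<bar>x\<bar> powr (- \<alpha>) * (v x)\<^sup>2)" for x t
    by (simp add: weight_def)
  have "integrable (lborel \<Otimes>\<^sub>M lborel) (\<lambda>p. weight \<alpha> p * (v (fst p))\<^sup>2)"
  proof (rule lborel_pair.Fubini_integrable)
    show "integrable lborel (\<lambda>x. LINT t|lborel. norm (weight \<alpha> (x, t) * (v (fst (x, t)))\<^sup>2))"
      using i by (simp add: eq abs_mult)
    show "AE x in lborel. integrable lborel (\<lambda>t. weight \<alpha> (x, t) * (v (fst (x, t)))\<^sup>2)"
      by (rule AE_I2) (simp add: eq circle_integrable)
  qed simp
  then show "integrable lborel (\<lambda>p. weight \<alpha> p * (v (fst p))\<^sup>2)" by (simp add: lborel_prod)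
qed

lemma L2_inner_lift:
  assumes "L2 (omega_line \<alpha>) v" "L2 (omega_line \<alpha>) w"
  shows "L2_inner (omega_M \<alpha>) (\<lambda>p. v (fst p)) (\<lambda>p. w (fst p)) = 2 * pi * L2_inner (omega_line \<alpha>) v w"
proof -
  have "L2_inner (omega_M \<alpha>) (\<lambda>p. v (fst p)) (\<lambda>p. w (fst p)) = (LINT x|lborel. 2 * pi * (\<bar>x\<bar> powr (- \<alpha>) * (v x * w x)))"
    unfolding L2_inner_omega_M_x[OF L2_lift[OF assms(1)] L2_lift[OF assms(2)]] fst_conv integral_circle_const
    by (simp add: mult_ac)
  then show ?thesis using assms by (simp add: L2_inner_omega_line L2_omega_line_iff)
qed

text \<open>A pair independent of the angle sees only the mode 0: the angular term of
  \<open>lap_M \<alpha> u\<close> is an exact angular derivative and integrates to 0 over each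
  circle, while the radial term is handled on every slice of fixed angle.\<close>

lemma boundary_pair_adjoint_M:
  assumes bp: "boundary_pair \<alpha> 0 v w"
  shows "(\<lambda>p. v (fst p), \<lambda>p. w (fst p)) \<in> L2_adjoint (omega_M \<alpha>) (op_graph Cc_M (lap_M \<alpha>))"
proof -
  have L: "L2 (omega_line \<alpha>) v" "L2 (omega_line \<alpha>) w" using bp by (auto simp: boundary_pair_def)
  note LV = L2_lift[OF L(1)] and LW = L2_lift[OF L(2)]
  have "L2_inner (omega_M \<alpha>) (lap_M \<alpha> u) (\<lambda>p. v (fst p)) = L2_inner (omega_M \<alpha>) u (\<lambda>p. w (fst p))" if u: "u \<in> Cc_M" for u
  proof -
    obtain E a b where E: "E 0 0 = u"
      "\<And>i j x t. ((\<lambda>s. E i j (s, t)) has_real_derivative E (Suc i) j (x, t)) (at x)"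
      "\<And>i j x t. ((\<lambda>s. E i j (x, s)) has_real_derivative E i (Suc j) (x, t)) (at t)"
      "\<And>i j p. isCont (E i j) p" "0 < a" "a < b"
      "\<And>i j x t. \<bar>x\<bar> < a \<or> b < \<bar>x\<bar> \<Longrightarrow> E i j (x, t) = 0"
      "\<And>i j x t. E i j (x, t + 2 * pi) = E i j (x, t)" using u by (rule Cc_ME) blast
    define A where "A p = E 2 0 p - \<alpha> / fst p * E 1 0 p" for p
    define B where "B p = \<bar>fst p\<bar> powr (2 * \<alpha>) * E 0 2 p" for p
    have lap: "lap_M \<alpha> u = (\<lambda>p. A p + B p)" unfolding lap_M_eq(3)[OF E(1-3)] by (simp add: A_def B_def)
    have cx: "isCont (\<lambda>p::real \<times> real. \<bar>fst p\<bar> powr s) (x, t)" if "x \<noteq> 0" for x t s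
      using isCont_fst_comp[OF isCont_abs_powr'[OF that], of t s] .
    have LB: "L2 (omega_M \<alpha>) B"
    proof (rule L2_omega_M_annular[OF E(5), of _ b])
      show "isCont B (x, t)" if "x \<noteq> 0" for x t unfolding B_def by (intro continuous_mult E(4) cx that)
    qed (use E(7) in \<open>auto simp: B_def\<close>)
    have LA: "L2 (omega_M \<alpha>) A"
      using L2_diff[OF Cc_M_L2(2)[OF u, of \<alpha>] LB] by (simp add: lap)
    have radial: "(LINT x|lborel. \<bar>x\<bar> powr (- \<alpha>) * (A (x, t) * v x)) = (LINT x|lborel. \<bar>x\<bar> powr (- \<alpha>) * (u (x, t) * w x))" for t
    proof -
      have "(LINT x|lborel. \<bar>x\<bar> powr (- \<alpha>) * ((E 2 0 (x, t) - \<alpha> / x * E 1 0 (x, t) - 0 * \<bar>x\<bar> powr (2 * \<alpha>) * E 0 0 (x, t)) * v x))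
        = (LINT x|lborel. \<bar>x\<bar> powr (- \<alpha>) * (E 0 0 (x, t) * w x))"
        by (rule boundary_pairD[OF bp E(5), of "\<lambda>x. E 0 0 (x, t)" "\<lambda>x. E 1 0 (x, t)" "\<lambda>x. E 2 0 (x, t)" b])
          (use E(2)[of 0 0 t] E(2)[of 1 0 t] E(7) DERIV_isCont[OF E(2)] in \<open>simp_all add: numeral_2_eq_2\<close>)
      then show ?thesis by (simp add: A_def E(1))
    qed
    have "(LINT t|lborel. indicator {0..<2 * pi} t * (B (x, t) * v x)) = 0" for x
    proof -
      have "(LINT t|lborel. indicator {0..<2 * pi} t * E 0 2 (x, t)) = 0"
        by (rule circle_FTC[of "\<lambda>t. E 0 1 (x, t)"])
          (use E(3)[of 0 1 x] E(8)[of 0 1 x 0] DERIV_isCont[OF E(3)] in \<open>simp_all add: numeral_2_eq_2\<close>)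
      moreover have "(LINT t|lborel. indicator {0..<2 * pi} t * (B (x, t) * v x))
          = \<bar>x\<bar> powr (2 * \<alpha>) * v x * (LINT t|lborel. indicator {0..<2 * pi} t * E 0 2 (x, t))"
        by (subst integral_mult_right_zero[symmetric]) (simp add: B_def mult_ac)
      ultimately show ?thesis by simp
    qed
    then have "L2_inner (omega_M \<alpha>) B (\<lambda>p. v (fst p)) = 0"
      unfolding L2_inner_omega_M_x[OF LB LV] by simp
    moreover have "L2_inner (omega_M \<alpha>) A (\<lambda>p. v (fst p)) = L2_inner (omega_M \<alpha>) u (\<lambda>p. w (fst p))"
      unfolding L2_inner_omega_M_t[OF LA LV] L2_inner_omega_M_t[OF Cc_M_L2(1)[OF u] LW] by (simp add: radial)
    ultimately show ?thesis
      unfolding lap using L2_inner_add_left[OF LA LB LV] by simp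
  qed
  then show ?thesis using LV LW by (auto simp: L2_adjoint_def op_graph_def)
qed

lemma not_ess_self_adjoint_M:
  assumes "boundary_pair \<alpha> 0 v\<^sub>1 w\<^sub>1" "boundary_pair \<alpha> 0 v\<^sub>2 w\<^sub>2"
    "L2_inner (omega_line \<alpha>) w\<^sub>1 v\<^sub>2 \<noteq> L2_inner (omega_line \<alpha>) v\<^sub>1 w\<^sub>2"
  shows "\<not> ess_self_adjoint (omega_M \<alpha>) Cc_M (lap_M \<alpha>)"
proof (rule not_ess_self_adjointI[OF _ boundary_pair_adjoint_M[OF assms(1)] boundary_pair_adjoint_M[OF assms(2)]])
  have L: "L2 (omega_line \<alpha>) v\<^sub>1" "L2 (omega_line \<alpha>) w\<^sub>1" "L2 (omega_line \<alpha>) v\<^sub>2" "L2 (omega_line \<alpha>) w\<^sub>2"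
    using assms by (auto simp: boundary_pair_def)
  show "L2_inner (omega_M \<alpha>) (\<lambda>p. w\<^sub>1 (fst p)) (\<lambda>p. v\<^sub>2 (fst p)) \<noteq> L2_inner (omega_M \<alpha>) (\<lambda>p. v\<^sub>1 (fst p)) (\<lambda>p. w\<^sub>2 (fst p))"
    using assms(3) L by (simp add: L2_inner_lift)
qed (auto intro: Cc_M_L2)

theorem mainTheorem3:
  fixes \<alpha> :: real
  shows "(\<alpha> \<le> -3 \<longrightarrow> ess_self_adjoint (omega_M \<alpha>) Cc_M (lap_M \<alpha>))
    \<and> (-3 < \<alpha> \<and> \<alpha> \<le> -1 \<longrightarrow>
         \<not> ess_self_adjoint (omega_line \<alpha>) Cc_line (lap_k \<alpha> 0)
       \<and> (\<forall>k::int. k \<noteq> 0 \<longrightarrow> ess_self_adjoint (omega_line \<alpha>) Cc_line (lap_k \<alpha> k))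
       \<and> \<not> ess_self_adjoint (omega_M \<alpha>) Cc_M (lap_M \<alpha>))
    \<and> (-1 < \<alpha> \<and> \<alpha> < 1 \<longrightarrow>
         (\<forall>k::int. \<not> ess_self_adjoint (omega_line \<alpha>) Cc_line (lap_k \<alpha> k)))
    \<and> (1 \<le> \<alpha> \<longrightarrow> ess_self_adjoint (omega_M \<alpha>) Cc_M (lap_M \<alpha>))"
proof (intro conjI impI allI)
  assume "\<alpha> \<le> -3"
  then show "ess_self_adjoint (omega_M \<alpha>) Cc_M (lap_M \<alpha>)" by (intro ess_self_adjoint_M limit_point_outer) simp
next
  assume \<alpha>: "-3 < \<alpha> \<and> \<alpha> \<le> -1"
  \<comment> \<open>The same two pairs refute self-adjointness for \<open>k = 0\<close> and, lifted,
    on the cylinder.\<close>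
  then obtain v\<^sub>1 w\<^sub>1 v\<^sub>2 w\<^sub>2 where bp: "boundary_pair \<alpha> 0 v\<^sub>1 w\<^sub>1" "boundary_pair \<alpha> 0 v\<^sub>2 w\<^sub>2"
    "L2_inner (omega_line \<alpha>) w\<^sub>1 v\<^sub>2 \<noteq> L2_inner (omega_line \<alpha>) v\<^sub>1 w\<^sub>2"
    using boundary_pairs_middle[of \<alpha>] by blast
  show "\<not> ess_self_adjoint (omega_line \<alpha>) Cc_line (lap_k \<alpha> 0)"
    by (rule not_ess_self_adjoint_line[OF _ _ bp(3)]) (simp_all add: bp)
  show "\<not> ess_self_adjoint (omega_M \<alpha>) Cc_M (lap_M \<alpha>)" by (rule not_ess_self_adjoint_M[OF bp])
  show "ess_self_adjoint (omega_line \<alpha>) Cc_line (lap_k \<alpha> k)" if "k \<noteq> 0" for k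
    by (rule ess_self_adjoint_line[OF limit_point_middle]) (use \<alpha> that in auto)
next
  fix k :: int
  assume "-1 < \<alpha> \<and> \<alpha> < 1"
  then obtain v\<^sub>1 w\<^sub>1 v\<^sub>2 w\<^sub>2 where "boundary_pair \<alpha> ((of_int k)\<^sup>2) v\<^sub>1 w\<^sub>1" "boundary_pair \<alpha> ((of_int k)\<^sup>2) v\<^sub>2 w\<^sub>2"
    "L2_inner (omega_line \<alpha>) w\<^sub>1 v\<^sub>2 \<noteq> L2_inner (omega_line \<alpha>) v\<^sub>1 w\<^sub>2"
    using boundary_pairs_inner[of \<alpha> "of_int k"] by blast
  then show "\<not> ess_self_adjoint (omega_line \<alpha>) Cc_line (lap_k \<alpha> k)" by (rule not_ess_self_adjoint_line)
next
  assume "1 \<le> \<alpha>"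
  then show "ess_self_adjoint (omega_M \<alpha>) Cc_M (lap_M \<alpha>)" by (intro ess_self_adjoint_M limit_point_outer) simp
qed

end
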